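(* Let $d\ge3$ and let $g$ satisfy the assumptions listed in the context. For every $\omega>0$, with $\Phi_\omega$ a ground state as in the context, $L_{\omega,+}:=-\Delta+V_{\omega,+}$, $V_{\omega,+}:=\omega-\frac{d+2}{d-2}\Phi_\omega^{\frac{4}{d-2}}-g'(\Phi_\omega)$ (self-adjoint on $L^2_{\mathrm{real}}(\mathbb{R}^d)$ with domain $H^2(\mathbb{R}^d)$), and $B_\omega(u,v):=\langle\nabla u,\nabla v\rangle+\langle V_{\omega,+}u,v\rangle$: (i) if $u\in H^1(\mathbb{R}^d)$ satisfies $\mathcal{N}_\omega'(\Phi_\omega)u=0$ (equivalently $\langle L_{\omega,+}\Phi_\omega,u\rangle=0$), then $B_\omega(u,u)\ge0$; (ii) $L_{\omega,+}$ has exactly one negative eigenvalue on $L^2_{\mathrm{real}}(\mathbb{R}^d)$, and this eigenvalue has multiplicity one.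
   Context: Let $d\ge3$ and $2^*=\frac{2d}{d-2}$. Assumptions on $g:\mathbb{C}\to\mathbb{C}$ (independent of $\omega$): (a) the restriction of $g$ to $(0,\infty)$ is real-valued and $C^2$, $g(0)=0$, $g(z)=\frac{z}{|z|}g(|z|)$ for all $z\neq0$, and $g'(t)t-g(t)\ge0$ for all $t>0$; (b) there exist $p_1,p_2$ with $\max\{\frac{2}{d-2},1\}<p_1<\frac{d+2}{d-2}$ and $\max\{\frac{d+2}{d-2}-2,p_1\}<p_2<\frac{d+2}{d-2}$, and constants $C_1,C_2>0$, such that $\limsup_{t\to0}|g'(t)|/t^{p_1-1}\le C_1$ and $\lim_{t\to\infty}g'(t)/t^{p_2-1}=C_2$; (c) with $G(t):=\int_0^tg(s)\,ds$, there is $C_3>0$ such that $G(t)-\frac{1}{2^*}g(t)t\ge C_3t^{p_2+1}$ for all $t\ge0$. For $\omega>0$ consider $-\Delta u+\omega u-|u|^{\frac{4}{d-2}}u-g(u)=0$, $u:\mathbb{R}^d\to\mathbb{C}$, with action $\mathcal{S}_\omega(u)=\frac12\|\nabla u\|_{L^2}^2+\frac\omega2\|u\|_{L^2}^2-\frac1{2^*}\|u\|_{L^{2^*}}^{2^*}-\int_{\mathbb{R}^d}G(|u|)$ and Nehari functional $\mathcal{N}_\omega(u)=\|\nabla u\|_{L^2}^2+\omega\|u\|_{L^2}^2-\|u\|_{L^{2^*}}^{2^*}-\int_{\mathbb{R}^d}g(|u|)|u|$, both $C^2$ on $H^1(\mathbb{R}^d)$ viewed as a real Hilbert space; $\mathcal{N}_\omega'(\Phi_\omega)u$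 denotes its Fréchet derivative at $\Phi_\omega$ applied to $u$. A ground state is a minimizer of $\inf\{\mathcal{S}_\omega(u):u\in H^1(\mathbb{R}^d)\setminus\{0\},\ \mathcal{N}_\omega(u)=0\}$. $\Phi_\omega$ denotes a ground state which solves the equation, lies in $H^2\cap C^2$, and is positive, radially symmetric about $0$ and strictly decreasing in $|x|$. $\langle f,g\rangle:=\operatorname{Re}\int_{\mathbb{R}^d}f\bar g\,dx$; $L^2_{\mathrm{real}}(\mathbb{R}^d)$ is $L^2(\mathbb{R}^d)$ regarded as a real Hilbert space with this inner product.
   Formalization: Here u and the eigenfunctions are real-valued: for complex-valued functions over the reals (i) fails at u = iΦ_ω and the negative eigenvalue has real multiplicity two; the parenthetical form ⟨L_{ω,+}Φ_ω,u⟩=0 of the constraint is not stated. *)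

theory Defs
  imports "HOL-Analysis.Analysis"
begin

text \<open>Test functions: C^1 functions with compact support (weak derivatives defined with
C^1_c test functions coincide with those defined with C^infinity_c test functions).\<close>
definition test_fun :: "(real^'n \<Rightarrow> real) \<Rightarrow> bool" where
  "test_fun \<phi> \<longleftrightarrow>
     (\<exists>D. (\<forall>x. (\<phi> has_derivative blinfun_apply (D x)) (at x)) \<and> continuous_on UNIV D) \<and>
     compact (closure {x. \<phi> x \<noteq> 0})"

definition is_weak_deriv ::
  "'n \<Rightarrow> (real^'n \<Rightarrow> 'b::{banach,second_countable_topology}) \<Rightarrow> (real^'n \<Rightarrow> 'b) \<Rightarrow> bool" where
  "is_weak_deriv i u w \<longleftrightarrow> w \<in> borel_measurable lebesgue \<and>
     (\<forall>\<phi>. test_fun \<phi> \<longrightarrow>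
        integrable lebesgue (\<lambda>x. frechet_derivative \<phi> (at x) (axis i 1) *\<^sub>R u x) \<and>
        integrable lebesgue (\<lambda>x. \<phi> x *\<^sub>R w x) \<and>
        (\<integral>x. frechet_derivative \<phi> (at x) (axis i 1) *\<^sub>R u x \<partial>lebesgue)
          = - (\<integral>x. \<phi> x *\<^sub>R w x \<partial>lebesgue))"

definition wderiv :: "'n \<Rightarrow> (real^'n \<Rightarrow> 'b::{banach,second_countable_topology}) \<Rightarrow> real^'n \<Rightarrow> 'b" where
  "wderiv i u = (SOME w. is_weak_deriv i u w)"

definition L2 :: "(real^'n \<Rightarrow> 'b::{banach,second_countable_topology}) \<Rightarrow> bool" where
  "L2 u \<longleftrightarrow> u \<in> borel_measurable lebesgue \<and> integrable lebesgue (\<lambda>x. (norm (u x))\<^sup>2)"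

definition H1 :: "(real^'n \<Rightarrow> 'b::{banach,second_countable_topology}) \<Rightarrow> bool" where
  "H1 u \<longleftrightarrow> L2 u \<and> (\<forall>i. \<exists>w. is_weak_deriv i u w \<and> L2 w)"

definition H2 :: "(real^'n \<Rightarrow> 'b::{banach,second_countable_topology}) \<Rightarrow> bool" where
  "H2 u \<longleftrightarrow> H1 u \<and> (\<forall>i. H1 (wderiv i u))"

definition wlap :: "(real^'n \<Rightarrow> 'b::{banach,second_countable_topology}) \<Rightarrow> real^'n \<Rightarrow> 'b" where
  "wlap u x = (\<Sum>i\<in>UNIV. wderiv i (wderiv i u) x)"

definition grad_sq :: "(real^'n \<Rightarrow> 'b::{banach,second_countable_topology}) \<Rightarrow> real^'n \<Rightarrow> real" where
  "grad_sq u x = (\<Sum>i\<in>UNIV. (norm (wderiv i u x))\<^sup>2)"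

definition C2_fun :: "(real^'n \<Rightarrow> real) \<Rightarrow> bool" where
  "C2_fun f \<longleftrightarrow> (\<exists>D1 D2. (\<forall>x. (f has_derivative blinfun_apply (D1 x)) (at x)) \<and>
                        (\<forall>x. (D1 has_derivative blinfun_apply (D2 x)) (at x)) \<and>
                        continuous_on UNIV D2)"

definition dimR :: "'n itself \<Rightarrow> real" where
  "dimR (_ :: 'n itself) = real CARD('n)"

definition crit :: "'n itself \<Rightarrow> real" where
  "crit T = 2 * dimR T / (dimR T - 2)"

definition gr :: "(complex \<Rightarrow> complex) \<Rightarrow> real \<Rightarrow> real" where
  "gr g t = Re (g (complex_of_real t))"

definition Gp :: "(complex \<Rightarrow> complex) \<Rightarrow> real \<Rightarrow> real" where
  "Gp g t = integral {0..t} (gr g)"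

definition g_assms :: "'n itself \<Rightarrow> (complex \<Rightarrow> complex) \<Rightarrow> bool" where
  "g_assms T g \<longleftrightarrow>
     \<comment> \<open>(a)\<close>
     (\<forall>t>0. Im (g (complex_of_real t)) = 0) \<and>
     (\<forall>t>0. gr g differentiable (at t)) \<and>
     (\<forall>t>0. deriv (gr g) differentiable (at t)) \<and>
     continuous_on {0<..} (deriv (deriv (gr g))) \<and>
     g 0 = 0 \<and>
     (\<forall>z. z \<noteq> 0 \<longrightarrow> g z = (z / complex_of_real (cmod z)) * g (complex_of_real (cmod z))) \<and>
     (\<forall>t>0. deriv (gr g) t * t - gr g t \<ge> 0) \<and>
     \<comment> \<open>(b) and (c)\<close>
     (\<exists>p1 p2 C1 C2 C3.
        max (2 / (dimR T - 2)) 1 < p1 \<and> p1 < (dimR T + 2) / (dimR T - 2) \<and>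
        max ((dimR T + 2) / (dimR T - 2) - 2) p1 < p2 \<and> p2 < (dimR T + 2) / (dimR T - 2) \<and>
        C1 > 0 \<and> C2 > 0 \<and> C3 > 0 \<and>
        Limsup (at_right 0) (\<lambda>t. ereal (\<bar>deriv (gr g) t\<bar> / t powr (p1 - 1))) \<le> ereal C1 \<and>
        ((\<lambda>t. deriv (gr g) t / t powr (p2 - 1)) \<longlongrightarrow> C2) at_top \<and>
        (\<forall>t\<ge>0. Gp g t - (1 / crit T) * gr g t * t \<ge> C3 * t powr (p2 + 1)))"

definition action :: "(complex \<Rightarrow> complex) \<Rightarrow> real \<Rightarrow> (real^'n \<Rightarrow> complex) \<Rightarrow> real" where
  "action g \<omega> u =
     1/2 * (\<integral>x. grad_sq u x \<partial>lebesgue) + \<omega>/2 * (\<integral>x. (cmod (u x))\<^sup>2 \<partial>lebesgue)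
     - 1 / crit TYPE('n) * (\<integral>x. cmod (u x) powr crit TYPE('n) \<partial>lebesgue)
     - (\<integral>x. Gp g (cmod (u x)) \<partial>lebesgue)"

definition nehari :: "(complex \<Rightarrow> complex) \<Rightarrow> real \<Rightarrow> (real^'n \<Rightarrow> complex) \<Rightarrow> real" where
  "nehari g \<omega> u =
     (\<integral>x. grad_sq u x \<partial>lebesgue) + \<omega> * (\<integral>x. (cmod (u x))\<^sup>2 \<partial>lebesgue)
     - (\<integral>x. cmod (u x) powr crit TYPE('n) \<partial>lebesgue)
     - (\<integral>x. gr g (cmod (u x)) * cmod (u x) \<partial>lebesgue)"

definition is_zero :: "(real^'n \<Rightarrow> 'b::zero) \<Rightarrow> bool" where
  "is_zero u \<longleftrightarrow> (AE x in lebesgue. u x = 0)"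

definition ground_state :: "(complex \<Rightarrow> complex) \<Rightarrow> real \<Rightarrow> (real^'n \<Rightarrow> complex) \<Rightarrow> bool" where
  "ground_state g \<omega> \<Phi> \<longleftrightarrow> H1 \<Phi> \<and> \<not> is_zero \<Phi> \<and> nehari g \<omega> \<Phi> = 0 \<and>
     (\<forall>u :: real^'n \<Rightarrow> complex. H1 u \<and> \<not> is_zero u \<and> nehari g \<omega> u = 0 \<longrightarrow> action g \<omega> \<Phi> \<le> action g \<omega> u)"

definition Vp :: "(complex \<Rightarrow> complex) \<Rightarrow> real \<Rightarrow> (real^'n \<Rightarrow> real) \<Rightarrow> real^'n \<Rightarrow> real" where
  "Vp g \<omega> \<Phi> x = \<omega> - (dimR TYPE('n) + 2) / (dimR TYPE('n) - 2) * \<Phi> x powr (4 / (dimR TYPE('n) - 2))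
                  - deriv (gr g) (\<Phi> x)"

definition Lp :: "(complex \<Rightarrow> complex) \<Rightarrow> real \<Rightarrow> (real^'n \<Rightarrow> real) \<Rightarrow> (real^'n \<Rightarrow> real) \<Rightarrow> real^'n \<Rightarrow> real" where
  "Lp g \<omega> \<Phi> u x = - wlap u x + Vp g \<omega> \<Phi> x * u x"

definition Bform :: "(complex \<Rightarrow> complex) \<Rightarrow> real \<Rightarrow> (real^'n \<Rightarrow> real) \<Rightarrow> (real^'n \<Rightarrow> real) \<Rightarrow> (real^'n \<Rightarrow> real) \<Rightarrow> real" where
  "Bform g \<omega> \<Phi> u v = (\<integral>x. (\<Sum>i\<in>UNIV. wderiv i u x * wderiv i v x) \<partial>lebesgue)
                       + (\<integral>x. Vp g \<omega> \<Phi> x * u x * v x \<partial>lebesgue)"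

definition Lp_eigen :: "(complex \<Rightarrow> complex) \<Rightarrow> real \<Rightarrow> (real^'n \<Rightarrow> real) \<Rightarrow> real \<Rightarrow> (real^'n \<Rightarrow> real) \<Rightarrow> bool" where
  "Lp_eigen g \<omega> \<Phi> lam u \<longleftrightarrow> H2 u \<and> (AE x in lebesgue. Lp g \<omega> \<Phi> u x = lam * u x)"

end

theory Submission
  imports Defs
begin

text \<open>
  Weak derivatives are the generators of the translation group on \<open>L\<^sup>2\<close>, so that integration by parts,
  Nirenberg's difference quotients and \<open>H\<^sup>2\<close> regularity become statements about a strongly continuous
  group of isometries of a Hilbert space.

  Nonnegativity of the form on the tangent space of the Nehari manifold at \<open>\<Phi>\<close>: given a tangent
  direction \<open>u\<close>, the intermediate value theorem applied to \<open>\<rho> \<mapsto> N (\<Phi> + s (u + \<rho> \<Phi>))\<close> yields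
  \<open>s\<^sub>k \<rightarrow> 0\<close> and \<open>\<rho>\<^sub>k \<rightarrow> 0\<close> on the constraint, because the derivative of the Nehari functional in
  the direction \<open>\<Phi>\<close> is \<open>B \<Phi> \<Phi> < 0\<close>; minimality and a second-order Taylor expansion of the action give
  \<open>B u u \<ge> 0\<close>.

  The form is thus nonnegative on a hyperplane and negative at \<open>\<Phi>\<close>. For that reason a minimizing
  sequence of the Rayleigh quotient is Cauchy up to signs, its limit is an eigenfunction, and two
  independent eigenfunctions with negative eigenvalues cannot exist, since some combination of them
  would lie in the hyperplane. Neither compactness nor a Sobolev embedding is needed.
\<close>

text \<open>The obstacle is that a direction in the energy space is not known to have an integrable
  power \<open>q = 2d/(d-2)\<close>, so the nonlinear functionals cannot be expanded along it. The
  argument therefore lives on two levels. The potential is bounded, since \<Phi> is largest at the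
  origin, so \<open>B\<close> makes sense on all of \<open>h1\<close>; the functionals are expanded
  only along \<open>adm\<close> directions. Ball averages connect the levels: they are bounded
  functions, they commute with translations and hence with weak derivatives, and they converge
  together with those derivatives, so nonnegativity passes from bounded tangents to all of them. In
  part (i) the Nehari functional is differentiated along a line, where a divergent integral counts
  as 0; differentiability at 0 itself then forces the direction to be admissible. The operator
  \<open>wderiv\<close> is an arbitrary choice among weak derivatives, not square integrable by
  definition; a fundamental lemma for locally integrable functions ties it to the Hilbert space. For
  \<open>H^2\<close> regularity, bounded difference quotients would give weak limits only; applied
  to differences of Steklov averages, the same estimate makes the quotients Cauchy.\<close>

lemma L2D: "L2 u \<Longrightarrow> u \<in> borel_measurable lebesgue"
  "L2 u \<Longrightarrow> integrable lebesgue (\<lambda>x. (norm (u x))\<^sup>2)"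
  by (auto simp: L2_def)

lemma L2_real: "L2 (u :: real^'n \<Rightarrow> real) \<longleftrightarrow>
    u \<in> borel_measurable lebesgue \<and> integrable lebesgue (\<lambda>x. (u x)\<^sup>2)"
  by (simp add: L2_def)

lemma L2_mult_integrable:
  fixes u v :: "real^'n \<Rightarrow> real"
  assumes "L2 u" "L2 v"
  shows "integrable lebesgue (\<lambda>x. u x * v x)"
proof (rule Bochner_Integration.integrable_bound)
  show "integrable lebesgue (\<lambda>x. (u x)\<^sup>2 + (v x)\<^sup>2)"
    using assms by (auto simp: L2_real)
  show "(\<lambda>x. u x * v x) \<in> borel_measurable lebesgue"
    using assms by (auto simp: L2_real)
  have "\<bar>a * b\<bar> \<le> \<bar>a\<^sup>2 + b\<^sup>2\<bar>" for a b :: real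
  proof -
    have "2 * (\<bar>a\<bar> * \<bar>b\<bar>) \<le> a\<^sup>2 + b\<^sup>2"
      using sum_squares_bound[of "\<bar>a\<bar>" "\<bar>b\<bar>"] by (simp add: mult.assoc)
    moreover have "0 \<le> \<bar>a\<bar> * \<bar>b\<bar>" by simp
    ultimately show ?thesis unfolding abs_mult by linarith
  qed
  then show "AE x in lebesgue. norm (u x * v x) \<le> norm ((u x)\<^sup>2 + (v x)\<^sup>2)"
    by auto
qed

lemma L2_add:
  fixes u v :: "real^'n \<Rightarrow> real"
  assumes "L2 u" "L2 v"
  shows "L2 (\<lambda>x. u x + v x)"
  using assms L2_mult_integrable[OF assms]
  unfolding L2_real power2_sum by (auto simp: mult.assoc)

lemma L2_scale: "L2 u \<Longrightarrow> L2 (\<lambda>x. c * u x)" for u :: "real^'n \<Rightarrow> real"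
  by (auto simp: L2_real power_mult_distrib)

lemma L2_uminus: "L2 u \<Longrightarrow> L2 (\<lambda>x. - u x)" for u :: "real^'n \<Rightarrow> real"
  by (auto simp: L2_real)

lemma L2_diff:
  fixes u v :: "real^'n \<Rightarrow> real"
  shows "L2 u \<Longrightarrow> L2 v \<Longrightarrow> L2 (\<lambda>x. u x - v x)"
  using L2_add[OF _ L2_uminus, of u v] by simp

lemma L2_zero [simp]: "L2 (\<lambda>x. 0 :: real)"
  by (simp add: L2_real)

lemma L2_cong_AE:
  fixes u v :: "real^'n \<Rightarrow> real"
  assumes "L2 u" "v \<in> borel_measurable lebesgue" "AE x in lebesgue. u x = v x"
  shows "L2 v"
  unfolding L2_real
proof
  show "integrable lebesgue (\<lambda>x. (v x)\<^sup>2)"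
  proof (rule integrable_cong_AE_imp)
    show "integrable lebesgue (\<lambda>x. (u x)\<^sup>2)" using assms by (simp add: L2_real)
    show "AE x in lebesgue. (u x)\<^sup>2 = (v x)\<^sup>2" using assms(3) by eventually_elim simp
  qed (use assms in measurable)
qed (use assms in auto)

lemma L2_bound:
  fixes u v :: "real^'n \<Rightarrow> real"
  assumes "L2 u" "v \<in> borel_measurable lebesgue" "AE x in lebesgue. \<bar>v x\<bar> \<le> \<bar>u x\<bar>"
  shows "L2 v"
  unfolding L2_real
proof
  show "integrable lebesgue (\<lambda>x. (v x)\<^sup>2)"
    by (rule Bochner_Integration.integrable_bound[of _ "\<lambda>x. (u x)\<^sup>2"])
       (use assms in \<open>auto simp: L2_real elim!: eventually_mono simp: abs_le_square_iff\<close>)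
qed (use assms in auto)

subsection \<open>The Hilbert space of square-integrable functions modulo null sets\<close>

text \<open>Reflexive only on square-integrable functions: the partial quotient builds membership in
  \<open>L2\<close> into the type, and \<open>abs_lsq u\<close> is meaningful only together with
  \<open>L2 u\<close>.\<close>

definition L2_eq :: "(real^'n \<Rightarrow> real) \<Rightarrow> (real^'n \<Rightarrow> real) \<Rightarrow> bool" where
  "L2_eq u v \<longleftrightarrow> L2 u \<and> L2 v \<and> (AE x in lebesgue. u x = v x)"

quotient_type (overloaded) 'n lsq = "real^'n \<Rightarrow> real" / partial: L2_eq
proof (rule part_equivpI)
  show "\<exists>x. L2_eq x x" by (rule exI[of _ "\<lambda>x. 0"]) (simp add: L2_eq_def)
  show "symp L2_eq" by (auto simp: symp_def L2_eq_def elim: eventually_mono)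
  show "transp L2_eq" by (auto simp: transp_def L2_eq_def elim: eventually_elim2)
qed

lemma L2_eq_refl: "L2_eq u u \<longleftrightarrow> L2 u"
  by (simp add: L2_eq_def)

lemma L2_rep: "L2 (rep_lsq a)"
  using Quotient_rep_reflp[OF Quotient_lsq, of a] by (simp add: L2_eq_def)

lemma abs_rep_lsq [simp]: "abs_lsq (rep_lsq a) = a"
  using Quotient_abs_rep[OF Quotient_lsq] .

lemma abs_lsq_eq_iff: "L2 u \<Longrightarrow> L2 v \<Longrightarrow> abs_lsq u = abs_lsq v \<longleftrightarrow> (AE x in lebesgue. u x = v x)"
  using Quotient_rel_abs[OF Quotient_lsq, of u v] Quotient_rel[OF Quotient_lsq, of u v]
  by (auto simp: L2_eq_def)

lemma rep_abs_AE: "L2 u \<Longrightarrow> AE x in lebesgue. rep_lsq (abs_lsq u) x = u x"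
  using abs_lsq_eq_iff[OF L2_rep, of u "abs_lsq u"] by simp

instantiation lsq :: (finite) real_inner
begin

lift_definition zero_lsq :: "'a lsq" is "\<lambda>x. 0" by (simp add: L2_eq_def)

lift_definition plus_lsq :: "'a lsq \<Rightarrow> 'a lsq \<Rightarrow> 'a lsq" is "\<lambda>u v x. u x + v x"
  by (auto simp: L2_eq_def intro: L2_add elim: eventually_elim2)

lift_definition minus_lsq :: "'a lsq \<Rightarrow> 'a lsq \<Rightarrow> 'a lsq" is "\<lambda>u v x. u x - v x"
  by (auto simp: L2_eq_def intro: L2_diff elim: eventually_elim2)

lift_definition uminus_lsq :: "'a lsq \<Rightarrow> 'a lsq" is "\<lambda>u x. - u x"
  by (auto simp: L2_eq_def intro: L2_uminus)

lift_definition scaleR_lsq :: "real \<Rightarrow> 'a lsq \<Rightarrow> 'a lsq" is "\<lambda>c u x. c * u x"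
  by (auto simp: L2_eq_def intro: L2_scale elim: eventually_mono)

lift_definition inner_lsq :: "'a lsq \<Rightarrow> 'a lsq \<Rightarrow> real" is "\<lambda>u v. \<integral>x. u x * v x \<partial>lebesgue"
  by (auto simp: L2_eq_def L2_real intro!: integral_cong_AE elim: eventually_elim2)

definition norm_lsq :: "'a lsq \<Rightarrow> real" where "norm_lsq a = sqrt (inner a a)"
definition dist_lsq :: "'a lsq \<Rightarrow> 'a lsq \<Rightarrow> real" where "dist_lsq a b = norm (a - b)"
definition sgn_lsq :: "'a lsq \<Rightarrow> 'a lsq" where "sgn_lsq a = scaleR (inverse (norm a)) a"
definition uniformity_lsq :: "('a lsq \<times> 'a lsq) filter" where
  "uniformity_lsq = (INF e\<in>{0 <..}. principal {(x, y). dist x y < e})"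
definition open_lsq :: "'a lsq set \<Rightarrow> bool" where
  "open_lsq S = (\<forall>x\<in>S. \<forall>\<^sub>F (x', y) in uniformity. x' = x \<longrightarrow> y \<in> S)"

instance
proof
  fix a b c :: "'a lsq" and r s :: real
  show "dist a b = norm (a - b)" by (simp add: dist_lsq_def)
  show "sgn a = scaleR (inverse (norm a)) a" by (simp add: sgn_lsq_def)
  show "uniformity = (INF e\<in>{0 <..}. principal {(x, y :: 'a lsq). dist x y < e})"
    by (simp add: uniformity_lsq_def)
  show "open S = (\<forall>x\<in>S. \<forall>\<^sub>F (x', y) in uniformity. x' = x \<longrightarrow> y \<in> S)" for S :: "'a lsq set"
    by (simp add: open_lsq_def)
  show "norm a = sqrt (inner a a)" by (simp add: norm_lsq_def)
  show "a + b + c = a + (b + c)" by transfer (auto simp: L2_eq_def algebra_simps intro: L2_add)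
  show "a + b = b + a" by transfer (auto simp: L2_eq_def algebra_simps intro: L2_add)
  show "0 + a = a" by transfer (auto simp: L2_eq_def)
  show "- a + a = 0" by transfer (auto simp: L2_eq_def)
  show "a - b = a + - b" by transfer (auto simp: L2_eq_def intro: L2_diff)
  show "r *\<^sub>R (a + b) = r *\<^sub>R a + r *\<^sub>R b"
    by transfer (auto simp: L2_eq_def algebra_simps intro!: L2_add L2_scale)
  show "(r + s) *\<^sub>R a = r *\<^sub>R a + s *\<^sub>R a"
    by transfer (auto simp: L2_eq_def algebra_simps intro!: L2_add L2_scale)
  show "r *\<^sub>R s *\<^sub>R a = (r * s) *\<^sub>R a"
    by transfer (auto simp: L2_eq_def algebra_simps intro!: L2_add L2_scale)
  show "1 *\<^sub>R a = a" by transfer (auto simp: L2_eq_def)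
  show "inner a b = inner b a" by transfer (simp add: mult.commute)
  show "inner (a + b) c = inner a c + inner b c"
    by transfer (simp add: L2_eq_refl distrib_right L2_mult_integrable)
  show "inner (r *\<^sub>R a) b = r * inner a b"
    by transfer (simp add: mult.assoc)
  show "0 \<le> inner a a"
    by transfer simp
  show "inner a a = 0 \<longleftrightarrow> a = 0"
    by transfer
      (auto simp: L2_eq_def L2_real integral_nonneg_eq_0_iff_AE simp flip: power2_eq_square)
qed
end

lemma inner_abs_lsq: "L2 u \<Longrightarrow> L2 v \<Longrightarrow> inner (abs_lsq u) (abs_lsq v) = (\<integral>x. u x * v x \<partial>lebesgue)"
  by (simp add: inner_lsq.abs_eq L2_eq_refl)

lemma norm_abs_lsq: "L2 u \<Longrightarrow> (norm (abs_lsq u))\<^sup>2 = (\<integral>x. (u x)\<^sup>2 \<partial>lebesgue)"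
  by (simp add: power2_norm_eq_inner inner_abs_lsq flip: power2_eq_square)

lemma norm_rep_lsq: "(norm a)\<^sup>2 = (\<integral>x. (rep_lsq a x)\<^sup>2 \<partial>lebesgue)"
  using norm_abs_lsq[OF L2_rep, of a] by simp

lemma abs_lsq_add: "L2 u \<Longrightarrow> L2 v \<Longrightarrow> abs_lsq (\<lambda>x. u x + v x) = abs_lsq u + abs_lsq v"
  by (simp add: plus_lsq.abs_eq L2_eq_refl)

lemma abs_lsq_diff: "L2 u \<Longrightarrow> L2 v \<Longrightarrow> abs_lsq (\<lambda>x. u x - v x) = abs_lsq u - abs_lsq v"
  by (simp add: minus_lsq.abs_eq L2_eq_refl)

lemma abs_lsq_scale: "L2 u \<Longrightarrow> abs_lsq (\<lambda>x. c * u x) = c *\<^sub>R abs_lsq u"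
  by (simp add: scaleR_lsq.abs_eq L2_eq_refl)

lemma abs_lsq_eq_0_iff: "L2 u \<Longrightarrow> abs_lsq u = 0 \<longleftrightarrow> (AE x in lebesgue. u x = 0)"
  unfolding zero_lsq.abs_eq by (simp add: abs_lsq_eq_iff)

lemma rep_diff_AE: "AE x in lebesgue. rep_lsq (a - b) x = rep_lsq a x - rep_lsq b x"
  using rep_abs_AE[OF L2_diff[OF L2_rep L2_rep, of a b]] by (simp add: abs_lsq_diff L2_rep)

lemma nn_integral_rep_sq: "(\<integral>\<^sup>+x. ennreal ((rep_lsq a x)\<^sup>2) \<partial>lebesgue) = ennreal ((norm a)\<^sup>2)"
  unfolding norm_rep_lsq using L2_rep[of a] by (intro nn_integral_eq_integral) (auto simp: L2_real)

text \<open>Terms of a convergent series are eventually below 1, so \<open>\<bar>d n\<bar>\<close>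
  is eventually at most \<open>2^(-n/2)\<close>. The weight converts a series of squares, which can
  be integrated term by term, into absolute summability of the increments at almost every
  point.\<close>

lemma summable_of_weighted_squares:
  fixes d :: "nat \<Rightarrow> real"
  assumes "(\<Sum>n. ennreal (2^n * (d n)\<^sup>2)) \<noteq> \<infinity>"
  shows "summable d"
proof -
  have "summable (\<lambda>n. 2^n * (d n)\<^sup>2)"
    using assms by (intro summable_suminf_not_top) auto
  then have "(\<lambda>n. 2^n * (d n)\<^sup>2) \<longlonglongrightarrow> 0" by (rule summable_LIMSEQ_zero)
  then have "eventually (\<lambda>n. 2^n * (d n)\<^sup>2 < 1) sequentially"
    by (rule order_tendstoD) simp
  then have ev: "eventually (\<lambda>n. norm (d n) \<le> (1 / sqrt 2)^n) sequentially"
  proof eventually_elim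
    case (elim n)
    have "(d n)\<^sup>2 \<le> ((1 / sqrt 2)^n)\<^sup>2"
    proof -
      have "((1 / sqrt 2)^n)\<^sup>2 = ((1 / sqrt 2)\<^sup>2)^n"
        by (metis power_mult mult.commute)
      also have "\<dots> = 1 / 2^n" by (simp add: power_divide)
      finally have "((1 / sqrt 2)^n)\<^sup>2 = 1 / 2^n" .
      with elim show ?thesis by (simp add: field_simps)
    qed
    then have "\<bar>d n\<bar> \<le> \<bar>(1 / sqrt 2)^n\<bar>" by (simp only: abs_le_square_iff)
    then show ?case by simp
  qed
  have "summable (\<lambda>n. (1 / sqrt 2 :: real)^n)" by (rule summable_geometric) simp
  then show ?thesis by (rule summable_comparison_test_ev[OF ev])
qed

instance lsq :: (finite) complete_space
proof
  fix X :: "nat \<Rightarrow> 'a lsq"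
  assume X: "Cauchy X"
  have "\<exists>r. strict_mono r \<and> (\<forall>n. norm (X (r (Suc n)) - X (r n)) < (1/2)^n)"
  proof -
    have "\<exists>N. \<forall>m\<ge>N. \<forall>n\<ge>N. norm (X m - X n) < (1/2)^k" for k :: nat
      using X unfolding Cauchy_iff by simp
    then obtain N where N: "\<And>k m n. m \<ge> N k \<Longrightarrow> n \<ge> N k \<Longrightarrow> norm (X m - X n) < (1/2)^k"
      by metis
    define r where "r = rec_nat (N 0) (\<lambda>n rn. max (N (Suc n)) (Suc rn))"
    have r_Suc: "r (Suc n) = max (N (Suc n)) (Suc (r n))" and r_0: "r 0 = N 0" for n
      by (simp_all add: r_def)
    have rN: "r n \<ge> N n" for n by (cases n) (auto simp: r_Suc r_0)
    have sm: "strict_mono r" by (simp add: strict_mono_Suc_iff r_Suc less_max_iff_disj)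
    have "norm (X (r (Suc n)) - X (r n)) < (1/2)^n" for n
      by (rule N) (use rN[of n] strict_monoD[OF sm, of n "Suc n"] in auto)
    with sm show ?thesis by blast
  qed
  then obtain r where r: "strict_mono r"
    and small: "\<And>n. norm (X (r (Suc n)) - X (r n)) < (1/2)^n" by blast
  define u where "u n = rep_lsq (X (r n))" for n
  have [measurable]: "u n \<in> borel_measurable lebesgue" for n
    using L2_rep by (auto simp: u_def L2_real)
  have nn: "(\<integral>\<^sup>+x. ennreal ((u m x - u n x)\<^sup>2) \<partial>lebesgue) = ennreal ((norm (X (r m) - X (r n)))\<^sup>2)" for m n
  proof -
    have "(\<integral>\<^sup>+x. ennreal ((u m x - u n x)\<^sup>2) \<partial>lebesgue)
      = (\<integral>\<^sup>+x. ennreal ((rep_lsq (X (r m) - X (r n)) x)\<^sup>2) \<partial>lebesgue)"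
      using rep_diff_AE[of "X (r m)" "X (r n)"]
      by (intro nn_integral_cong_AE) (auto simp: u_def elim!: eventually_mono)
    then show ?thesis by (simp add: nn_integral_rep_sq)
  qed
  \<comment> \<open>Increments along the subsequence have norm below \<open>(1/2)^n\<close>, so
    their squares carry \<open>(1/4)^n\<close>; the weight \<open>2^n\<close> still leaves a
    geometric series with sum 2.\<close>
  have AE_conv: "AE x in lebesgue. convergent (\<lambda>n. u n x)"
  proof -
    have "(\<integral>\<^sup>+x. (\<Sum>n. ennreal (2^n * (u (Suc n) x - u n x)\<^sup>2)) \<partial>lebesgue)
        = (\<Sum>n. (\<integral>\<^sup>+x. ennreal (2^n * (u (Suc n) x - u n x)\<^sup>2) \<partial>lebesgue))"
      by (rule nn_integral_suminf) measurable
    also have "\<dots> \<le> (\<Sum>n. ennreal ((1/2)^n))"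
    proof (rule suminf_le)
      fix n
      have "(\<integral>\<^sup>+x. ennreal (2^n * (u (Suc n) x - u n x)\<^sup>2) \<partial>lebesgue)
        = ennreal (2^n) * ennreal ((norm (X (r (Suc n)) - X (r n)))\<^sup>2)"
        by (simp add: ennreal_mult nn_integral_cmult nn)
      also have "\<dots> \<le> ennreal (2^n) * ennreal (((1/2)^n)\<^sup>2)"
        using small[of n] by (intro mult_left_mono ennreal_leI power_mono) auto
      also have "\<dots> = ennreal ((1/2)^n)"
        by (simp add: ennreal_mult[symmetric] power2_eq_square power_divide)
      finally show "(\<integral>\<^sup>+x. ennreal (2^n * (u (Suc n) x - u n x)\<^sup>2) \<partial>lebesgue) \<le> ennreal ((1/2)^n)" .
    qed auto
    also have "\<dots> < \<infinity>"
      by (subst suminf_ennreal_eq[of _ 2]) (auto simp: power_divide sums_def intro: geometric_sums[of "1/2::real", simplified, unfolded sums_def])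
    finally have "AE x in lebesgue. (\<Sum>n. ennreal (2^n * (u (Suc n) x - u n x)\<^sup>2)) \<noteq> \<infinity>"
      by (intro nn_integral_PInf_AE) auto
    then show ?thesis
    proof eventually_elim
      case (elim x)
      have "summable (\<lambda>n. u (Suc n) x - u n x)"
        by (rule summable_of_weighted_squares) (use elim in simp)
      then have "convergent (\<lambda>n. \<Sum>i<n. u (Suc i) x - u i x)" by (simp add: summable_iff_convergent)
      then have "convergent (\<lambda>n. u n x - u 0 x)"
        by (simp add: sum_lessThan_telescope[of "\<lambda>n. u n x"])
      from convergent_add[OF this convergent_const[of "u 0 x"]]
      have "convergent (\<lambda>n. u n x)" by simp
      then show ?case by simp
    qed
  qed
  define w where "w x = lim (\<lambda>n. u n x)" for x
  have [measurable]: "w \<in> borel_measurable lebesgue"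
    unfolding w_def by measurable
  have AE_w: "AE x in lebesgue. (\<lambda>n. u n x) \<longlonglongrightarrow> w x"
    using AE_conv by eventually_elim (simp add: w_def convergent_LIMSEQ_iff)
  \<comment> \<open>Fatou in \<open>m\<close> transfers the Cauchy bound to the almost everywhere
    limit, giving both square integrability and smallness of \<open>w - u n\<close>.\<close>
  have fatou: "(\<integral>\<^sup>+x. ennreal ((w x - u n x)\<^sup>2) \<partial>lebesgue) \<le> ennreal (e\<^sup>2)"
    if e: "e > 0" and le: "\<And>m. m \<ge> n \<Longrightarrow> norm (X (r m) - X (r n)) \<le> e" for e n
  proof -
    have "(\<integral>\<^sup>+x. ennreal ((w x - u n x)\<^sup>2) \<partial>lebesgue)
       = (\<integral>\<^sup>+x. liminf (\<lambda>m. ennreal ((u m x - u n x)\<^sup>2)) \<partial>lebesgue)"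
    proof (rule nn_integral_cong_AE, use AE_w in eventually_elim)
      case (elim x)
      then have "(\<lambda>m. ennreal ((u m x - u n x)\<^sup>2)) \<longlonglongrightarrow> ennreal ((w x - u n x)\<^sup>2)"
        by (intro tendsto_intros) auto
      from lim_imp_Liminf[OF sequentially_bot this] show ?case by simp
    qed
    also have "\<dots> \<le> liminf (\<lambda>m. (\<integral>\<^sup>+x. ennreal ((u m x - u n x)\<^sup>2) \<partial>lebesgue))"
      by (rule nn_integral_liminf) measurable
    also have "\<dots> \<le> liminf (\<lambda>m. ennreal (e\<^sup>2))"
    proof (rule Liminf_mono)
      show "\<forall>\<^sub>F m in sequentially. (\<integral>\<^sup>+x. ennreal ((u m x - u n x)\<^sup>2) \<partial>lebesgue) \<le> ennreal (e\<^sup>2)"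
        using eventually_ge_at_top[of n] by eventually_elim (auto simp: nn intro!: ennreal_leI power_mono le)
    qed
    finally show ?thesis by (simp add: Liminf_const)
  qed
  have close: "L2 (\<lambda>x. w x - u n x) \<and> norm (abs_lsq (\<lambda>x. w x - u n x)) \<le> e"
    if e: "e > 0" and le: "\<And>m. m \<ge> n \<Longrightarrow> norm (X (r m) - X (r n)) \<le> e" for e n
  proof -
    have nnle: "(\<integral>\<^sup>+x. ennreal ((w x - u n x)\<^sup>2) \<partial>lebesgue) \<le> ennreal (e\<^sup>2)" by (rule fatou[OF that])
    then have int: "integrable lebesgue (\<lambda>x. (w x - u n x)\<^sup>2)"
      by (intro integrableI_bounded) (auto intro: le_less_trans)
    then have L: "L2 (\<lambda>x. w x - u n x)" by (auto simp: L2_real)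
    have "ennreal ((norm (abs_lsq (\<lambda>x. w x - u n x)))\<^sup>2) \<le> ennreal (e\<^sup>2)"
      using nnle int by (simp add: norm_abs_lsq[OF L] nn_integral_eq_integral)
    then have "(norm (abs_lsq (\<lambda>x. w x - u n x)))\<^sup>2 \<le> e\<^sup>2" by simp
    then show ?thesis using L e by (auto intro: power2_le_imp_le)
  qed
  have XrC: "Cauchy (\<lambda>n. X (r n))" using Cauchy_subseq_Cauchy[OF X r] by (simp add: o_def)
  have ex: "\<exists>M. \<forall>n\<ge>M. L2 (\<lambda>x. w x - u n x) \<and> norm (abs_lsq (\<lambda>x. w x - u n x)) \<le> e" if e: "e > 0" for e
  proof -
    obtain M where M: "\<And>m n. m \<ge> M \<Longrightarrow> n \<ge> M \<Longrightarrow> norm (X (r m) - X (r n)) < e"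
      using XrC e unfolding Cauchy_iff by meson
    show ?thesis
      by (intro exI[of _ M] allI impI close) (use e M in \<open>auto intro: less_imp_le\<close>)
  qed
  have Lw: "L2 w"
  proof -
    obtain M where "L2 (\<lambda>x. w x - u M x)" using ex[of 1] by auto
    from L2_add[OF this, of "u M"] show ?thesis using L2_rep by (auto simp: u_def)
  qed
  have "(\<lambda>n. X (r n)) \<longlonglongrightarrow> abs_lsq w"
  proof (rule LIMSEQ_I)
    fix e :: real assume e: "e > 0"
    then obtain M where M: "\<forall>n\<ge>M. norm (abs_lsq (\<lambda>x. w x - u n x)) \<le> e/2" using ex[of "e/2"] by auto
    have "norm (X (r n) - abs_lsq w) < e" if "n \<ge> M" for n
      using M[rule_format, OF that] e Lw
      by (simp add: abs_lsq_diff u_def L2_rep norm_minus_commute)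
    then show "\<exists>no. \<forall>n\<ge>no. norm (X (r n) - abs_lsq w) < e" by blast
  qed
  then show "convergent X"
    using Cauchy_converges_subseq[OF X r, of "abs_lsq w"] by (auto simp: o_def convergent_def)
qed

instance lsq :: (finite) banach ..

subsection \<open>Translations\<close>

text \<open>The completed sigma-algebra is larger than the Borel one, so continuity does not
  suffice; the preimage of a set is its image under the opposite translation, which is again a
  Lebesgue set.\<close>

lemma measurable_plus_lebesgue [measurable]:
  "(\<lambda>x. x + a) \<in> lebesgue \<rightarrow>\<^sub>M (lebesgue :: 'a::euclidean_space measure)"
proof (rule measurableI)
  fix A :: "'a set" assume "A \<in> sets lebesgue"
  then have "(\<lambda>x. - a + x) ` A \<in> sets lebesgue" by (rule lebesgue_sets_translation)
  also have "(\<lambda>x. - a + x) ` A = (\<lambda>x. x + a) -` A \<inter> space lebesgue"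
    by (auto simp: image_iff) (metis add.commute add_diff_cancel_right' uminus_add_conv_diff)
  finally show "(\<lambda>x. x + a) -` A \<inter> space lebesgue \<in> sets lebesgue" .
qed auto

lemma distr_plus_lebesgue:
  "distr lebesgue lebesgue (\<lambda>x. x + a) = (lebesgue :: 'a::euclidean_space measure)"
proof (rule measure_eqI)
  fix A :: "'a set" assume A: "A \<in> sets (distr lebesgue lebesgue (\<lambda>x. x + a))"
  have "emeasure (distr lebesgue lebesgue (\<lambda>x. x + a)) A
      = emeasure lebesgue ((\<lambda>x. x + a) -` A \<inter> space lebesgue)"
    using A by (intro emeasure_distr) auto
  also have "(\<lambda>x. x + a) -` A \<inter> space lebesgue = (\<lambda>x. x - a) ` A"
    by (auto simp: image_iff) (metis add_diff_cancel_right')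
  also have "emeasure lebesgue ((\<lambda>x. x - a) ` A) = emeasure lebesgue A"
    using A emeasure_lebesgue_affine[of 1 "-a" A] by (simp del: emeasure_completion)
  finally show "emeasure (distr lebesgue lebesgue (\<lambda>x. x + a)) A = emeasure lebesgue A" .
qed simp

lemma integrable_translate:
  fixes f :: "'a::euclidean_space \<Rightarrow> real"
  assumes "integrable lebesgue f"
  shows "integrable lebesgue (\<lambda>x. f (x + a))"
  by (rule integrable_distr[of "\<lambda>x. x + a" lebesgue lebesgue])
     (use assms in \<open>simp_all add: distr_plus_lebesgue\<close>)

lemma integral_translate:
  fixes f :: "'a::euclidean_space \<Rightarrow> real"
  assumes "f \<in> borel_measurable lebesgue"
  shows "(\<integral>x. f (x + a) \<partial>lebesgue) = (\<integral>x. f x \<partial>lebesgue)"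
  using integral_distr[of "\<lambda>x. x + a" lebesgue lebesgue f] assms by (simp add: distr_plus_lebesgue)

lemma AE_translate:
  fixes P :: "'a::euclidean_space \<Rightarrow> bool"
  assumes "AE x in lebesgue. P x"
  shows "AE x in lebesgue. P (x + a)"
proof -
  have "AE x in distr lebesgue lebesgue (\<lambda>x. x + a). P x"
    using assms by (simp only: distr_plus_lebesgue)
  then show ?thesis by (rule AE_distrD[rotated]) simp
qed

lemma L2_translate:
  fixes u :: "real^'n \<Rightarrow> real"
  assumes "L2 u" shows "L2 (\<lambda>x. u (x + a))"
  using assms integrable_translate[of "\<lambda>x. (u x)\<^sup>2" a] by (auto simp: L2_real)

lift_definition tr :: "real^'n \<Rightarrow> 'n lsq \<Rightarrow> 'n lsq" is "\<lambda>a u x. u (x + a)"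
  unfolding L2_eq_def by (intro conjI L2_translate AE_translate) auto

lemma tr_abs: "L2 u \<Longrightarrow> tr a (abs_lsq u) = abs_lsq (\<lambda>x. u (x + a))"
  by (simp add: tr.abs_eq L2_eq_refl)

lemma inner_tr_tr [simp]: "inner (tr a u) (tr a v) = inner u v"
proof transfer
  fix a :: "real^'a" and u v :: "real^'a \<Rightarrow> real"
  assume "L2_eq u u" "L2_eq v v"
  then show "(\<integral>x. u (x + a) * v (x + a) \<partial>lebesgue) = (\<integral>x. u x * v x \<partial>lebesgue)"
    using integral_translate[of "\<lambda>x. u x * v x" a] by (auto simp: L2_eq_refl L2_real)
qed

lemma tr_tr: "tr a (tr b u) = tr (a + b) u"
proof transfer
  fix a b :: "real^'a" and u :: "real^'a \<Rightarrow> real"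
  assume "L2_eq u u"
  then show "L2_eq (\<lambda>x. u (x + a + b)) (\<lambda>x. u (x + (a + b)))"
    using L2_translate[of u "a + b"] by (simp add: L2_eq_def add.assoc)
qed

lemma tr_0 [simp]: "tr 0 u = u"
  by transfer (auto simp: L2_eq_def)

lemma norm_tr [simp]: "norm (tr a u) = norm u"
  by (simp add: norm_eq_sqrt_inner)

lemma inner_tr_left: "inner (tr a u) v = inner u (tr (- a) v)"
  using inner_tr_tr[of a u "tr (-a) v"] by (simp add: tr_tr)

lemma bounded_linear_tr: "bounded_linear (tr a)"
proof (rule bounded_linear_intro[of _ 1])
  show "tr a (u + v) = tr a u + tr a v" for u v
    by transfer (auto simp: L2_eq_def intro: L2_translate L2_add)
  show "tr a (r *\<^sub>R u) = r *\<^sub>R tr a u" for r u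
    by transfer (auto simp: L2_eq_def intro: L2_translate L2_scale)
qed simp

lemmas linear_tr = bounded_linear.linear[OF bounded_linear_tr]
lemmas tr_add = linear_add[OF linear_tr]
  and tr_diff = linear_diff[OF linear_tr]
  and tr_scaleR = linear_scale[OF linear_tr]

subsection \<open>Test functions\<close>

text \<open>The squared differences are dominated by \<open>4 * (w x)\<^sup>2\<close>, so scalar
  dominated convergence applied to them yields convergence in norm.\<close>

lemma lsq_dominated_convergence:
  fixes u :: "nat \<Rightarrow> real^'n \<Rightarrow> real" and v w :: "real^'n \<Rightarrow> real"
  assumes w: "L2 w" and meas: "\<And>n. u n \<in> borel_measurable lebesgue" "v \<in> borel_measurable lebesgue"
    and bound: "\<And>n. AE x in lebesgue. \<bar>u n x\<bar> \<le> \<bar>w x\<bar>"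
    and lim: "AE x in lebesgue. (\<lambda>n. u n x) \<longlonglongrightarrow> v x"
  shows "L2 v" "(\<lambda>n. abs_lsq (u n)) \<longlonglongrightarrow> abs_lsq v"
proof -
  have Lu: "L2 (u n)" for n by (rule L2_bound[OF w meas(1) bound])
  have AEb: "AE x in lebesgue. \<forall>n. \<bar>u n x\<bar> \<le> \<bar>w x\<bar>" using bound by (simp add: AE_all_countable)
  have vb: "AE x in lebesgue. \<bar>v x\<bar> \<le> \<bar>w x\<bar>"
    using AEb lim
  proof eventually_elim
    case (elim x)
    then show ?case by (intro LIMSEQ_le_const2[OF tendsto_rabs[OF elim(2)]]) auto
  qed
  show Lv: "L2 v" by (rule L2_bound[OF w meas(2) vb])
  have "(\<lambda>n. (\<integral>x. (u n x - v x)\<^sup>2 \<partial>lebesgue)) \<longlonglongrightarrow> (\<integral>x. (0::real) \<partial>(lebesgue :: (real^'n) measure))"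
  proof (rule integral_dominated_convergence[where w = "\<lambda>x. 4 * (w x)\<^sup>2"])
    show "integrable lebesgue (\<lambda>x. 4 * (w x)\<^sup>2)" using w by (simp add: L2_real)
    show "AE x in lebesgue. (\<lambda>n. (u n x - v x)\<^sup>2) \<longlonglongrightarrow> 0"
      using lim
    proof eventually_elim
      case (elim x)
      from tendsto_power[OF tendsto_diff[OF elim tendsto_const[of "v x"]], of 2] show ?case by simp
    qed
    show "AE x in lebesgue. norm ((u n x - v x)\<^sup>2) \<le> 4 * (w x)\<^sup>2" for n
      using AEb vb
    proof eventually_elim
      case (elim x)
      have "\<bar>u n x - v x\<bar> \<le> \<bar>2 * w x\<bar>" using elim(1)[rule_format, of n] elim(2) by linarith
      then show ?case by (simp add: abs_le_square_iff power_mult_distrib)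
    qed
  qed (use meas in measurable)
  then have "(\<lambda>n. (norm (abs_lsq (u n) - abs_lsq v))\<^sup>2) \<longlonglongrightarrow> 0"
    by (simp add: norm_abs_lsq Lu Lv L2_diff flip: abs_lsq_diff)
  from tendsto_real_sqrt[OF this] have "(\<lambda>n. norm (abs_lsq (u n) - abs_lsq v)) \<longlonglongrightarrow> 0" by simp
  then show "(\<lambda>n. abs_lsq (u n)) \<longlonglongrightarrow> abs_lsq v"
    using Lim_null tendsto_norm_zero_iff by blast
qed

text \<open>The differentiability half of \<open>test_fun\<close>. Polynomials satisfy it, and
  multiplication by a cutoff supplies the compact support.\<close>

definition C1 :: "(real^'n \<Rightarrow> real) \<Rightarrow> bool" where
  "C1 f \<longleftrightarrow> (\<exists>D. (\<forall>x. (f has_derivative blinfun_apply (D x)) (at x)) \<and> continuous_on UNIV D)"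

lemma test_fun_C1: "test_fun f \<longleftrightarrow> C1 f \<and> compact (closure {x. f x \<noteq> 0})"
  by (auto simp: test_fun_def C1_def)

lemma C1_continuous: "C1 f \<Longrightarrow> continuous_on UNIV f"
  unfolding C1_def by (metis continuous_at_imp_continuous_on has_derivative_continuous)

lemma C1_const: "C1 (\<lambda>x. c)"
  unfolding C1_def by (intro exI[of _ "\<lambda>x. 0"]) (auto simp: zero_blinfun.rep_eq)

lemma C1_linear:
  assumes "bounded_linear f" shows "C1 f"
  unfolding C1_def
  by (intro exI[of _ "\<lambda>x. Blinfun f"])
     (use assms in \<open>auto simp: bounded_linear_Blinfun_apply bounded_linear_imp_has_derivative\<close>)

lemma C1_add:
  assumes "C1 f" "C1 g" shows "C1 (\<lambda>x. f x + g x)"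
proof -
  obtain F G where "\<forall>x. (f has_derivative blinfun_apply (F x)) (at x)" "continuous_on UNIV F"
    "\<forall>x. (g has_derivative blinfun_apply (G x)) (at x)" "continuous_on UNIV G"
    using assms by (auto simp: C1_def)
  then show ?thesis unfolding C1_def
    by (intro exI[of _ "\<lambda>x. F x + G x"])
       (auto simp: plus_blinfun.rep_eq intro!: continuous_intros has_derivative_add)
qed

lemma C1_compose:
  fixes h :: "real \<Rightarrow> real"
  assumes "C1 f" "\<And>t. (h has_real_derivative h' t) (at t)" "continuous_on UNIV h'"
  shows "C1 (\<lambda>x. h (f x))"
proof -
  obtain F where F: "\<And>x. (f has_derivative blinfun_apply (F x)) (at x)" "continuous_on UNIV F"
    using assms by (auto simp: C1_def)
  have "((\<lambda>x. h (f x)) has_derivative blinfun_apply (h' (f x) *\<^sub>R F x)) (at x)" for x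
    using has_derivative_compose[OF F(1) assms(2)[unfolded has_field_derivative_def]]
    by (simp add: scaleR_blinfun.rep_eq mult.commute fun_eq_iff)
  moreover have "continuous_on UNIV (\<lambda>x. h' (f x) *\<^sub>R F x)"
    using F(2) C1_continuous[OF assms(1)] continuous_on_compose2[OF assms(3)]
    by (auto intro!: continuous_intros)
  ultimately show ?thesis by (auto simp: C1_def intro!: exI[of _ "\<lambda>x. h' (f x) *\<^sub>R F x"])
qed

lemma C1_mult:
  assumes "C1 f" "C1 g" shows "C1 (\<lambda>x. f x * g x)"
proof -
  obtain F G where FG: "\<And>x. (f has_derivative blinfun_apply (F x)) (at x)" "continuous_on UNIV F"
    "\<And>x. (g has_derivative blinfun_apply (G x)) (at x)" "continuous_on UNIV G"
    using assms by (auto simp: C1_def)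
  have "((\<lambda>x. f x * g x) has_derivative blinfun_apply (f x *\<^sub>R G x + g x *\<^sub>R F x)) (at x)" for x
    using has_derivative_mult[OF FG(1)[of x] FG(3)[of x]]
    by (simp add: plus_blinfun.rep_eq scaleR_blinfun.rep_eq mult.commute fun_eq_iff)
  moreover have "continuous_on UNIV (\<lambda>x. f x *\<^sub>R G x + g x *\<^sub>R F x)"
    using FG assms[THEN C1_continuous] by (auto intro!: continuous_intros)
  ultimately show ?thesis by (auto simp: C1_def intro!: exI[of _ "\<lambda>x. f x *\<^sub>R G x + g x *\<^sub>R F x"])
qed

lemma C1_polynomial: "real_polynomial_function f \<Longrightarrow> C1 f"
  by (induction rule: real_polynomial_function.induct) (auto intro: C1_linear C1_const C1_add C1_mult)

lemma C1_translate:
  assumes "C1 f" shows "C1 (\<lambda>x. f (x + a))"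
proof -
  obtain F where F: "\<And>x. (f has_derivative blinfun_apply (F x)) (at x)" "continuous_on UNIV F"
    using assms by (auto simp: C1_def)
  have "((\<lambda>x. f (x + a)) has_derivative blinfun_apply (F (x + a))) (at x)" for x
  proof -
    have "((\<lambda>x. x + a) has_derivative (\<lambda>x. x)) (at x)" by (auto intro!: derivative_eq_intros)
    from has_derivative_compose[OF this F(1)] show ?thesis .
  qed
  moreover have "continuous_on UNIV (\<lambda>x. F (x + a))"
    by (rule continuous_on_compose2[OF F(2)]) (auto intro!: continuous_intros)
  ultimately show ?thesis by (auto simp: C1_def intro!: exI[of _ "\<lambda>x. F (x + a)"])
qed

lemma compact_closure_support_iff:
  "compact (closure {x. f x \<noteq> 0}) \<longleftrightarrow> (\<exists>R>0. \<forall>x::real^'n. norm x > R \<longrightarrow> f x = 0)"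
proof
  assume "compact (closure {x. f x \<noteq> 0})"
  then have "bounded {x. f x \<noteq> 0}" by simp
  then show "\<exists>R>0. \<forall>x. norm x > R \<longrightarrow> f x = 0" unfolding bounded_pos by force
next
  assume "\<exists>R>0. \<forall>x. norm x > R \<longrightarrow> f x = 0"
  then obtain R where "\<forall>x. norm x > R \<longrightarrow> f x = 0" by blast
  then have "bounded {x. f x \<noteq> 0}" unfolding bounded_iff by (intro exI[of _ R]) force
  then show "compact (closure {x. f x \<noteq> 0})" by simp
qed

lemma test_fun_iff: "test_fun f \<longleftrightarrow> C1 f \<and> (\<exists>R>0. \<forall>x. norm x > R \<longrightarrow> f x = 0)"
  unfolding test_fun_C1 compact_closure_support_iff ..

lemma test_fun_translate: "test_fun f \<Longrightarrow> test_fun (\<lambda>x. f (x + a))"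
  unfolding test_fun_iff
proof (elim conjE exE, intro conjI)
  fix R assume "C1 f" "0 < R" and R: "\<forall>x. R < norm x \<longrightarrow> f x = 0"
  then show "C1 (\<lambda>x. f (x + a))" by (simp add: C1_translate)
  have "f (x + a) = 0" if "norm x > R + norm a" for x
    using norm_triangle_ineq4[of "x + a" a] that by (intro R[rule_format]) simp
  then show "\<exists>R>0. \<forall>x. R < norm x \<longrightarrow> f (x + a) = 0"
    using \<open>0 < R\<close> by (intro exI[of _ "R + norm a"]) (auto intro: add_pos_nonneg)
qed

lemma continuous_support_bounded:
  fixes f :: "real^'n \<Rightarrow> real"
  assumes "continuous_on UNIV f" "\<And>x. norm x > R \<Longrightarrow> f x = 0"
  shows "\<exists>M>0. \<forall>x. \<bar>f x\<bar> \<le> M * indicator (cball 0 R) x"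
proof -
  have "compact (f ` cball 0 R)"
    using assms(1) by (intro compact_continuous_image) (auto intro: continuous_on_subset)
  then obtain M where M: "M > 0" "\<And>x. x \<in> cball 0 R \<Longrightarrow> \<bar>f x\<bar> \<le> M"
    by (auto dest!: compact_imp_bounded simp: bounded_pos)
  show ?thesis using M assms(2) by (intro exI[of _ M]) (auto simp: indicator_def not_le)
qed

lemma L2_indicator_cball: "L2 (\<lambda>x. c * indicator (cball (0::real^'n) R) x :: real)"
proof (rule L2_scale)
  have *: "(indicator (cball (0::real^'n) R) x :: real)\<^sup>2 = indicator (cball 0 R) x" for x
    by (simp add: indicator_def)
  show "L2 (indicator (cball (0::real^'n) R) :: _ \<Rightarrow> real)"
    unfolding L2_real *
    using lmeasurable_iff_integrable[THEN iffD1, OF lmeasurable_cball[of "0::real^'n" R]] by auto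
qed

lemma continuous_borel_lebesgue: "continuous_on UNIV f \<Longrightarrow> f \<in> borel_measurable lebesgue"
  for f :: "real^'n \<Rightarrow> real"
  by (intro measurable_completion) (simp add: borel_measurable_continuous_onI)

lemma L2_continuous_support:
  fixes f :: "real^'n \<Rightarrow> real"
  assumes "continuous_on UNIV f" "\<And>x. norm x > R \<Longrightarrow> f x = 0"
  shows "L2 f"
proof -
  obtain M where "M > 0" and M: "\<forall>x. \<bar>f x\<bar> \<le> M * indicator (cball 0 R) x"
    using continuous_support_bounded[OF assms] by blast
  then show ?thesis
    by (intro L2_bound[OF L2_indicator_cball[of M R]] continuous_borel_lebesgue assms(1))
       (auto simp: abs_mult)
qed

definition pd :: "'n \<Rightarrow> (real^'n \<Rightarrow> real) \<Rightarrow> real^'n \<Rightarrow> real" where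
  "pd i \<phi> x = frechet_derivative \<phi> (at x) (axis i 1)"

lemma test_funE:
  assumes "test_fun \<phi>"
  obtains D R where "\<And>x. (\<phi> has_derivative blinfun_apply (D x)) (at x)" "continuous_on UNIV D"
    "\<And>i x. pd i \<phi> x = D x (axis i 1)" "R > 0" "\<And>x. norm x > R \<Longrightarrow> \<phi> x = 0"
    "\<And>i x. norm x > R \<Longrightarrow> pd i \<phi> x = 0"
proof -
  obtain D R where D: "\<And>x. (\<phi> has_derivative blinfun_apply (D x)) (at x)" "continuous_on UNIV D"
    and R: "R > 0" "\<And>x. norm x > R \<Longrightarrow> \<phi> x = 0"
    using assms by (auto simp: test_fun_iff C1_def)
  have 1: "pd i \<phi> x = D x (axis i 1)" for i x
    using frechet_derivative_at[OF D(1)[of x]] by (simp add: pd_def)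
  have 2: "pd i \<phi> x = 0" if "norm x > R" for i x
  proof -
    have "open {x::real^'n. norm x > R}" by (intro open_Collect_less continuous_intros)
    then have "(\<phi> has_derivative (\<lambda>x. 0)) (at x)"
      using that R(2)
      by (intro has_derivative_transform_within_open[OF has_derivative_const[of 0]]) auto
    from has_derivative_unique[OF D(1) this]
    have "blinfun_apply (D x) = (\<lambda>x. 0)" .
    then show ?thesis by (simp add: 1)
  qed
  show ?thesis by (rule that[OF D 1 R 2])
qed

lemma pd_continuous:
  assumes "test_fun \<phi>" shows "continuous_on UNIV (pd i \<phi>)"
proof -
  obtain D where D: "\<And>x. (\<phi> has_derivative blinfun_apply (D x)) (at x)" "continuous_on UNIV D"
    "\<And>i x. pd i \<phi> x = blinfun_apply (D x) (axis i 1)"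
    by (rule test_funE[OF assms], rule that, assumption+)
  then have "pd i \<phi> = (\<lambda>x. blinfun_apply (D x) (axis i 1))" by auto
  then show ?thesis using D by (auto intro!: continuous_intros)
qed

lemma test_fun_L2: assumes "test_fun \<phi>" shows "L2 \<phi>" "L2 (pd i \<phi>)"
proof -
  obtain R where "\<And>x. norm x > R \<Longrightarrow> \<phi> x = 0" "\<And>i x. norm x > R \<Longrightarrow> pd i \<phi> x = 0"
    by (rule test_funE[OF assms], rule that, assumption+)
  moreover have "continuous_on UNIV \<phi>" using assms by (auto simp: test_fun_iff C1_continuous)
  ultimately show "L2 \<phi>" "L2 (pd i \<phi>)"
    by (auto intro: L2_continuous_support[of _ R] L2_continuous_support[OF pd_continuous[OF assms]])
qed

lemma pd_translate:
  assumes "test_fun \<phi>" shows "pd i (\<lambda>x. \<phi> (x + a)) x = pd i \<phi> (x + a)"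
proof -
  obtain D where D: "\<And>x. (\<phi> has_derivative blinfun_apply (D x)) (at x)"
     "\<And>i x. pd i \<phi> x = blinfun_apply (D x) (axis i 1)"
    by (rule test_funE[OF assms], rule that, assumption+)
  have "((\<lambda>x. \<phi> (x + a)) has_derivative blinfun_apply (D (x + a))) (at x)"
  proof -
    have "((\<lambda>x. x + a) has_derivative (\<lambda>x. x)) (at x)" by (auto intro!: derivative_eq_intros)
    from has_derivative_compose[OF this D(1)] show ?thesis .
  qed
  from frechet_derivative_at[OF this] show ?thesis by (simp add: pd_def D(2)[unfolded pd_def])
qed

section \<open>Explicit cutoffs, density of test functions, and the fundamental lemma\<close>

definition cutoff :: "real \<Rightarrow> real^'n \<Rightarrow> real" where
  "cutoff R x = (max 0 (1 - (norm x)\<^sup>2 / R\<^sup>2))\<^sup>2"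

lemma cutoff_bounds: "0 \<le> cutoff R x" "cutoff R x \<le> 1"
  by (auto simp: cutoff_def intro!: power_le_one)

lemma abs_cutoff [simp]: "\<bar>cutoff R x\<bar> = cutoff R x"
  by (simp add: cutoff_bounds)

lemma has_real_derivative_max_sq: "((\<lambda>s::real. (max 0 s)\<^sup>2) has_real_derivative (2 * max 0 t)) (at t)"
proof -
  consider "t > 0" | "t < 0" | "t = 0" by linarith
  then show ?thesis
  proof cases
    case 1
    have "((\<lambda>s::real. s\<^sup>2) has_real_derivative (2 * max 0 t)) (at t)"
      using 1 by (auto intro!: derivative_eq_intros)
    then show ?thesis
      by (rule has_field_derivative_transform_within_open[of _ _ _ "{0<..}"]) (use 1 in auto)
  next
    case 2
    have "((\<lambda>s::real. 0) has_real_derivative (2 * max 0 t)) (at t)" using 2 by auto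
    then show ?thesis
      by (rule has_field_derivative_transform_within_open[of _ _ _ "{..<0}"]) (use 2 in auto)
  next
    case 3
    have "((\<lambda>h::real. (max 0 h)\<^sup>2 / h) \<longlongrightarrow> 0) (at 0)"
    proof (rule tendsto_0_le[where K = 1])
      show "((\<lambda>h::real. h) \<longlongrightarrow> 0) (at 0)" by (rule tendsto_ident_at)
      show "\<forall>\<^sub>F h in at 0. norm ((max 0 h)\<^sup>2 / h) \<le> norm (h::real) * 1"
        by (auto simp: power2_eq_square max_def intro!: always_eventually)
    qed
    then show ?thesis using 3 by (simp add: DERIV_def)
  qed
qed

text \<open>Squaring makes the positive part differentiable with continuous derivative, and the
  squared norm is a polynomial in the coordinates. As test functions are only C^1, this elementary
  bump is smooth enough.\<close>

lemma cutoff_C1: "C1 (cutoff R)"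
proof -
  have eq: "cutoff R = (\<lambda>x. (max 0 (1 + (- 1 / R\<^sup>2) * (\<Sum>i\<in>UNIV. x$i * x$i)))\<^sup>2)"
    by (auto simp: cutoff_def fun_eq_iff power2_norm_eq_inner inner_vec_def)
  have "real_polynomial_function (\<lambda>x::real^'n. 1 + (- 1 / R\<^sup>2) * (\<Sum>i\<in>UNIV. x$i * x$i))"
    by (intro real_polynomial_function.intros real_polynomial_function_sum bounded_linear_vec_nth) auto
  then show ?thesis unfolding eq
    by (intro C1_compose[OF C1_polynomial has_real_derivative_max_sq]) (auto intro!: continuous_intros)
qed

lemma cutoff_eq_0: "R > 0 \<Longrightarrow> norm x \<ge> R \<Longrightarrow> cutoff R x = 0"
  by (auto simp: cutoff_def max_def field_simps power2_le_iff_abs_le)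

lemma cutoff_pos: "R > 0 \<Longrightarrow> norm x < R \<Longrightarrow> cutoff R x > 0"
proof -
  assume "R > 0" "norm x < R"
  then have "(norm x)\<^sup>2 < R\<^sup>2" by (intro power_strict_mono) auto
  then have "max 0 (1 - (norm x)\<^sup>2 / R\<^sup>2) > 0" using \<open>R > 0\<close> by (simp add: divide_less_eq)
  then show ?thesis unfolding cutoff_def by (rule zero_less_power)
qed

lemma cutoff_tendsto: "(\<lambda>n. cutoff (real n) x) \<longlonglongrightarrow> 1"
proof -
  have "(\<lambda>n. (norm x / real n)\<^sup>2) \<longlonglongrightarrow> 0\<^sup>2"
    by (intro tendsto_power tendsto_divide_0[OF tendsto_const] filterlim_real_at_infinity_sequentially)
  then have "(\<lambda>n. (max 0 (1 - (norm x / real n)\<^sup>2))\<^sup>2) \<longlonglongrightarrow> (max 0 (1 - 0))\<^sup>2"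
    by (intro tendsto_power tendsto_max tendsto_diff tendsto_const) simp
  then show ?thesis by (simp add: cutoff_def power_divide)
qed

lemma test_fun_cutoff_mult: "R > 0 \<Longrightarrow> C1 f \<Longrightarrow> test_fun (\<lambda>x. cutoff R x * f x)"
  unfolding test_fun_iff by (auto intro!: C1_mult cutoff_C1 exI[of _ R] simp: cutoff_eq_0)

text \<open>Stone-Weierstrass on the ball supplies the polynomial. Measuring the error relative to
  the cutoff makes the bound valid on the whole space, both sides being 0 outside the ball, and lets
  it be integrated against any weight.\<close>

lemma cutoff_mult_approx:
  assumes "R > 0" "continuous_on UNIV f" "e > 0"
  obtains p where "C1 p" "\<And>x. \<bar>cutoff R x * f x - cutoff R x * p x\<bar> \<le> e * cutoff R x"
proof -
  obtain p where p: "real_polynomial_function p" "\<And>x. x \<in> cball 0 R \<Longrightarrow> \<bar>f x - p x\<bar> < e"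
    using Stone_Weierstrass_real_polynomial_function[of "cball 0 R" f e] assms
    by (metis compact_cball continuous_on_subset subset_UNIV)
  have "\<bar>cutoff R x * f x - cutoff R x * p x\<bar> \<le> e * cutoff R x" for x
  proof (cases "norm x \<le> R")
    case True
    then have "\<bar>f x - p x\<bar> \<le> e" using p(2)[of x] by simp
    then have "cutoff R x * \<bar>f x - p x\<bar> \<le> cutoff R x * e" by (rule mult_left_mono) (rule cutoff_bounds)
    moreover have "\<bar>cutoff R x * f x - cutoff R x * p x\<bar> = cutoff R x * \<bar>f x - p x\<bar>"
      by (simp add: abs_mult cutoff_bounds flip: right_diff_distrib)
    ultimately show ?thesis by (simp add: mult.commute)
  qed (use cutoff_eq_0[of R x] assms in auto)
  then show ?thesis using that p C1_polynomial by blast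
qed

lemma cutoff_continuous: "continuous_on UNIV (cutoff R)"
  by (rule C1_continuous[OF cutoff_C1])

lemma cutoff_measurable [measurable]: "cutoff R \<in> borel_measurable lebesgue"
  by (rule continuous_borel_lebesgue[OF cutoff_continuous])

definition clip :: "real \<Rightarrow> real \<Rightarrow> real" where "clip k t = max (- k) (min k t)"

lemma clip_bounds: "k \<ge> 0 \<Longrightarrow> \<bar>clip k t\<bar> \<le> k" "k \<ge> 0 \<Longrightarrow> \<bar>clip k t\<bar> \<le> \<bar>t\<bar>" "\<bar>t\<bar> \<le> k \<Longrightarrow> clip k t = t"
  by (auto simp: clip_def)

lemma clip_measurable [measurable]: "clip k \<in> borel_measurable borel"
  unfolding clip_def by measurable

lemma measurable_AE_limit_continuous:
  fixes f :: "real^'n \<Rightarrow> real"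
  assumes "f \<in> borel_measurable lebesgue"
  obtains g where "\<And>n::nat. continuous_on UNIV (g n)" "AE x in lebesgue. (\<lambda>n. g n x) \<longlonglongrightarrow> f x"
proof -
  have "f measurable_on UNIV" by (rule lebesgue_measurable_imp_measurable_on[OF assms]) simp
  then obtain N g where "negligible N" "\<And>n. continuous_on UNIV (g n)"
     "\<And>x. x \<notin> N \<Longrightarrow> (\<lambda>n. g n x) \<longlonglongrightarrow> f x"
    unfolding measurable_on_def by auto
  then show ?thesis
    by (intro that[of g]) (auto simp: negligible_iff_null_sets eventually_ae_filter intro!: bexI[of _ N])
qed

lemma measurable_AE_limit_clip:
  fixes f :: "real^'n \<Rightarrow> real"
  assumes "f \<in> borel_measurable lebesgue" "k \<ge> 0" "\<And>x. \<bar>f x\<bar> \<le> k"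
  obtains g where "\<And>n::nat. continuous_on UNIV (g n)" "\<And>n x. \<bar>g n x\<bar> \<le> k"
    "AE x in lebesgue. (\<lambda>n. g n x) \<longlonglongrightarrow> f x"
proof -
  obtain g where g: "\<And>n::nat. continuous_on UNIV (g n)" "AE x in lebesgue. (\<lambda>n. g n x) \<longlonglongrightarrow> f x"
    using measurable_AE_limit_continuous[OF assms(1)] by metis
  show ?thesis
  proof (rule that[of "\<lambda>n x. clip k (g n x)"])
    show "continuous_on UNIV (\<lambda>x. clip k (g n x))" for n
      unfolding clip_def by (intro continuous_intros g(1))
    show "\<bar>clip k (g n x)\<bar> \<le> k" for n x using clip_bounds assms by blast
    show "AE x in lebesgue. (\<lambda>n. clip k (g n x)) \<longlonglongrightarrow> f x"
      using g(2)
    proof eventually_elim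
      case (elim x)
      then have "(\<lambda>n. clip k (g n x)) \<longlonglongrightarrow> clip k (f x)"
        unfolding clip_def by (intro tendsto_intros)
      then show ?case using clip_bounds(3)[of "f x" k] assms by simp
    qed
  qed
qed

lemma L2_cutoff_mult_bounded:
  assumes "R > 0" "f \<in> borel_measurable lebesgue" "\<And>x. \<bar>f x\<bar> \<le> k"
  shows "L2 (\<lambda>x. cutoff R x * f x)"
proof (rule L2_bound[OF L2_indicator_cball[of k R]])
  have "k \<ge> 0" using assms(3)[of 0] by linarith
  have "\<bar>cutoff R x * f x\<bar> \<le> \<bar>k * indicator (cball 0 R) x\<bar>" for x
  proof (cases "norm x \<le> R")
    case True
    have "\<bar>cutoff R x\<bar> * \<bar>f x\<bar> \<le> 1 * k" using cutoff_bounds[of R x] assms(3) by (intro mult_mono) auto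
    then show ?thesis using True \<open>k \<ge> 0\<close> by (simp add: abs_mult)
  qed (use cutoff_eq_0[of R x] assms in auto)
  then show "AE x in lebesgue. \<bar>cutoff R x * f x\<bar> \<le> \<bar>k * indicator (cball 0 R) x\<bar>" by simp
qed (use assms in measurable)

text \<open>Polynomials times a cutoff reach continuous functions times the cutoff; almost
  everywhere limits of continuous functions reach bounded measurable ones; truncating both the
  values and the support reaches every class. No mollification enters.\<close>

theorem test_fun_dense: "closure (abs_lsq ` {\<phi>::real^'n \<Rightarrow> real. test_fun \<phi>}) = UNIV"
proof -
  let ?S = "closure (abs_lsq ` {\<phi>::real^'n \<Rightarrow> real. test_fun \<phi>})"
  have seq: "x \<in> ?S" if "\<And>n. a n \<in> ?S" "a \<longlonglongrightarrow> x" for a :: "nat \<Rightarrow> 'n lsq" and x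
    using closed_sequentially[OF closed_closure that] .
  have A: "abs_lsq (\<lambda>x. cutoff R x * f x) \<in> ?S"
    if R: "R > 0" and f: "continuous_on UNIV f" for R and f :: "real^'n \<Rightarrow> real"
    unfolding closure_approachable
  proof (intro allI impI)
    fix e :: real assume e: "e > 0"
    \<comment> \<open>Adding 1 keeps the divisor positive and makes the final estimate strict, since
      \<open>n / (n + 1) < 1\<close>.\<close>
    let ?c = "norm (abs_lsq (cutoff R :: real^'n \<Rightarrow> real)) + 1"
    have cp: "?c > 0" by (simp add: add_nonneg_pos)
    have "e / ?c > 0" using e cp by simp
    then obtain p where p: "C1 p" "\<And>x. \<bar>cutoff R x * f x - cutoff R x * p x\<bar> \<le> e / ?c * cutoff R x"
      using cutoff_mult_approx[OF R f] by metis
    have L: "L2 (cutoff R :: real^'n \<Rightarrow> real)" using R cutoff_continuous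
      by (intro L2_continuous_support[of _ R]) (auto simp: cutoff_eq_0)
    have L1: "L2 (\<lambda>x. cutoff R x * f x)" using R f cutoff_continuous
      by (intro L2_continuous_support[of _ R]) (auto simp: cutoff_eq_0 intro!: continuous_intros)
    have t: "test_fun (\<lambda>x. cutoff R x * p x)" by (rule test_fun_cutoff_mult[OF R p(1)])
    let ?d = "\<lambda>x. cutoff R x * f x - cutoff R x * p x"
    have Ld: "L2 ?d" by (intro L2_diff L1 test_fun_L2 t)
    have "(norm (abs_lsq ?d))\<^sup>2 \<le> (norm (abs_lsq (\<lambda>x::real^'n. e / ?c * cutoff R x)))\<^sup>2"
      unfolding norm_abs_lsq[OF Ld] norm_abs_lsq[OF L2_scale[OF L]]
    proof (rule integral_mono)
      show "integrable lebesgue (\<lambda>x. (?d x)\<^sup>2)" using Ld by (simp add: L2_real)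
      show "integrable lebesgue (\<lambda>x::real^'n. (e / ?c * cutoff R x)\<^sup>2)"
        using L2_scale[OF L, of "e / ?c"] by (simp add: L2_real)
      show "(?d x)\<^sup>2 \<le> (e / ?c * cutoff R x)\<^sup>2" for x
        using p(2)[of x] by (metis abs_le_square_iff abs_ge_self order_trans)
    qed
    then have "norm (abs_lsq ?d) \<le> norm (abs_lsq (\<lambda>x::real^'n. e / ?c * cutoff R x))"
      by (simp add: power_mono_iff)
    also have "\<dots> = e * (norm (abs_lsq (cutoff R :: real^'n \<Rightarrow> real)) / ?c)"
      using e cp unfolding abs_lsq_scale[OF L] by simp
    also have "\<dots> < e * 1"
    proof (rule mult_strict_left_mono[OF _ e])
      have "n / (n + 1) < 1" if "n \<ge> 0" for n :: real using that by (simp add: divide_simps)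
      from this[OF norm_ge_zero] show "norm (abs_lsq (cutoff R :: real^'n \<Rightarrow> real)) / ?c < 1" .
    qed
    finally have "dist (abs_lsq (\<lambda>x. cutoff R x * p x)) (abs_lsq (\<lambda>x. cutoff R x * f x)) < e"
      by (simp add: dist_norm norm_minus_commute abs_lsq_diff[OF L1 test_fun_L2(1)[OF t]])
    then show "\<exists>y\<in>abs_lsq ` {\<phi>. test_fun \<phi>}. dist y (abs_lsq (\<lambda>x. cutoff R x * f x)) < e"
      using t by blast
  qed
  have B: "abs_lsq (\<lambda>x. cutoff R x * f x) \<in> ?S"
    if R: "R > 0" and f: "f \<in> borel_measurable lebesgue" "k \<ge> 0" "\<And>x. \<bar>f x\<bar> \<le> k"
    for R k and f :: "real^'n \<Rightarrow> real"
  proof -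
    obtain g where g: "\<And>n::nat. continuous_on UNIV (g n)" "\<And>n x. \<bar>g n x\<bar> \<le> k"
      "AE x in lebesgue. (\<lambda>n. g n x) \<longlonglongrightarrow> f x"
      using measurable_AE_limit_clip[OF f] by metis
    have [measurable]: "g n \<in> borel_measurable lebesgue" for n
      by (rule continuous_borel_lebesgue[OF g(1)])
    have "(\<lambda>n. abs_lsq (\<lambda>x. cutoff R x * g n x)) \<longlonglongrightarrow> abs_lsq (\<lambda>x. cutoff R x * f x)"
    proof (rule lsq_dominated_convergence(2)[where w = "\<lambda>x. cutoff R x * k"])
      show "L2 (\<lambda>x::real^'n. cutoff R x * k)"
        by (rule L2_cutoff_mult_bounded[OF R, of _ k]) (use \<open>k \<ge> 0\<close> in auto)
      show "AE x in lebesgue. \<bar>cutoff R x * g n x\<bar> \<le> \<bar>cutoff R x * k\<bar>" for n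
        using g(2) \<open>k \<ge> 0\<close> by (auto simp: abs_mult intro!: AE_I2 mult_left_mono cutoff_bounds)
      show "AE x in lebesgue. (\<lambda>n. cutoff R x * g n x) \<longlonglongrightarrow> cutoff R x * f x"
        using g(3) by eventually_elim (intro tendsto_intros)
    qed (use f in measurable)
    then show ?thesis by (rule seq[rotated]) (rule A[OF R g(1)])
  qed
  have "x \<in> ?S" for x
  proof (rule seq)
    let ?u = "rep_lsq x"
    have L: "L2 ?u" by (rule L2_rep)
    have [measurable]: "?u \<in> borel_measurable lebesgue" using L by (simp add: L2_real)
    show "abs_lsq (\<lambda>y. cutoff (real (Suc n)) y * clip (real (Suc n)) (?u y)) \<in> ?S" for n
      by (rule B[of _ _ "real (Suc n)"]) (auto intro: clip_bounds)
    have "(\<lambda>n. abs_lsq (\<lambda>y. cutoff (real (Suc n)) y * clip (real (Suc n)) (?u y))) \<longlonglongrightarrow> abs_lsq ?u"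
    proof (rule lsq_dominated_convergence(2)[OF L])
      show "AE y in lebesgue. \<bar>cutoff (real (Suc n)) y * clip (real (Suc n)) (?u y)\<bar> \<le> \<bar>?u y\<bar>" for n
      proof (rule AE_I2)
        fix y :: "real^'n"
        have "\<bar>cutoff (real (Suc n)) y\<bar> * \<bar>clip (real (Suc n)) (?u y)\<bar> \<le> 1 * \<bar>?u y\<bar>"
          using cutoff_bounds[of "real (Suc n)" y] clip_bounds(2)[of "real (Suc n)" "?u y"]
          by (intro mult_mono) auto
        then show "\<bar>cutoff (real (Suc n)) y * clip (real (Suc n)) (?u y)\<bar> \<le> \<bar>?u y\<bar>" by (simp add: abs_mult)
      qed
      show "AE y in lebesgue. (\<lambda>n. cutoff (real (Suc n)) y * clip (real (Suc n)) (?u y)) \<longlonglongrightarrow> ?u y"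
      proof (rule AE_I2)
        fix y :: "real^'n"
        have "(\<lambda>n. clip (real n) (?u y)) \<longlonglongrightarrow> ?u y"
        proof (rule tendsto_eventually)
          show "\<forall>\<^sub>F n in sequentially. clip (real n) (?u y) = ?u y"
            using eventually_ge_at_top[of "nat \<lceil>\<bar>?u y\<bar>\<rceil>"]
            by eventually_elim (rule clip_bounds(3), linarith)
        qed
        from tendsto_mult[OF cutoff_tendsto this]
        have "(\<lambda>n. cutoff (real n) y * clip (real n) (?u y)) \<longlonglongrightarrow> ?u y" by simp
        from LIMSEQ_Suc[OF this]
        show "(\<lambda>n. cutoff (real (Suc n)) y * clip (real (Suc n)) (?u y)) \<longlonglongrightarrow> ?u y" .
      qed
    qed measurable
    then show "(\<lambda>n. abs_lsq (\<lambda>y. cutoff (real (Suc n)) y * clip (real (Suc n)) (?u y))) \<longlonglongrightarrow> x" by simp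
  qed
  then show ?thesis by blast
qed

lemma test_fun_approx:
  fixes a :: "'n::finite lsq"
  assumes "e > 0" obtains \<phi> where "test_fun \<phi>" "norm (abs_lsq \<phi> - a) < e"
proof -
  have "a \<in> closure (abs_lsq ` {\<phi>. test_fun \<phi>})" by (simp add: test_fun_dense)
  then show ?thesis using assms that by (auto simp: closure_approachable dist_norm)
qed

text \<open>Here \<open>d\<close> is only integrable against test functions, so density in the
  Hilbert space says nothing. Instead \<open>cutoff R x * \<bar>d x\<bar>\<close> serves as a finite
  weight: polynomial approximation gives vanishing against bounded continuous functions, and letting
  these tend to \<open>sgn (d x)\<close> shows that the weight has integral 0.\<close>

theorem fundamental_lemma:
  fixes d :: "real^'n \<Rightarrow> real"
  assumes d [measurable]: "d \<in> borel_measurable lebesgue"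
    and int: "\<And>\<phi>. test_fun \<phi> \<Longrightarrow> integrable lebesgue (\<lambda>x. \<phi> x * d x)"
    and zero: "\<And>\<phi>. test_fun \<phi> \<Longrightarrow> (\<integral>x. \<phi> x * d x \<partial>lebesgue) = 0"
  shows "AE x in lebesgue. d x = 0"
proof -
  have "AE x in lebesgue. cutoff R x * d x = 0" if R: "R > 0" for R
  proof -
    have "test_fun (\<lambda>x::real^'n. cutoff R x * 1)" by (rule test_fun_cutoff_mult[OF R C1_const])
    from int[OF this] have icd: "integrable lebesgue (\<lambda>x. cutoff R x * d x)" by simp
    have bdd: "integrable lebesgue (\<lambda>x. cutoff R x * f x * d x)"
      if "f \<in> borel_measurable lebesgue" "\<And>x. \<bar>f x\<bar> \<le> k" for f k
    proof (rule Bochner_Integration.integrable_bound[where f = "\<lambda>x. k * (cutoff R x * d x)"])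
      show "integrable lebesgue (\<lambda>x. k * (cutoff R x * d x))" using icd by simp
      have "k \<ge> 0" using that(2)[of 0] by linarith
      have "\<bar>f x\<bar> * (cutoff R x * \<bar>d x\<bar>) \<le> k * (cutoff R x * \<bar>d x\<bar>)" for x
        using that(2) cutoff_bounds[of R x] by (intro mult_right_mono) auto
      then show "AE x in lebesgue. norm (cutoff R x * f x * d x) \<le> norm (k * (cutoff R x * d x))"
        using \<open>k \<ge> 0\<close> cutoff_bounds(1)[of R] by (intro AE_I2) (simp add: abs_mult ac_simps)
    qed (use that in measurable)
    have cont0: "(\<integral>x. cutoff R x * f x * d x \<partial>lebesgue) = 0"
      if f: "continuous_on UNIV f" "\<And>x. \<bar>f x\<bar> \<le> k" for f k
    proof (rule ccontr)
      have [measurable]: "f \<in> borel_measurable lebesgue" by (rule continuous_borel_lebesgue[OF f(1)])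
      have bf: "integrable lebesgue (\<lambda>x. cutoff R x * f x * d x)"
        by (rule bdd[OF _ f(2)]) measurable
      let ?I = "\<integral>x. cutoff R x * f x * d x \<partial>lebesgue"
      \<comment> \<open>With tolerance \<open>\<bar>?I\<bar> / ?c\<close>, replacing
        \<open>f\<close> by a polynomial costs at most
        \<open>\<bar>?I\<bar> * ((?c - 1) / ?c)\<close>; the polynomial itself contributes 0, so
        \<open>\<bar>?I\<bar> < \<bar>?I\<bar>\<close> results.\<close>
      let ?c = "(\<integral>x. cutoff R x * \<bar>d x\<bar> \<partial>lebesgue) + 1"
      have icd': "integrable lebesgue (\<lambda>x. cutoff R x * \<bar>d x\<bar>)"
        using integrable_abs[OF icd] cutoff_bounds(1)[of R] by (simp add: abs_mult)
      have c: "?c > 0" 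
        by (intro add_nonneg_pos integral_nonneg_AE) (simp_all add: cutoff_bounds)
      assume "?I \<noteq> 0"
      then have e: "\<bar>?I\<bar> / ?c > 0" using c by simp
      obtain p where p: "C1 p" "\<And>x. \<bar>cutoff R x * f x - cutoff R x * p x\<bar> \<le> \<bar>?I\<bar> / ?c * cutoff R x"
        by (rule cutoff_mult_approx[OF R f(1) e], rule that, assumption+)
      have t: "test_fun (\<lambda>x. cutoff R x * p x)" by (rule test_fun_cutoff_mult[OF R p(1)])
      have "?I = (\<integral>x. cutoff R x * f x * d x \<partial>lebesgue) - (\<integral>x. cutoff R x * p x * d x \<partial>lebesgue)"
        using zero[OF t] by simp
      also have "\<dots> = (\<integral>x. cutoff R x * f x * d x - cutoff R x * p x * d x \<partial>lebesgue)"
        by (rule Bochner_Integration.integral_diff[symmetric, OF bf int[OF t]])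
      finally have "\<bar>?I\<bar> = \<bar>\<integral>x. cutoff R x * f x * d x - cutoff R x * p x * d x \<partial>lebesgue\<bar>" by simp
      also have "\<dots> \<le> (\<integral>x. \<bar>cutoff R x * f x * d x - cutoff R x * p x * d x\<bar> \<partial>lebesgue)"
        by (rule integral_abs_bound)
      also have "\<dots> \<le> (\<integral>x. \<bar>?I\<bar> / ?c * (cutoff R x * \<bar>d x\<bar>) \<partial>lebesgue)"
      proof (rule integral_mono)
        show "integrable lebesgue (\<lambda>x. \<bar>cutoff R x * f x * d x - cutoff R x * p x * d x\<bar>)"
          by (intro integrable_abs Bochner_Integration.integrable_diff bf int[OF t])
        show "integrable lebesgue (\<lambda>x. \<bar>?I\<bar> / ?c * (cutoff R x * \<bar>d x\<bar>))" by (intro integrable_mult_right icd')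
        show "\<bar>cutoff R x * f x * d x - cutoff R x * p x * d x\<bar> \<le> \<bar>?I\<bar> / ?c * (cutoff R x * \<bar>d x\<bar>)" for x
          using mult_right_mono[OF p(2)[of x], of "\<bar>d x\<bar>"]
          by (simp add: left_diff_distrib mult.assoc flip: abs_mult)
      qed
      also have "\<dots> = \<bar>?I\<bar> * ((?c - 1) / ?c)" by simp
      also have "\<dots> < \<bar>?I\<bar> * 1"
      proof (rule mult_strict_left_mono)
        have "(n - 1) / n < 1" if "n > 0" for n :: real using that by (simp add: divide_simps)
        then show "(?c - 1) / ?c < 1" using c by blast
      qed (use \<open>?I \<noteq> 0\<close> in simp)
      finally show False by simp
    qed
    obtain g where g: "\<And>n::nat. continuous_on UNIV (g n)" "\<And>n x. \<bar>g n x\<bar> \<le> 1"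
      "AE x in lebesgue. (\<lambda>n. g n x) \<longlonglongrightarrow> sgn (d x)"
      by (rule measurable_AE_limit_clip[of "\<lambda>x. sgn (d x)" 1]) (auto simp: abs_sgn_eq)
    have [measurable]: "g n \<in> borel_measurable lebesgue" for n
      by (rule continuous_borel_lebesgue[OF g(1)])
    have "(\<lambda>n. \<integral>x. cutoff R x * g n x * d x \<partial>lebesgue) \<longlonglongrightarrow> (\<integral>x. cutoff R x * sgn (d x) * d x \<partial>lebesgue)"
    proof (rule integral_dominated_convergence[where w = "\<lambda>x. \<bar>cutoff R x * d x\<bar>"])
      show "integrable lebesgue (\<lambda>x. \<bar>cutoff R x * d x\<bar>)" using icd by simp
      show "AE x in lebesgue. (\<lambda>n. cutoff R x * g n x * d x) \<longlonglongrightarrow> cutoff R x * sgn (d x) * d x"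
        using g(3) by eventually_elim (intro tendsto_intros)
      show "AE x in lebesgue. norm (cutoff R x * g n x * d x) \<le> \<bar>cutoff R x * d x\<bar>" for n
      proof (rule AE_I2)
        fix x
        have "\<bar>g n x\<bar> * \<bar>cutoff R x * d x\<bar> \<le> 1 * \<bar>cutoff R x * d x\<bar>"
          by (intro mult_right_mono g(2)) simp
        then show "norm (cutoff R x * g n x * d x) \<le> \<bar>cutoff R x * d x\<bar>" by (simp add: abs_mult ac_simps)
      qed
    qed measurable
    then have "(\<integral>x. cutoff R x * sgn (d x) * d x \<partial>lebesgue) = 0"
      by (simp add: cont0[OF g(1,2)] LIMSEQ_const_iff)
    moreover have "cutoff R x * sgn (d x) * d x = \<bar>cutoff R x * d x\<bar>" for x
      by (cases "d x" "0::real" rule: linorder_cases) (auto simp: abs_mult)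
    ultimately have "(\<integral>x. \<bar>cutoff R x * d x\<bar> \<partial>lebesgue) = 0" by simp
    then show ?thesis using icd by (subst (asm) integral_nonneg_eq_0_iff_AE) auto
  qed
  then have "AE x in lebesgue. \<forall>n. cutoff (real (Suc n)) x * d x = 0"
    unfolding AE_all_countable by (intro allI) (simp del: of_nat_Suc mult_eq_0_iff)
  then show ?thesis
  proof eventually_elim
    case (elim x)
    obtain n where "norm x < real (Suc n)" using reals_Archimedean2 by (metis less_Suc_eq of_nat_less_iff order.strict_trans)
    then have "cutoff (real (Suc n)) x > 0" by (intro cutoff_pos) auto
    then show ?case using elim[rule_format, of n] by simp
  qed
qed

subsection \<open>Weak derivatives as generators of the translation group\<close>

text \<open>The weak derivative as a relation between classes, both pairings being inner products;
  on square-integrable representatives it coincides with \<open>is_weak_deriv\<close>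
  (\<open>wd_abs_iff\<close>).\<close>

definition wd :: "'n \<Rightarrow> 'n::finite lsq \<Rightarrow> 'n lsq \<Rightarrow> bool" where
  "wd i u w \<longleftrightarrow> (\<forall>\<phi>. test_fun \<phi> \<longrightarrow> inner (abs_lsq (pd i \<phi>)) u = - inner (abs_lsq \<phi>) w)"

lemma wd_abs_iff:
  fixes u w :: "real^'n \<Rightarrow> real"
  assumes "L2 u" "L2 w"
  shows "wd i (abs_lsq u) (abs_lsq w) \<longleftrightarrow> is_weak_deriv i u w"
proof -
  have "integrable lebesgue (\<lambda>x. frechet_derivative \<phi> (at x) (axis i 1) * u x)"
    "integrable lebesgue (\<lambda>x. \<phi> x * w x)"
    "inner (abs_lsq (pd i \<phi>)) (abs_lsq u) = (\<integral>x. frechet_derivative \<phi> (at x) (axis i 1) * u x \<partial>lebesgue)"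
    "inner (abs_lsq \<phi>) (abs_lsq w) = (\<integral>x. \<phi> x * w x \<partial>lebesgue)" if "test_fun \<phi>" for \<phi>
    using L2_mult_integrable[OF test_fun_L2(2)[OF that, of i] assms(1)]
      L2_mult_integrable[OF test_fun_L2(1)[OF that] assms(2)]
      inner_abs_lsq[OF test_fun_L2(2)[OF that, of i] assms(1)]
      inner_abs_lsq[OF test_fun_L2(1)[OF that] assms(2)]
    by (simp_all add: pd_def)
  then show ?thesis
    using assms(2) by (simp add: wd_def is_weak_deriv_def L2D)
qed

text \<open>By density \<open>z\<close> may be tested against itself, giving
  \<open>\<bar>inner z z\<bar> \<le> C * norm z\<close>. This turns duality estimates into norm
  estimates; \<open>C = 0\<close> yields uniqueness.\<close>

lemma norm_le_if_inner_test_le: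
  fixes z :: "'n::finite lsq"
  assumes "C \<ge> 0" and le: "\<And>\<phi>. test_fun \<phi> \<Longrightarrow> \<bar>inner z (abs_lsq \<phi>)\<bar> \<le> C * norm (abs_lsq \<phi>)"
  shows "norm z \<le> C"
proof -
  have "z \<in> closure (abs_lsq ` {\<phi>. test_fun \<phi>})" by (simp add: test_fun_dense)
  then obtain y where y: "\<And>n. y n \<in> abs_lsq ` {\<phi>. test_fun \<phi>}" "y \<longlonglongrightarrow> z"
    unfolding closure_sequential by blast
  have "(\<lambda>n. \<bar>inner z (y n)\<bar>) \<longlonglongrightarrow> \<bar>inner z z\<bar>" using y(2) by (intro tendsto_intros)
  moreover have "(\<lambda>n. C * norm (y n)) \<longlonglongrightarrow> C * norm z" using y(2) by (intro tendsto_intros)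
  ultimately have "\<bar>inner z z\<bar> \<le> C * norm z" 
    by (rule LIMSEQ_le, intro exI[of _ 0] allI impI) (metis y(1) le imageE mem_Collect_eq)
  then have "norm z * norm z \<le> C * norm z" by (simp add: power2_norm_eq_inner[symmetric] power2_eq_square)
  then show ?thesis using assms(1) by (cases "norm z = 0") (auto simp: mult_le_cancel_right)
qed

lemma wd_unique: "wd i u v \<Longrightarrow> wd i u w \<Longrightarrow> v = w"
proof -
  assume "wd i u v" "wd i u w"
  then have "inner (v - w) (abs_lsq \<phi>) = 0" if "test_fun \<phi>" for \<phi>
  proof -
    have "inner (abs_lsq \<phi>) v = inner (abs_lsq \<phi>) w"
      using \<open>wd i u v\<close> \<open>wd i u w\<close> that unfolding wd_def by (metis neg_equal_iff_equal)
    then show ?thesis by (simp add: inner_commute[of "v - w"] inner_diff_right)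
  qed
  then have "norm (v - w) \<le> 0" by (intro norm_le_if_inner_test_le) auto
  then show "v = w" by simp
qed

lemma wd_add: "wd i u u' \<Longrightarrow> wd i v v' \<Longrightarrow> wd i (u + v) (u' + v')"
  and wd_diff: "wd i u u' \<Longrightarrow> wd i v v' \<Longrightarrow> wd i (u - v) (u' - v')"
  and wd_scaleR: "wd i u u' \<Longrightarrow> wd i (c *\<^sub>R u) (c *\<^sub>R u')"
  and wd_zero: "wd i 0 0"
  by (auto simp: wd_def inner_add_right inner_diff_right)

text \<open>The defining identity sees \<open>u\<close> and \<open>w\<close> only through inner
  products with fixed vectors, hence survives limits: the generator is a closed operator.\<close>

lemma wd_closed:
  fixes a b :: "'n::finite lsq"
  assumes "\<And>n. wd i (u n) (w n)" "(u \<longlongrightarrow> a) F" "(w \<longlongrightarrow> b) F" "F \<noteq> bot"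
  shows "wd i a b"
  unfolding wd_def
proof (intro allI impI)
  fix \<phi> :: "real^'n \<Rightarrow> real" assume "test_fun \<phi>"
  then have "(\<lambda>n. inner (abs_lsq (pd i \<phi>)) (u n)) = (\<lambda>n. - inner (abs_lsq \<phi>) (w n))"
    using assms(1) by (auto simp: wd_def)
  moreover have "((\<lambda>n. inner (abs_lsq (pd i \<phi>)) (u n)) \<longlongrightarrow> inner (abs_lsq (pd i \<phi>)) a) F"
    by (intro tendsto_intros assms)
  moreover have "((\<lambda>n. - inner (abs_lsq \<phi>) (w n)) \<longlongrightarrow> - inner (abs_lsq \<phi>) b) F"
    by (intro tendsto_intros assms)
  ultimately show "inner (abs_lsq (pd i \<phi>)) a = - inner (abs_lsq \<phi>) b"
    using tendsto_unique[OF assms(4)] by metis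
qed

lemma test_fun_uniform_bound:
  assumes "test_fun \<phi>"
  obtains M R where "M > 0" "R > 0" "\<And>x. \<bar>\<phi> x\<bar> \<le> M" "\<And>i x. \<bar>pd i \<phi> x\<bar> \<le> M"
    "\<And>x. norm x > R \<Longrightarrow> \<phi> x = 0" "\<And>i x. norm x > R \<Longrightarrow> pd i \<phi> x = 0"
proof -
  obtain R where R: "R > 0" "\<And>x. norm x > R \<Longrightarrow> \<phi> x = 0" "\<And>i x. norm x > R \<Longrightarrow> pd i \<phi> x = 0"
    by (rule test_funE[OF assms], rule that, assumption+)
  have "continuous_on UNIV \<phi>" using assms by (auto simp: test_fun_iff C1_continuous)
  from continuous_support_bounded[OF this R(2)]
  obtain M0 where M0: "M0 > 0" "\<And>x. \<bar>\<phi> x\<bar> \<le> M0 * indicator (cball 0 R) x" by blast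
  have "\<exists>M>0. \<forall>x. \<bar>pd i \<phi> x\<bar> \<le> M * indicator (cball 0 R) x" for i
    by (rule continuous_support_bounded[OF pd_continuous[OF assms] R(3)])
  then obtain M where M: "\<And>i. M i > 0" "\<And>i x. \<bar>pd i \<phi> x\<bar> \<le> M i * indicator (cball 0 R) x" by metis
  let ?M = "M0 + (\<Sum>i\<in>UNIV. M i)"
  have s0: "0 \<le> (\<Sum>i\<in>UNIV. M i)" using M(1) by (intro sum_nonneg) (auto intro: less_imp_le)
  show ?thesis
  proof (rule that[of ?M R])
    show "?M > 0" using M0 s0 by linarith
    show "\<bar>\<phi> x\<bar> \<le> ?M" for x
      using M0(2)[of x] M0(1) s0 by (cases "x \<in> cball 0 R") auto
    show "\<bar>pd i \<phi> x\<bar> \<le> ?M" for i x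
    proof -
      have "M i \<le> (\<Sum>i\<in>UNIV. M i)" using M(1) by (intro member_le_sum) (auto intro: less_imp_le)
      then show ?thesis
        using M(2)[of i x] M0(1) M(1)[of i] by (cases "x \<in> cball 0 R") auto
    qed
  qed (use R in auto)
qed

text \<open>Limits in the parameter reduce to sequences, for which dominated convergence is
  available. The bounds hold only for \<open>norm a \<le> 1\<close>, so an initial segment is
  dropped.\<close>

lemma lsq_limit_at_0:
  fixes f :: "'b::real_normed_vector \<Rightarrow> real^'n \<Rightarrow> real" and v :: "real^'n \<Rightarrow> real"
  assumes meas: "\<And>a. f a \<in> borel_measurable lebesgue" "v \<in> borel_measurable lebesgue"
    and bound: "\<And>a x. norm a \<le> 1 \<Longrightarrow> \<bar>f a x\<bar> \<le> M"
    and supp: "\<And>a x. norm a \<le> 1 \<Longrightarrow> norm x > R \<Longrightarrow> f a x = 0"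
    and lim: "\<And>x. ((\<lambda>a. f a x) \<longlongrightarrow> v x) (at 0)"
  shows "((\<lambda>a. abs_lsq (f a)) \<longlongrightarrow> abs_lsq v) (at 0)"
  unfolding tendsto_at_iff_sequentially
proof (intro allI impI)
  fix X :: "nat \<Rightarrow> 'b" assume X: "\<forall>i. X i \<in> UNIV - {0}" "X \<longlonglongrightarrow> 0"
  from X(2) have "\<forall>\<^sub>F n in sequentially. norm (X n) < 1"
    using tendstoD[of X 0 _ 1] by (simp add: dist_norm)
  then obtain N where N: "\<And>n. n \<ge> N \<Longrightarrow> norm (X n) \<le> 1"
    unfolding eventually_sequentially by (meson less_imp_le)
  have "(\<lambda>n. abs_lsq (f (X (n + N)))) \<longlonglongrightarrow> abs_lsq v"
  proof (rule lsq_dominated_convergence(2)[OF L2_indicator_cball[of M R]])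
    show "AE x in lebesgue. \<bar>f (X (n + N)) x\<bar> \<le> \<bar>M * indicator (cball 0 R) x\<bar>" for n
    proof (rule AE_I2)
      fix x :: "real^'n"
      show "\<bar>f (X (n + N)) x\<bar> \<le> \<bar>M * indicator (cball 0 R) x\<bar>"
        using bound[OF N, of "n + N" x] supp[OF N, of "n + N" x] by (cases "norm x \<le> R") auto
    qed
    show "AE x in lebesgue. (\<lambda>n. f (X (n + N)) x) \<longlonglongrightarrow> v x"
    proof (rule AE_I2)
      fix x :: "real^'n"
      have "(\<lambda>n. f (X n) x) \<longlonglongrightarrow> v x"
        using lim[of x] X unfolding tendsto_at_iff_sequentially by (auto simp: o_def)
      then show "(\<lambda>n. f (X (n + N)) x) \<longlonglongrightarrow> v x" by (rule LIMSEQ_ignore_initial_segment)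
    qed
  qed (use meas in auto)
  then show "((\<lambda>a. abs_lsq (f a)) \<circ> X) \<longlonglongrightarrow> abs_lsq v" by (auto dest: LIMSEQ_offset simp: o_def)
qed

text \<open>The error splits into an approximation error, its translate, which has the same norm,
  and the displacement of a test function, which tends to 0 by dominated convergence.\<close>

theorem tr_tendsto: "((\<lambda>a. tr a u) \<longlongrightarrow> u) (at 0)"
proof (rule tendstoI)
  fix e :: real assume "e > 0"
  then have "e / 3 > 0" by simp
  then obtain \<phi> where \<phi>: "test_fun \<phi>" "norm (abs_lsq \<phi> - u) < e / 3" by (rule test_fun_approx)
  obtain M R where MR: "M > 0" "R > 0" "\<And>x. \<bar>\<phi> x\<bar> \<le> M" "\<And>x. norm x > R \<Longrightarrow> \<phi> x = 0"
    by (rule test_fun_uniform_bound[OF \<phi>(1)], rule that, assumption+)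
  have cont: "continuous_on UNIV \<phi>" using \<phi>(1) by (auto simp: test_fun_iff C1_continuous)
  have "((\<lambda>a. abs_lsq (\<lambda>x. \<phi> (x + a))) \<longlongrightarrow> abs_lsq \<phi>) (at 0)"
  proof (rule lsq_limit_at_0[where M = M and R = "R + 1"])
    show "(\<lambda>x. \<phi> (x + a)) \<in> borel_measurable lebesgue" for a
      by (intro continuous_borel_lebesgue continuous_on_compose2[OF cont]) (auto intro!: continuous_intros)
    show "\<phi> \<in> borel_measurable lebesgue" by (rule continuous_borel_lebesgue[OF cont])
    show "\<phi> (x + a) = 0" if "norm a \<le> 1" "norm x > R + 1" for a x
      using norm_triangle_ineq4[of "x + a" a] that by (intro MR(4)) simp
    show "((\<lambda>a. \<phi> (x + a)) \<longlongrightarrow> \<phi> x) (at 0)" for x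
    proof -
      have "isCont \<phi> x" using cont by (simp add: continuous_on_eq_continuous_at)
      then show ?thesis by (simp add: isCont_iff)
    qed
  qed (rule MR)
  then have "((\<lambda>a. tr a (abs_lsq \<phi>)) \<longlongrightarrow> abs_lsq \<phi>) (at 0)"
    by (simp add: tr_abs test_fun_L2(1)[OF \<phi>(1)])
  from tendstoD[OF this \<open>e / 3 > 0\<close>]
  show "\<forall>\<^sub>F a in at 0. dist (tr a u) u < e"
  proof eventually_elim
    case (elim a)
    have "tr a u - u = tr a (u - abs_lsq \<phi>) + (tr a (abs_lsq \<phi>) - abs_lsq \<phi>) + (abs_lsq \<phi> - u)"
      by (simp add: tr_diff)
    also have "norm \<dots> \<le> norm (tr a (u - abs_lsq \<phi>)) + norm (tr a (abs_lsq \<phi>) - abs_lsq \<phi>) + norm (abs_lsq \<phi> - u)"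
      by (meson add_mono norm_triangle_ineq norm_triangle_le order_refl)
    also have "\<dots> < e" using elim \<phi>(2) by (simp add: dist_norm norm_minus_commute)
    finally show ?case by (simp add: dist_norm)
  qed
qed

lemma continuous_on_tr: "continuous_on S (\<lambda>a. tr a u)"
proof -
  have "isCont (\<lambda>a. tr a u) a" for a
  proof -
    have "((\<lambda>h. tr h (tr a u)) \<longlongrightarrow> tr a u) (at 0)" by (rule tr_tendsto)
    then show ?thesis by (simp add: isCont_iff tr_tr add.commute)
  qed
  then show ?thesis by (simp add: continuous_at_imp_continuous_on)
qed

section \<open>Difference quotients and their limits\<close>

definition dq :: "'n \<Rightarrow> real \<Rightarrow> 'n::finite lsq \<Rightarrow> 'n lsq" where
  "dq i h u = (1 / h) *\<^sub>R (tr (h *\<^sub>R axis i 1) u - u)"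

text \<open>The mean value inequality bounds the quotients by the supremum of the derivative, and
  for \<open>\<bar>h\<bar> \<le> 1\<close> all supports lie in one ball; so the pointwise limit is a
  limit in norm.\<close>

lemma dq_pd:
  assumes \<phi>: "test_fun \<phi>"
  shows "((\<lambda>h. dq i h (abs_lsq \<phi>)) \<longlongrightarrow> abs_lsq (pd i \<phi>)) (at 0)"
proof -
  let ?e = "axis i 1 :: real^'a"
  obtain M R where MR: "M > 0" "R > 0" "\<And>i x. \<bar>pd i \<phi> x\<bar> \<le> M" "\<And>x. norm x > R \<Longrightarrow> \<phi> x = 0"
    by (rule test_fun_uniform_bound[OF \<phi>], rule that, assumption+)
  obtain D where D: "\<And>x. (\<phi> has_derivative blinfun_apply (D x)) (at x)"
     "\<And>i x. pd i \<phi> x = blinfun_apply (D x) (axis i 1)"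
    by (rule test_funE[OF \<phi>], rule that, assumption+)
  have cont: "continuous_on UNIV \<phi>" using \<phi>(1) by (auto simp: test_fun_iff C1_continuous)
  have der: "((\<lambda>t. \<phi> (x + t *\<^sub>R ?e)) has_real_derivative pd i \<phi> (x + t *\<^sub>R ?e)) (at t)" for x t
  proof -
    have "((\<lambda>t. x + t *\<^sub>R ?e) has_derivative (\<lambda>s. s *\<^sub>R ?e)) (at t)" by (auto intro!: derivative_eq_intros)
    from has_derivative_compose[OF this D(1)]
    show ?thesis
      by (simp add: has_field_derivative_def D(2) blinfun.scaleR_right mult.commute[of _ "blinfun_apply _ _"])
  qed
  have "((\<lambda>h. abs_lsq (\<lambda>x. (1 / h) * (\<phi> (x + h *\<^sub>R ?e) - \<phi> x))) \<longlongrightarrow> abs_lsq (pd i \<phi>)) (at 0)"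
  proof (rule lsq_limit_at_0[where M = M and R = "R + 1"])
    show "(\<lambda>x. (1 / h) * (\<phi> (x + h *\<^sub>R ?e) - \<phi> x)) \<in> borel_measurable lebesgue" for h
      by (intro continuous_borel_lebesgue continuous_intros continuous_on_compose2[OF cont])
         (auto intro!: continuous_intros cont)
    show "pd i \<phi> \<in> borel_measurable lebesgue" by (rule continuous_borel_lebesgue[OF pd_continuous[OF \<phi>]])
    show "(1 / h) * (\<phi> (x + h *\<^sub>R ?e) - \<phi> x) = 0" if "norm h \<le> 1" "norm x > R + 1" for h :: real and x
    proof -
      have "norm (h *\<^sub>R ?e) \<le> 1" using that by simp
      then have "norm (x + h *\<^sub>R ?e) > R"
        using norm_triangle_ineq4[of "x + h *\<^sub>R ?e" "h *\<^sub>R ?e"] that(2) by simp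
      then show ?thesis using MR(4) that(2) by simp
    qed
    show "\<bar>(1 / h) * (\<phi> (x + h *\<^sub>R ?e) - \<phi> x)\<bar> \<le> M" if "norm h \<le> 1" for h :: real and x
    proof (cases "h = 0")
      case False
      have "norm (\<phi> (x + h *\<^sub>R ?e) - \<phi> (x + 0 *\<^sub>R ?e)) \<le> M * norm (h - 0)"
        by (rule field_differentiable_bound[of UNIV _ "\<lambda>t. pd i \<phi> (x + t *\<^sub>R ?e)"])
           (use der MR(3) in auto)
      then show ?thesis using False by (simp add: abs_mult field_simps)
    qed (use MR in simp)
    show "((\<lambda>h. (1 / h) * (\<phi> (x + h *\<^sub>R ?e) - \<phi> x)) \<longlongrightarrow> pd i \<phi> x) (at 0)" for x
      using der[of x 0] by (simp add: DERIV_def)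
  qed
  moreover have "dq i h (abs_lsq \<phi>) = abs_lsq (\<lambda>x. (1 / h) * (\<phi> (x + h *\<^sub>R ?e) - \<phi> x))" for h
    unfolding dq_def tr_abs[OF test_fun_L2(1)[OF \<phi>]]
    by (subst abs_lsq_scale) (simp_all only: abs_lsq_diff test_fun_L2(1)[OF \<phi>] L2_translate L2_diff)
  ultimately show ?thesis by simp
qed

lemma dq_inner: "inner (dq i h u) v = - inner u (dq i (- h) v)"
  by (simp add: dq_def inner_diff_left inner_diff_right inner_tr_left diff_divide_distrib)

text \<open>By the group law the quotient at \<open>t\<close> is an isometry applied to the quotient
  at 0, so a single limit differentiates the whole orbit.\<close>

lemma has_vector_derivative_tr:
  assumes "((\<lambda>h. dq i h u) \<longlongrightarrow> w) (at 0)"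
  shows "((\<lambda>t. tr (t *\<^sub>R axis i 1) u) has_vector_derivative tr (t *\<^sub>R axis i 1) w) (at t)"
  unfolding has_vector_derivative_def has_derivative_at
proof
  let ?e = "axis i 1 :: real^'a"
  show "bounded_linear (\<lambda>x. x *\<^sub>R tr (t *\<^sub>R ?e) w)" by (rule bounded_linear_scaleR_left)
  have "((\<lambda>h. norm (dq i h u - w)) \<longlongrightarrow> 0) (at 0)"
    using assms by (simp add: tendsto_norm_zero_iff LIM_zero)
  moreover have "norm (dq i h u - w)
      = norm (tr ((t + h) *\<^sub>R ?e) u - tr (t *\<^sub>R ?e) u - h *\<^sub>R tr (t *\<^sub>R ?e) w) / norm h" if "h \<noteq> 0" for h
  proof -
    have "tr ((t + h) *\<^sub>R ?e) u - tr (t *\<^sub>R ?e) u - h *\<^sub>R tr (t *\<^sub>R ?e) w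
      = h *\<^sub>R tr (t *\<^sub>R ?e) (dq i h u - w)"
      using that by (simp add: dq_def tr_diff tr_scaleR tr_tr scaleR_left_distrib scaleR_right_diff_distrib)
    then show ?thesis using that by simp
  qed
  ultimately show "(\<lambda>h. norm (tr ((t + h) *\<^sub>R ?e) u - tr (t *\<^sub>R ?e) u - h *\<^sub>R tr (t *\<^sub>R ?e) w) / norm h) \<midarrow>0\<rightarrow> 0"
    by (subst tendsto_cong[OF eventually_at_filter[THEN iffD2], rule_format]) 
       (auto intro: always_eventually elim: Lim_transform_eventually simp: eventually_at_filter)
qed

text \<open>The orbit of \<open>u\<close> is paired with \<phi> and the translation moved onto
  \<phi>, whose orbit is differentiable in norm; the weak derivative brings \<open>w\<close> back.
  The comparison vector is free: \<open>z = 0\<close> bounds difference quotients,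
  \<open>z = w\<close> makes them converge.\<close>

lemma wd_mean_value:
  assumes wd: "wd i u w" and C: "\<And>t. \<bar>t\<bar> \<le> \<bar>h\<bar> \<Longrightarrow> norm (tr (t *\<^sub>R axis i 1) w - z) \<le> C"
  shows "norm (tr (h *\<^sub>R axis i 1) u - u - h *\<^sub>R z) \<le> \<bar>h\<bar> * C"
proof (rule norm_le_if_inner_test_le)
  let ?e = "axis i 1 :: real^'a"
  have "0 \<le> norm (tr (0 *\<^sub>R ?e) w - z)" by simp
  also have "\<dots> \<le> C" by (rule C) simp
  finally show "0 \<le> \<bar>h\<bar> * C" by simp
  fix \<phi> :: "real^'a \<Rightarrow> real" assume \<phi>: "test_fun \<phi>"
  let ?F = "\<lambda>t. inner u (tr (- t *\<^sub>R ?e) (abs_lsq \<phi>)) - t * inner z (abs_lsq \<phi>)"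
  have der: "(?F has_real_derivative inner (tr (t *\<^sub>R ?e) w - z) (abs_lsq \<phi>)) (at t)" for t
  proof -
    have 1: "((\<lambda>t. tr (t *\<^sub>R ?e) (abs_lsq \<phi>)) has_vector_derivative tr (s *\<^sub>R ?e) (abs_lsq (pd i \<phi>))) (at s)" for s
      by (rule has_vector_derivative_tr[OF dq_pd[OF \<phi>]])
    have "((\<lambda>t. tr (- t *\<^sub>R ?e) (abs_lsq \<phi>)) has_vector_derivative (- 1) *\<^sub>R tr (- t *\<^sub>R ?e) (abs_lsq (pd i \<phi>))) (at t)"
      using vector_diff_chain_at[OF has_vector_derivative_minus[OF has_vector_derivative_id] 1]
      by (simp add: o_def)
    from bounded_linear.has_vector_derivative[OF bounded_linear_inner_right[of u] this]
    have 2: "((\<lambda>t. inner u (tr (- t *\<^sub>R ?e) (abs_lsq \<phi>))) has_real_derivative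
        - inner u (tr (- t *\<^sub>R ?e) (abs_lsq (pd i \<phi>)))) (at t)"
      by (simp add: has_real_derivative_iff_has_vector_derivative)
    have 3: "tr a (abs_lsq (pd i \<phi>)) = abs_lsq (pd i (\<lambda>x. \<phi> (x + a)))" for a
    proof -
      have "(\<lambda>x. pd i \<phi> (x + a)) = pd i (\<lambda>x. \<phi> (x + a))" by (rule ext) (simp add: pd_translate[OF \<phi>])
      then show ?thesis by (simp add: tr_abs test_fun_L2[OF \<phi>])
    qed
    have "inner u (tr (- t *\<^sub>R ?e) (abs_lsq (pd i \<phi>))) = - inner w (tr (- t *\<^sub>R ?e) (abs_lsq \<phi>))"
      unfolding 3 tr_abs[OF test_fun_L2(1)[OF \<phi>]]
      using wd[unfolded wd_def, rule_format, OF test_fun_translate[OF \<phi>]]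
      by (simp only: inner_commute[of u] inner_commute[of w])
    with 2 have "((\<lambda>t. inner u (tr (- t *\<^sub>R ?e) (abs_lsq \<phi>))) has_real_derivative
        inner (tr (t *\<^sub>R ?e) w) (abs_lsq \<phi>)) (at t)"
      by (simp add: inner_tr_left)
    then show ?thesis by (auto intro!: derivative_eq_intros simp: inner_diff_left)
  qed
  have "norm (?F h - ?F 0) \<le> (C * norm (abs_lsq \<phi>)) * norm (h - 0)"
  proof (rule field_differentiable_bound)
    show "convex {- \<bar>h\<bar> .. \<bar>h\<bar>}" by simp
    show "(?F has_field_derivative inner (tr (t *\<^sub>R ?e) w - z) (abs_lsq \<phi>)) (at t within {- \<bar>h\<bar> .. \<bar>h\<bar>})" for t
      using der by (rule has_field_derivative_at_within)
    show "norm (inner (tr (t *\<^sub>R ?e) w - z) (abs_lsq \<phi>)) \<le> C * norm (abs_lsq \<phi>)" if "t \<in> {- \<bar>h\<bar> .. \<bar>h\<bar>}" for t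
    proof -
      have "\<bar>t\<bar> \<le> \<bar>h\<bar>" using that by auto
      then have "norm (tr (t *\<^sub>R ?e) w - z) * norm (abs_lsq \<phi>) \<le> C * norm (abs_lsq \<phi>)"
        by (intro mult_right_mono C) auto
      then show ?thesis using Cauchy_Schwarz_ineq2[of "tr (t *\<^sub>R ?e) w - z" "abs_lsq \<phi>"] by simp
    qed
  qed auto
  then show "\<bar>inner (tr (h *\<^sub>R ?e) u - u - h *\<^sub>R z) (abs_lsq \<phi>)\<bar> \<le> \<bar>h\<bar> * C * norm (abs_lsq \<phi>)"
    by (simp add: inner_diff_left inner_tr_left algebra_simps)
qed

text \<open>The mean value inequality with \<open>z = 0\<close>. At \<open>h = 0\<close> division by
  zero makes the quotient 0, so the bound holds for every \<open>h\<close>.\<close>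

lemma norm_dq_le:
  assumes "wd i u w" shows "norm (dq i h u) \<le> norm w"
proof (cases "h = 0")
  case False
  have "norm (tr (h *\<^sub>R axis i 1) u - u - h *\<^sub>R 0) \<le> \<bar>h\<bar> * norm w"
    by (rule wd_mean_value[OF assms]) simp
  moreover have "norm (dq i h u) = norm (tr (h *\<^sub>R axis i 1) u - u) / \<bar>h\<bar>" by (simp add: dq_def)
  ultimately show ?thesis using False by (simp add: pos_divide_le_eq mult.commute)
qed (simp add: dq_def)

text \<open>Forward: the mean value inequality with \<open>z = w\<close>, made small by strong
  continuity. Backward: \<open>dq_inner\<close> moves the quotient to the test function, where it
  converges in norm. Identities for quotients thus become identities for weak derivatives.\<close>

theorem wd_iff_dq: "wd i u w \<longleftrightarrow> ((\<lambda>h. dq i h u) \<longlongrightarrow> w) (at 0)"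
proof
  assume wd: "wd i u w"
  show "((\<lambda>h. dq i h u) \<longlongrightarrow> w) (at 0)"
  proof (rule tendstoI)
    fix e :: real assume e: "e > 0"
    have "((\<lambda>t. tr (t *\<^sub>R axis i 1) w) \<longlongrightarrow> w) (at 0)"
    proof -
      have "continuous_on UNIV (\<lambda>t::real. tr (t *\<^sub>R axis i 1) w)"
        by (rule continuous_on_compose2[OF continuous_on_tr[of UNIV]]) (auto intro!: continuous_intros)
      then have "isCont (\<lambda>t::real. tr (t *\<^sub>R axis i 1) w) 0" by (simp add: continuous_on_eq_continuous_at)
      then show ?thesis by (simp add: isCont_def)
    qed
    then obtain d where d: "d > 0" "\<And>t. t \<noteq> 0 \<Longrightarrow> \<bar>t\<bar> < d \<Longrightarrow> norm (tr (t *\<^sub>R axis i 1) w - w) < e / 2"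
      using LIM_D[of "\<lambda>t::real. tr (t *\<^sub>R axis i 1) w" w 0 "e / 2"] e by auto
    have "norm (dq i h u - w) < e" if h: "h \<noteq> 0" "\<bar>h\<bar> < d" for h
    proof -
      have "norm (tr (h *\<^sub>R axis i 1) u - u - h *\<^sub>R w) \<le> \<bar>h\<bar> * (e / 2)"
      proof (rule wd_mean_value[OF wd])
        show "norm (tr (t *\<^sub>R axis i 1) w - w) \<le> e / 2" if "\<bar>t\<bar> \<le> \<bar>h\<bar>" for t
          using d(2)[of t] h that e by (cases "t = 0") (auto intro: less_imp_le)
      qed
      moreover have "tr (h *\<^sub>R axis i 1) u - u - h *\<^sub>R w = h *\<^sub>R (dq i h u - w)"
        using h by (simp add: dq_def scaleR_right_diff_distrib)
      ultimately have "norm (dq i h u - w) \<le> e / 2" using h by simp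
      then show ?thesis using e by simp
    qed
    then show "\<forall>\<^sub>F h in at 0. dist (dq i h u) w < e"
      unfolding eventually_at using d(1) by (intro exI[of _ d]) (auto simp: dist_norm)
  qed
next
  assume lim: "((\<lambda>h. dq i h u) \<longlongrightarrow> w) (at 0)"
  show "wd i u w" unfolding wd_def
  proof (intro allI impI)
    fix \<phi> :: "real^'a \<Rightarrow> real" assume \<phi>: "test_fun \<phi>"
    have m: "filterlim uminus (at 0) (at (0::real))"
      by (rule filterlim_atI) (auto intro!: tendsto_eq_intros simp: eventually_at_filter)
    have "((\<lambda>h. - inner (dq i (- h) (abs_lsq \<phi>)) u) \<longlongrightarrow> - inner (abs_lsq (pd i \<phi>)) u) (at 0)"
      by (intro tendsto_intros filterlim_compose[OF dq_pd[OF \<phi>] m])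
    moreover have "- inner (dq i (- h) (abs_lsq \<phi>)) u = inner (abs_lsq \<phi>) (dq i h u)" for h
      using dq_inner[of i "- h" "abs_lsq \<phi>" u] by simp
    moreover have "((\<lambda>h. inner (abs_lsq \<phi>) (dq i h u)) \<longlongrightarrow> inner (abs_lsq \<phi>) w) (at 0)"
      by (intro tendsto_intros lim)
    ultimately show "inner (abs_lsq (pd i \<phi>)) u = - inner (abs_lsq \<phi>) w"
      using tendsto_unique[OF trivial_limit_at] by fastforce
  qed
qed

lemma wd_integration_by_parts:
  assumes "wd i u u'" "wd i v v'"
  shows "inner u' v = - inner u v'"
proof -
  have m: "filterlim uminus (at 0) (at (0::real))"
    by (rule filterlim_atI) (auto intro!: tendsto_eq_intros simp: eventually_at_filter)
  have "((\<lambda>h. inner (dq i h u) v) \<longlongrightarrow> inner u' v) (at 0)"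
    using assms(1) by (intro tendsto_intros) (simp add: wd_iff_dq)
  moreover have "((\<lambda>h. - inner u (dq i (- h) v)) \<longlongrightarrow> - inner u v') (at 0)"
    using assms(2) by (intro tendsto_intros filterlim_compose[OF _ m, of "\<lambda>h. dq i h v"]) (simp add: wd_iff_dq)
  ultimately show ?thesis unfolding dq_inner using tendsto_unique[OF trivial_limit_at] by blast
qed

text \<open>Such an operator commutes with difference quotients, and boundedness carries it through
  the limit. Translations, Steklov averages and ball averages all qualify.\<close>

lemma wd_commuting:
  assumes T: "bounded_linear T" "\<And>a u. T (tr a u) = tr a (T u)" and "wd i u w"
  shows "wd i (T u) (T w)"
proof -
  have "T (dq i h u) = dq i h (T u)" for h
    by (simp add: dq_def linear_diff[OF bounded_linear.linear[OF T(1)]]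
        linear_scale[OF bounded_linear.linear[OF T(1)]] T(2))
  moreover have "((\<lambda>h. T (dq i h u)) \<longlongrightarrow> T w) (at 0)"
    using assms(3) by (intro bounded_linear.tendsto[OF T(1)]) (simp add: wd_iff_dq)
  ultimately show ?thesis by (simp add: wd_iff_dq)
qed

lemma wd_tr: "wd i u w \<Longrightarrow> wd i (tr a u) (tr a w)"
  by (rule wd_commuting[OF bounded_linear_tr]) (simp_all add: tr_tr add.commute)

lemma wd_dq: "wd i u w \<Longrightarrow> wd i (dq j h u) (dq j h w)"
  unfolding dq_def by (intro wd_scaleR wd_diff wd_tr)

subsection \<open>Steklov averages\<close>

text \<open>The mean of the translates over a segment of length \<open>h\<close> in direction
  \<open>i\<close>. It gains a weak derivative in that direction, namely \<open>dq i h u\<close>,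
  even when \<open>u\<close> has none.\<close>

definition steklov :: "'n \<Rightarrow> real \<Rightarrow> 'n::finite lsq \<Rightarrow> 'n lsq" where
  "steklov i h u = (1 / h) *\<^sub>R integral {0..h} (\<lambda>t. tr (t *\<^sub>R axis i 1) u)"

lemma continuous_on_tr_axis: "continuous_on S (\<lambda>t::real. tr (t *\<^sub>R axis i 1) u)"
  by (rule continuous_on_compose2[OF continuous_on_tr[of UNIV]]) (auto intro!: continuous_intros)

lemma tr_axis_integrable: "(\<lambda>t::real. tr (t *\<^sub>R axis i 1) u) integrable_on {a..b}"
  by (rule integrable_continuous_interval[OF continuous_on_tr_axis])

text \<open>An average of vectors within \<open>C\<close> of \<open>z\<close> stays within
  \<open>C\<close> of \<open>z\<close>; \<open>z = 0\<close> bounds the operator,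
  \<open>z = u\<close> gives convergence.\<close>

lemma norm_steklov_diff_le:
  assumes "h > 0" "\<And>t. 0 \<le> t \<Longrightarrow> t \<le> h \<Longrightarrow> norm (tr (t *\<^sub>R axis i 1) u - z) \<le> C"
  shows "norm (steklov i h u - z) \<le> C"
proof -
  have "integral {0..h} (\<lambda>t. tr (t *\<^sub>R axis i 1) u - z) = integral {0..h} (\<lambda>t. tr (t *\<^sub>R axis i 1) u) - h *\<^sub>R z"
    using assms(1) by (subst Henstock_Kurzweil_Integration.integral_diff) (auto simp: tr_axis_integrable)
  then have "steklov i h u - z = (1 / h) *\<^sub>R integral {0..h} (\<lambda>t. tr (t *\<^sub>R axis i 1) u - z)"
    using assms(1) by (simp add: steklov_def scaleR_right_diff_distrib)
  moreover have "norm (integral {0..h} (\<lambda>t. tr (t *\<^sub>R axis i 1) u - z)) \<le> C * (h - 0)"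
    using assms by (intro integral_bound continuous_intros continuous_on_tr_axis) auto
  ultimately show ?thesis using assms(1) by (simp add: field_simps)
qed

lemma bounded_linear_steklov: "h > 0 \<Longrightarrow> bounded_linear (steklov i h)"
proof (rule bounded_linear_intro[of _ 1])
  show "steklov i h (u + v) = steklov i h u + steklov i h v" for u v
    by (simp add: steklov_def tr_add Henstock_Kurzweil_Integration.integral_add tr_axis_integrable scaleR_right_distrib)
  show "steklov i h (c *\<^sub>R u) = c *\<^sub>R steklov i h u" for u c
    by (simp add: steklov_def tr_scaleR)
  show "norm (steklov i h u) \<le> norm u * 1" if "h > 0" for u
    using norm_steklov_diff_le[OF that, of i u 0 "norm u"] by simp
qed

lemma steklov_tr: "steklov i h (tr a u) = tr a (steklov i h u)"
  using integral_linear[OF tr_axis_integrable[of i u 0 h] bounded_linear_tr[of a]]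
  by (simp add: steklov_def tr_scaleR o_def tr_tr add.commute)

lemma wd_steklov_commute: "h > 0 \<Longrightarrow> wd j u w \<Longrightarrow> wd j (steklov i h u) (steklov i h w)"
  by (rule wd_commuting[OF bounded_linear_steklov]) (simp_all add: steklov_tr)

lemma steklov_tendsto: "((\<lambda>h. steklov i h u) \<longlongrightarrow> u) (at_right 0)"
proof (rule tendstoI)
  fix e :: real assume e: "e > 0"
  have "((\<lambda>t::real. tr (t *\<^sub>R axis i 1) u) \<longlongrightarrow> u) (at 0)"
    using continuous_on_tr_axis[of UNIV i u] by (simp add: continuous_on_def[of UNIV] del: tr_0) (metis scaleR_zero_left tr_0)
  then obtain d where d: "d > 0" "\<And>t. t \<noteq> 0 \<Longrightarrow> \<bar>t\<bar> < d \<Longrightarrow> norm (tr (t *\<^sub>R axis i 1) u - u) < e / 2"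
    using LIM_D[of "\<lambda>t::real. tr (t *\<^sub>R axis i 1) u" u 0 "e / 2"] e by auto
  have d': "norm (tr (t *\<^sub>R axis i 1) u - u) \<le> e / 2" if "\<bar>t\<bar> < d" for t
    using d(2)[of t] that e by (cases "t = 0") (auto intro: less_imp_le)
  show "\<forall>\<^sub>F h in at_right 0. dist (steklov i h u) u < e"
    unfolding eventually_at_right_field
  proof (intro exI[of _ d] conjI allI impI)
    fix h assume h: "0 < h" "h < d"
    have "norm (steklov i h u - u) \<le> e / 2"
      by (rule norm_steklov_diff_le[OF h(1)]) (use d' h in auto)
    then show "dist (steklov i h u) u < e" using e by (simp add: dist_norm)
  qed (rule d(1))
qed

text \<open>The fundamental theorem of calculus applied to the orbit of a test function paired with
  \<open>u\<close>: the derivative falls on \<phi> alone.\<close>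

lemma wd_steklov:
  assumes h: "h > 0" shows "wd i (steklov i h u) (dq i h u)"
  unfolding wd_def
proof (intro allI impI)
  let ?e = "axis i 1 :: real^'a"
  fix \<phi> :: "real^'a \<Rightarrow> real" assume \<phi>: "test_fun \<phi>"
  let ?p = "abs_lsq (pd i \<phi>)" and ?f = "abs_lsq \<phi>"
  have 1: "((\<lambda>t. tr (t *\<^sub>R ?e) ?f) has_vector_derivative tr (s *\<^sub>R ?e) ?p) (at s)" for s
    by (rule has_vector_derivative_tr[OF dq_pd[OF \<phi>]])
  have 2: "((\<lambda>t. - inner u (tr (- t *\<^sub>R ?e) ?f)) has_vector_derivative inner u (tr (- t *\<^sub>R ?e) ?p)) (at t within {0..h})" for t
  proof -
    have "((\<lambda>t. tr (- t *\<^sub>R ?e) ?f) has_vector_derivative (- 1) *\<^sub>R tr (- t *\<^sub>R ?e) ?p) (at t)"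
      using vector_diff_chain_at[OF has_vector_derivative_minus[OF has_vector_derivative_id] 1]
      by (simp add: o_def)
    from has_vector_derivative_minus[OF bounded_linear.has_vector_derivative[OF bounded_linear_inner_right[of u] this]]
    show ?thesis by (simp add: has_vector_derivative_at_within)
  qed
  have "((\<lambda>t. inner u (tr (- t *\<^sub>R ?e) ?p)) has_integral
      (- inner u (tr (- h *\<^sub>R ?e) ?f) - (- inner u (tr (- 0 *\<^sub>R ?e) ?f)))) {0..h}"
    by (rule fundamental_theorem_of_calculus) (use h 2 in auto)
  then have "integral {0..h} (\<lambda>t. inner ?p (tr (t *\<^sub>R ?e) u)) = - inner ?f (tr (h *\<^sub>R ?e) u - u)"
    by (intro integral_unique) (simp add: inner_commute[of u] inner_tr_left inner_diff_right)
  moreover have "integral {0..h} (\<lambda>t. inner ?p (tr (t *\<^sub>R ?e) u)) = inner ?p (integral {0..h} (\<lambda>t. tr (t *\<^sub>R ?e) u))"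
    using integral_linear[OF tr_axis_integrable[of i u 0 h] bounded_linear_inner_right[of ?p]] by (simp add: o_def)
  ultimately show "inner ?p (steklov i h u) = - inner ?f (dq i h u)"
    by (simp add: steklov_def dq_def)
qed

subsection \<open>Approximation by bounded functions\<close>

definition ball_kernel :: "real \<Rightarrow> real^'n \<Rightarrow> real" where
  "ball_kernel r x = indicator (cball 0 r) x / measure lebesgue (cball (0::real^'n) r)"

text \<open>Convolution with the normalized indicator of a ball, written as an inner product with a
  translate: strong continuity makes it continuous, Cauchy-Schwarz makes it bounded.\<close>

definition ball_avg :: "real \<Rightarrow> 'n::finite lsq \<Rightarrow> real^'n \<Rightarrow> real" where
  "ball_avg r u x = inner (abs_lsq (ball_kernel r)) (tr x u)"

lemma L2_ball_kernel: "L2 (ball_kernel r)"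
  using L2_indicator_cball[of "1 / measure lebesgue (cball 0 r)" r] by (simp add: ball_kernel_def[abs_def])

lemma ball_avg_continuous: "continuous_on UNIV (ball_avg r u)"
  unfolding ball_avg_def by (intro continuous_intros continuous_on_tr)

lemma ball_avg_bounded: "\<bar>ball_avg r u x\<bar> \<le> norm (abs_lsq (ball_kernel r :: real^'n \<Rightarrow> real)) * norm (u :: 'n::finite lsq)"
  unfolding ball_avg_def using Cauchy_Schwarz_ineq2[of "abs_lsq (ball_kernel r)" "tr x u"] by simp

text \<open>Cauchy-Schwarz on the ball bounds the squared deviation at \<open>x\<close> by the mean
  over \<open>y\<close> of the squared increments of \<open>u\<close>. After exchanging the
  integrals, the inner one is the squared norm of \<open>tr y u - u\<close>, at most
  \<open>C\<^sup>2\<close>.\<close>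

lemma ball_avg_close:
  fixes u :: "'n::finite lsq"
  assumes r: "r > 0" and C: "\<And>y. norm y \<le> r \<Longrightarrow> norm (tr y u - u) \<le> C"
  shows "L2 (ball_avg r u)" "norm (abs_lsq (ball_avg r u) - u) \<le> C"
proof -
  define m where "m = measure lebesgue (cball (0::real^'n) r)"
  have m: "m > 0" using r by (simp add: m_def content_cball_pos)
  define Q where "Q = (indicator (cball 0 r) :: real^'n \<Rightarrow> real)"
  have LQ: "L2 (\<lambda>y. c * Q y)" for c unfolding Q_def by (rule L2_indicator_cball)
  have intQ: "integrable lebesgue Q" "(\<integral>y. Q y \<partial>lebesgue) = m"
    using lmeasurable_iff_integrable[THEN iffD1, OF lmeasurable_cball[of "0::real^'n" r]]
    by (auto simp: Q_def m_def)
  have QQ: "Q y * Q y = Q y" for y by (simp add: Q_def indicator_def)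
  have [measurable]: "Q \<in> borel_measurable borel" unfolding Q_def by (intro borel_measurable_indicator) simp
  \<comment> \<open>Passing to a Borel representative makes \<open>u0 (y + x)\<close> jointly
    measurable, as the exchange of integrals requires.\<close>
  have "rep_lsq u \<in> borel_measurable (completion lborel)" using L2_rep[of u] by (simp add: L2_real)
  from completion_ex_borel_measurable_real[OF this]
  obtain u0 where u0 [measurable]: "u0 \<in> borel_measurable borel" and ae: "AE x in lborel. rep_lsq u x = u0 x"
    by auto
  have ae: "AE x in lebesgue. rep_lsq u x = u0 x" using ae by (rule AE_completion)
  have u0l: "u0 \<in> borel_measurable lebesgue" by (rule measurable_completion) simp
  have Lu0: "L2 u0" by (rule L2_cong_AE[OF L2_rep u0l ae])
  have u: "u = abs_lsq u0" using abs_lsq_eq_iff[OF L2_rep Lu0, of u] ae by simp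
  have pointwise: "ennreal ((ball_avg r u x - u0 x)\<^sup>2)
      \<le> (\<integral>\<^sup>+y. ennreal ((1 / m) * Q y * (u0 (y + x) - u0 x)\<^sup>2) \<partial>lebesgue)" for x
  proof -
    let ?b = "\<lambda>y. Q y * u0 (y + x) - u0 x * Q y"
    have LQu: "L2 (\<lambda>y. Q y * u0 (y + x))"
      by (rule L2_bound[OF L2_translate[OF Lu0, of x]])
         (use measurable_compose[OF measurable_plus_lebesgue u0l] LQ[of 1] in
          \<open>auto simp: L2_real Q_def indicator_def\<close>)
    have Lb: "L2 ?b" by (intro L2_diff LQu LQ)
    have int1: "integrable lebesgue (\<lambda>y. Q y * u0 (y + x))"
      using L2_mult_integrable[OF LQ[of 1] L2_translate[OF Lu0, of x]] by simp
    have "ball_avg r u x = (\<integral>y. ball_kernel r y * u0 (y + x) \<partial>lebesgue)"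
      unfolding ball_avg_def u tr_abs[OF Lu0] by (rule inner_abs_lsq[OF L2_ball_kernel L2_translate[OF Lu0]])
    also have "\<dots> = (1 / m) * (\<integral>y. Q y * u0 (y + x) \<partial>lebesgue)"
      by (simp add: ball_kernel_def Q_def m_def)
    finally have "ball_avg r u x - u0 x = (1 / m) * (\<integral>y. ?b y \<partial>lebesgue)"
      using m intQ int1 by (simp add: right_diff_distrib)
    also have "(\<integral>y. ?b y \<partial>lebesgue) = (\<integral>y. (1 * Q y) * ?b y \<partial>lebesgue)"
      by (rule Bochner_Integration.integral_cong) (auto simp: Q_def indicator_def)
    also have "\<dots> = inner (abs_lsq (\<lambda>y. 1 * Q y)) (abs_lsq ?b)"
      by (rule inner_abs_lsq[symmetric, OF LQ Lb])
    finally have eq: "(ball_avg r u x - u0 x)\<^sup>2 = (1 / m)\<^sup>2 * (inner (abs_lsq (\<lambda>y. 1 * Q y)) (abs_lsq ?b))\<^sup>2"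
      by (simp add: power_mult_distrib power_divide)
    have "(inner (abs_lsq (\<lambda>y. 1 * Q y)) (abs_lsq ?b))\<^sup>2
        \<le> inner (abs_lsq (\<lambda>y. 1 * Q y)) (abs_lsq (\<lambda>y. 1 * Q y)) * inner (abs_lsq ?b) (abs_lsq ?b)"
      by (rule Cauchy_Schwarz_ineq)
    also have "inner (abs_lsq (\<lambda>y. 1 * Q y)) (abs_lsq (\<lambda>y. 1 * Q y)) = m"
      by (subst inner_abs_lsq[OF LQ LQ]) (simp add: QQ intQ)
    also have "inner (abs_lsq ?b) (abs_lsq ?b) = (\<integral>y. Q y * (u0 (y + x) - u0 x)\<^sup>2 \<partial>lebesgue)"
      by (subst inner_abs_lsq[OF Lb Lb], rule Bochner_Integration.integral_cong)
         (auto simp: Q_def indicator_def power2_eq_square)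
    finally have "(ball_avg r u x - u0 x)\<^sup>2 \<le> (1 / m)\<^sup>2 * (m * (\<integral>y. Q y * (u0 (y + x) - u0 x)\<^sup>2 \<partial>lebesgue))"
      unfolding eq by (intro mult_left_mono) auto
    also have "\<dots> = (\<integral>y. (1 / m) * Q y * (u0 (y + x) - u0 x)\<^sup>2 \<partial>lebesgue)"
      using m by (simp add: power2_eq_square mult.assoc)
    finally have "ennreal ((ball_avg r u x - u0 x)\<^sup>2) \<le> ennreal \<dots>" by (rule ennreal_leI)
    also have "\<dots> = (\<integral>\<^sup>+y. ennreal ((1 / m) * Q y * (u0 (y + x) - u0 x)\<^sup>2) \<partial>lebesgue)"
    proof (rule nn_integral_eq_integral[symmetric])
      have "(\<lambda>y. (1 / m) * (?b y)\<^sup>2) = (\<lambda>y. (1 / m) * Q y * (u0 (y + x) - u0 x)\<^sup>2)"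
        by (auto simp: Q_def indicator_def fun_eq_iff)
      moreover have "integrable lebesgue (\<lambda>y. (1 / m) * (?b y)\<^sup>2)" using Lb by (simp add: L2_real)
      ultimately show "integrable lebesgue (\<lambda>y. (1 / m) * Q y * (u0 (y + x) - u0 x)\<^sup>2)" by simp
    qed (use m in \<open>auto simp: Q_def\<close>)
    finally show ?thesis .
  qed
  have trans: "(\<integral>\<^sup>+x. ennreal ((u0 (y + x) - u0 x)\<^sup>2) \<partial>lebesgue) = ennreal ((norm (tr y u - u))\<^sup>2)" for y
  proof -
    have L: "L2 (\<lambda>x. u0 (x + y) - u0 x)" by (intro L2_diff L2_translate Lu0)
    have "tr y u - u = abs_lsq (\<lambda>x. u0 (x + y) - u0 x)"
      by (simp add: u tr_abs Lu0 abs_lsq_diff L2_translate)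
    then show ?thesis
      using L by (simp add: norm_abs_lsq[OF L] L2_real add.commute[of y] nn_integral_eq_integral)
  qed
  have "C \<ge> 0" using C[of 0] r by simp
  have "(\<integral>\<^sup>+x. ennreal ((ball_avg r u x - u0 x)\<^sup>2) \<partial>lebesgue)
      \<le> (\<integral>\<^sup>+x. (\<integral>\<^sup>+y. ennreal ((1 / m) * Q y * (u0 (y + x) - u0 x)\<^sup>2) \<partial>lebesgue) \<partial>lebesgue)"
    by (intro nn_integral_mono pointwise)
  also have "\<dots> = (\<integral>\<^sup>+x. (\<integral>\<^sup>+y. ennreal ((1 / m) * Q y * (u0 (y + x) - u0 x)\<^sup>2) \<partial>lborel) \<partial>lborel)"
    by (simp add: nn_integral_completion)
  also have "\<dots> = (\<integral>\<^sup>+y. (\<integral>\<^sup>+x. ennreal ((1 / m) * Q y * (u0 (y + x) - u0 x)\<^sup>2) \<partial>lborel) \<partial>lborel)"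
    by (rule lborel_pair.Fubini') measurable
  also have "\<dots> = (\<integral>\<^sup>+y. (\<integral>\<^sup>+x. ennreal ((1 / m) * Q y * (u0 (y + x) - u0 x)\<^sup>2) \<partial>lebesgue) \<partial>lebesgue)"
    by (simp add: nn_integral_completion)
  also have "\<dots> \<le> (\<integral>\<^sup>+y. ennreal ((1 / m * C\<^sup>2) * Q y) \<partial>lebesgue)"
  proof (rule nn_integral_mono)
    fix y :: "real^'n"
    have "(\<integral>\<^sup>+x. ennreal ((1 / m) * Q y * (u0 (y + x) - u0 x)\<^sup>2) \<partial>lebesgue)
      = ennreal ((1 / m) * Q y) * ennreal ((norm (tr y u - u))\<^sup>2)"
    proof -
      have "(\<lambda>x. u0 (y + x)) \<in> borel_measurable lebesgue"
        using measurable_compose[OF measurable_plus_lebesgue u0l, of y] by (simp add: add.commute)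
      then have [measurable]: "(\<lambda>x. (u0 (y + x) - u0 x)\<^sup>2) \<in> borel_measurable lebesgue"
        using u0l by measurable
      show ?thesis using m unfolding trans[symmetric]
        by (subst nn_integral_cmult[symmetric]) (auto simp: ennreal_mult[symmetric] Q_def)
    qed
    also have "\<dots> \<le> ennreal ((1 / m) * Q y) * ennreal (C\<^sup>2)" if "norm y \<le> r"
      by (intro mult_left_mono ennreal_leI power_mono C that) auto
    ultimately show "(\<integral>\<^sup>+x. ennreal ((1 / m) * Q y * (u0 (y + x) - u0 x)\<^sup>2) \<partial>lebesgue) \<le> ennreal ((1 / m * C\<^sup>2) * Q y)"
      using m by (cases "norm y \<le> r") (auto simp: Q_def ennreal_mult[symmetric])
  qed
  also have "\<dots> = ennreal (C\<^sup>2)"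
    using m intQ by (subst nn_integral_eq_integral) (auto simp: Q_def)
  finally have le: "(\<integral>\<^sup>+x. ennreal ((ball_avg r u x - u0 x)\<^sup>2) \<partial>lebesgue) \<le> ennreal (C\<^sup>2)" .
  have [measurable]: "ball_avg r u \<in> borel_measurable lebesgue"
    by (rule continuous_borel_lebesgue[OF ball_avg_continuous])
  have int: "integrable lebesgue (\<lambda>x. (ball_avg r u x - u0 x)\<^sup>2)"
    using le u0l by (intro integrableI_bounded) (auto intro: le_less_trans)
  then have L: "L2 (\<lambda>x. ball_avg r u x - u0 x)" using u0l by (auto simp: L2_real)
  from L2_add[OF this Lu0] show LT: "L2 (ball_avg r u)" by simp
  have "ennreal ((norm (abs_lsq (ball_avg r u) - u))\<^sup>2) \<le> ennreal (C\<^sup>2)"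
  proof -
    have eq: "abs_lsq (ball_avg r u) - u = abs_lsq (\<lambda>x. ball_avg r u x - u0 x)"
      using abs_lsq_diff[OF LT Lu0] u by simp
    show ?thesis unfolding eq norm_abs_lsq[OF L] using le int by (simp add: nn_integral_eq_integral)
  qed
  then show "norm (abs_lsq (ball_avg r u) - u) \<le> C"
    using \<open>C \<ge> 0\<close> by (auto intro: power2_le_imp_le)
qed

text \<open>The crude value \<open>C = 2 * norm v\<close> is admissible in
  \<open>ball_avg_close\<close> for every radius; it already gives square integrability and the
  operator bound 3.\<close>

lemma ball_avg_operator:
  fixes u :: "'n::finite lsq"
  assumes r: "r > 0"
  shows "L2 (ball_avg r u)" "bounded_linear (\<lambda>u :: 'n lsq. abs_lsq (ball_avg r u))"
    "abs_lsq (ball_avg r (tr a u)) = tr a (abs_lsq (ball_avg r u))"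
proof -
  have bound: "norm (tr y v - v) \<le> 2 * norm v" for y :: "real^'n" and v
    using norm_triangle_ineq4[of "tr y v" v] by simp
  have L: "L2 (ball_avg r v)" and close: "norm (abs_lsq (ball_avg r v) - v) \<le> 2 * norm v" for v :: "'n lsq"
    using ball_avg_close[OF r bound] by blast+
  show "L2 (ball_avg r u)" by (rule L)
  show "bounded_linear (\<lambda>u :: 'n lsq. abs_lsq (ball_avg r u))"
  proof (rule bounded_linear_intro[of _ 3])
    show "abs_lsq (ball_avg r (u + v)) = abs_lsq (ball_avg r u) + abs_lsq (ball_avg r v)" for u v :: "'n lsq"
      unfolding abs_lsq_add[OF L L, symmetric]
      by (rule arg_cong[of _ _ abs_lsq]) (simp add: ball_avg_def tr_add inner_add_right fun_eq_iff)
    show "abs_lsq (ball_avg r (c *\<^sub>R u)) = c *\<^sub>R abs_lsq (ball_avg r u)" for c and u :: "'n lsq"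
      unfolding abs_lsq_scale[OF L, symmetric]
      by (rule arg_cong[of _ _ abs_lsq]) (simp add: ball_avg_def tr_scaleR fun_eq_iff)
    show "norm (abs_lsq (ball_avg r v)) \<le> norm v * 3" for v :: "'n lsq"
      using close[of v] norm_triangle_ineq[of "abs_lsq (ball_avg r v) - v" v] by simp
  qed
  show "abs_lsq (ball_avg r (tr a u)) = tr a (abs_lsq (ball_avg r u))"
    unfolding tr_abs[OF L] by (rule arg_cong[of _ _ abs_lsq]) (simp add: ball_avg_def tr_tr fun_eq_iff)
qed

text \<open>Ball averages with radius \<open>1 / (n + 1)\<close>. Boundedness puts
  \<open>T n u\<close> into the domain of the nonlinear functionals; commuting with weak derivatives
  makes the derivatives converge as well.\<close>

theorem bounded_approximation:
  obtains T :: "nat \<Rightarrow> 'n::finite lsq \<Rightarrow> 'n lsq" where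
    "\<And>n u. \<exists>k. AE x in lebesgue. \<bar>rep_lsq (T n u) x\<bar> \<le> k"
    "\<And>u. (\<lambda>n. T n u) \<longlonglongrightarrow> u"
    "\<And>n i u w. wd i u w \<Longrightarrow> wd i (T n u) (T n w)"
proof
  let ?r = "\<lambda>n. inverse (real (Suc n))"
  let ?T = "\<lambda>n u. abs_lsq (ball_avg (?r n) u) :: 'n lsq"
  have r: "?r n > 0" for n by simp
  show "\<exists>k. AE x in lebesgue. \<bar>rep_lsq (?T n u) x\<bar> \<le> k" for n u
    using rep_abs_AE[OF ball_avg_operator(1)[OF r, of n u]] ball_avg_bounded[of "?r n" u]
    by (intro exI) (auto elim!: eventually_mono)
  show "wd i (?T n u) (?T n w)" if "wd i u w" for n i u w
    by (rule wd_commuting[OF ball_avg_operator(2)[OF r] ball_avg_operator(3)[OF r] that])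
  show "(\<lambda>n. ?T n u) \<longlonglongrightarrow> u" for u
  proof (rule LIMSEQ_I)
    fix e :: real assume e: "e > 0"
    then obtain d where d: "d > 0" "\<And>y. y \<noteq> 0 \<Longrightarrow> norm y < d \<Longrightarrow> norm (tr y u - u) < e / 2"
      using LIM_D[OF tr_tendsto, of "e / 2" u] by auto
    obtain N where N: "?r N < d" using reals_Archimedean[OF d(1)] by blast
    have "norm (?T n u - u) < e" if "n \<ge> N" for n
    proof -
      have "?r n \<le> ?r N" using that by (simp add: field_simps)
      have "norm (?T n u - u) \<le> e / 2"
      proof (rule ball_avg_close(2)[OF r])
        fix y :: "real^'n" assume "norm y \<le> ?r n"
        then have "norm y < d" using N \<open>?r n \<le> ?r N\<close> by linarith
        then show "norm (tr y u - u) \<le> e / 2"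
          using d(2)[of y] e by (cases "y = 0") (auto intro!: less_imp_le)
      qed
      then show ?thesis using e by simp
    qed
    then show "\<exists>no. \<forall>n\<ge>no. norm (?T n u - u) < e" by blast
  qed
qed

subsection \<open>The quadratic form and its negative eigenvalue\<close>

definition h1 :: "'n::finite lsq \<Rightarrow> bool" where
  "h1 u \<longleftrightarrow> (\<forall>i. \<exists>w. wd i u w)"

definition wpd :: "'n \<Rightarrow> 'n::finite lsq \<Rightarrow> 'n lsq" where
  "wpd i u = (THE w. wd i u w)"

lemma wpd_eq: "wd i u w \<Longrightarrow> wpd i u = w"
  unfolding wpd_def using wd_unique by blast

lemma wd_wpd: "h1 u \<Longrightarrow> wd i u (wpd i u)"
  unfolding h1_def using wpd_eq by metis

lemma h1I: "(\<And>i. wd i u (w i)) \<Longrightarrow> h1 u"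
  unfolding h1_def by blast

lemma h1_add: "h1 u \<Longrightarrow> h1 v \<Longrightarrow> h1 (u + v)"
  by (rule h1I) (rule wd_add[OF wd_wpd wd_wpd])

lemma h1_diff: "h1 u \<Longrightarrow> h1 v \<Longrightarrow> h1 (u - v)"
  by (rule h1I) (rule wd_diff[OF wd_wpd wd_wpd])

lemma h1_scaleR: "h1 u \<Longrightarrow> h1 (c *\<^sub>R u)"
  by (rule h1I) (rule wd_scaleR[OF wd_wpd])

lemma h1_dq: "h1 u \<Longrightarrow> h1 (dq i h u)"
  by (rule h1I) (rule wd_dq[OF wd_wpd])

lemma h1_tr: "h1 u \<Longrightarrow> h1 (tr a u)"
  by (rule h1I) (rule wd_tr[OF wd_wpd])

lemma wpd_tr: "h1 u \<Longrightarrow> wpd i (tr a u) = tr a (wpd i u)"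
  by (rule wpd_eq) (rule wd_tr[OF wd_wpd])

lemma wpd_add: "h1 u \<Longrightarrow> h1 v \<Longrightarrow> wpd i (u + v) = wpd i u + wpd i v"
  and wpd_diff: "h1 u \<Longrightarrow> h1 v \<Longrightarrow> wpd i (u - v) = wpd i u - wpd i v"
  and wpd_scaleR: "h1 u \<Longrightarrow> wpd i (c *\<^sub>R u) = c *\<^sub>R wpd i u"
  and wpd_dq: "h1 u \<Longrightarrow> wpd i (dq j h u) = dq j h (wpd i u)"
  by (simp_all add: wpd_eq wd_add wd_diff wd_scaleR wd_dq wd_wpd)

lemma h1_test: "test_fun \<phi> \<Longrightarrow> h1 (abs_lsq \<phi>)"
  by (rule h1I, unfold wd_iff_dq, rule dq_pd)

definition dirichlet :: "'n::finite lsq \<Rightarrow> 'n lsq \<Rightarrow> real" where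
  "dirichlet u v = (\<Sum>i\<in>UNIV. inner (wpd i u) (wpd i v))"

lemma dirichlet_commute: "dirichlet u v = dirichlet v u"
  by (simp add: dirichlet_def inner_commute)

lemma dirichlet_add_left: "h1 u \<Longrightarrow> h1 v \<Longrightarrow> dirichlet (u + v) w = dirichlet u w + dirichlet v w"
  and dirichlet_diff_left: "h1 u \<Longrightarrow> h1 v \<Longrightarrow> dirichlet (u - v) w = dirichlet u w - dirichlet v w"
  and dirichlet_scaleR_left: "h1 u \<Longrightarrow> dirichlet (c *\<^sub>R u) w = c * dirichlet u w"
  by (simp_all add: dirichlet_def wpd_add wpd_diff wpd_scaleR inner_add_left inner_diff_left
      sum.distrib sum_subtractf sum_distrib_left)

lemma dirichlet_add_right: "h1 u \<Longrightarrow> h1 v \<Longrightarrow> dirichlet w (u + v) = dirichlet w u + dirichlet w v"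
  and dirichlet_scaleR_right: "h1 u \<Longrightarrow> dirichlet w (c *\<^sub>R u) = c * dirichlet w u"
  by (simp_all add: dirichlet_commute[of w] dirichlet_add_left dirichlet_scaleR_left)

lemma norm_wpd_le_dirichlet: "(norm (wpd i u))\<^sup>2 \<le> dirichlet u u"
  unfolding dirichlet_def power2_norm_eq_inner
  by (rule member_le_sum) auto

lemma dirichlet_nonneg: "0 \<le> dirichlet u u"
  by (simp add: dirichlet_def sum_nonneg)

lemma dirichlet_by_parts:
  assumes "\<And>i. h1 (wpd i u)" "h1 u" "h1 v"
  shows "dirichlet u v = - inner (\<Sum>i\<in>UNIV. wpd i (wpd i u)) v"
proof -
  have "inner (wpd i u) (wpd i v) = - inner (wpd i (wpd i u)) v" for i
    using wd_integration_by_parts[OF wd_wpd[OF assms(1)[of i]] wd_wpd[OF assms(3), of i]] by simp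
  then show ?thesis by (simp add: dirichlet_def inner_sum_left sum_negf)
qed

lemma Cauchy_if_norm_sq_le:
  fixes X :: "nat \<Rightarrow> 'a::real_normed_vector"
  assumes "\<And>N m n. m \<ge> N \<Longrightarrow> n \<ge> N \<Longrightarrow> (norm (X m - X n))\<^sup>2 \<le> e N" "e \<longlonglongrightarrow> (0::real)"
  shows "Cauchy X"
  unfolding Cauchy_iff
proof (intro allI impI)
  fix r :: real assume r: "r > 0"
  then have "\<forall>\<^sub>F N in sequentially. e N < r\<^sup>2" by (intro order_tendstoD[OF assms(2)]) simp
  then obtain N where "e N < r\<^sup>2" by (auto simp: eventually_sequentially)
  then have "norm (X m - X n) < r" if "m \<ge> N" "n \<ge> N" for m n
    using assms(1)[OF that] r by (intro power2_less_imp_less[of _ r]) auto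
  then show "\<exists>M. \<forall>m\<ge>M. \<forall>n\<ge>M. norm (X m - X n) < r" by blast
qed

lemma quadratic_nonneg_imp_linear_zero:
  fixes a b :: real
  assumes "a \<ge> 0" "\<And>t. 0 \<le> a * t\<^sup>2 + 2 * b * t"
  shows "b = 0"
proof (rule ccontr)
  assume "b \<noteq> 0"
  \<comment> \<open>The minimum is at \<open>- b / a\<close>; adding 1 to the denominator also
    covers \<open>a = 0\<close>.\<close>
  have "a * (- b / (a + 1))\<^sup>2 + 2 * b * (- b / (a + 1)) = - (b\<^sup>2 * (a + 2)) / (a + 1)\<^sup>2"
    using assms(1) by (simp add: power2_eq_square divide_simps) (simp add: algebra_simps)
  also have "\<dots> < 0" using \<open>b \<noteq> 0\<close> assms(1) by (simp add: divide_neg_pos)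
  finally show False using assms(2)[of "- b / (a + 1)"] by simp
qed

text \<open>Nirenberg's argument: test the equation with the second difference quotient of \<open>u\<close> itself.\<close>

lemma dq_wpd_le:
  assumes h: "h1 u" and weak: "\<And>v. h1 v \<Longrightarrow> dirichlet u v = inner f v"
  shows "norm (dq i t (wpd j u)) \<le> norm f"
proof -
  let ?X = "\<Sum>j\<in>UNIV. (norm (dq i t (wpd j u)))\<^sup>2"
  let ?v = "dq i (- t) (dq i t u)"
  have "?X = - dirichlet u ?v"
    by (simp add: dirichlet_def h h1_dq wpd_dq power2_norm_eq_inner dq_inner[of i t] sum_negf)
  also have "\<dots> = - inner f ?v" by (simp add: weak h h1_dq)
  also have "\<dots> \<le> norm f * norm ?v" using Cauchy_Schwarz_ineq2[of f ?v] by simp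
  \<comment> \<open>The outer quotient is bounded by the derivative of the inner one, which is a
    quotient of \<open>wpd i u\<close> and so a summand of \<open>?X\<close>; the estimate closes on
    itself.\<close>
  also have "\<dots> \<le> norm f * norm (dq i t (wpd i u))"
    by (intro mult_left_mono norm_dq_le wd_dq wd_wpd h) simp
  also have "\<dots> \<le> norm f * sqrt ?X"
    by (intro mult_left_mono real_le_rsqrt member_le_sum[of i UNIV "\<lambda>j. (norm (dq i t (wpd j u)))\<^sup>2"]) auto
  finally have *: "?X \<le> norm f * sqrt ?X" .
  have X0: "0 \<le> ?X" by (intro sum_nonneg) simp
  have le: "sqrt ?X \<le> norm f"
  proof (cases "sqrt ?X > 0")
    case True
    have "sqrt ?X * sqrt ?X \<le> norm f * sqrt ?X" using * X0 by simp
    then show ?thesis using True by (rule mult_right_le_imp_le)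
  next
    case False
    then show ?thesis using norm_ge_zero[of f] by linarith
  qed
  have "norm (dq i t (wpd j u)) \<le> sqrt ?X"
    by (intro real_le_rsqrt member_le_sum[of j UNIV "\<lambda>j. (norm (dq i t (wpd j u)))\<^sup>2"]) auto
  with le show ?thesis by simp
qed

text \<open>The Dirichlet form is translation invariant, so translating the solution translates the
  right side, and averaging preserves this.\<close>

lemma dirichlet_steklov:
  assumes h: "h1 u" and weak: "\<And>v. h1 v \<Longrightarrow> dirichlet u v = inner f v" and "t > 0" "h1 v"
  shows "dirichlet (steklov i t u) v = inner (steklov i t f) v"
proof -
  have tr_weak: "(\<Sum>j\<in>UNIV. inner (tr a (wpd j u)) (wpd j v)) = inner (tr a f) v" for a
  proof -
    show ?thesis
      using weak[OF h1_tr[OF \<open>h1 v\<close>], of "- a"] by (simp add: dirichlet_def wpd_tr \<open>h1 v\<close> inner_tr_left)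
  qed
  have st: "inner (steklov i t x) y = (1 / t) * integral {0..t} (\<lambda>s. inner (tr (s *\<^sub>R axis i 1) x) y)" for x y
    using integral_linear[OF tr_axis_integrable[of i x 0 t] bounded_linear_inner_left[of y]]
    by (simp add: steklov_def o_def)
  have int: "(\<lambda>s. inner (tr (s *\<^sub>R axis i 1) x) y) integrable_on {0..t}" for x y
    using integrable_linear[OF tr_axis_integrable[of i x 0 t] bounded_linear_inner_left[of y]]
    by (simp add: o_def)
  have "dirichlet (steklov i t u) v = (\<Sum>j\<in>UNIV. inner (steklov i t (wpd j u)) (wpd j v))"
    unfolding dirichlet_def using wpd_eq[OF wd_steklov_commute[OF \<open>t > 0\<close> wd_wpd[OF h]]] by simp
  also have "\<dots> = (1 / t) * integral {0..t} (\<lambda>s. \<Sum>j\<in>UNIV. inner (tr (s *\<^sub>R axis i 1) (wpd j u)) (wpd j v))"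
    by (subst Henstock_Kurzweil_Integration.integral_sum) (simp_all add: int st sum_distrib_left)
  also have "\<dots> = inner (steklov i t f) v" by (simp add: tr_weak st)
  finally show ?thesis .
qed

text \<open>The bound on difference quotients is applied to the difference of two Steklov averages
  of \<open>u\<close>. Their right sides are averages of \<open>f\<close>, hence Cauchy, and so the
  quotients of \<open>wpd j u\<close> converge in norm; closedness of the generator identifies the
  limit.\<close>

theorem weak_solution_regular:
  fixes u f :: "'n::finite lsq"
  assumes h: "h1 u" and weak: "\<And>v. h1 v \<Longrightarrow> dirichlet u v = inner f v"
  shows "h1 (wpd j u)" "- (\<Sum>i\<in>UNIV. wpd i (wpd i u)) = f"
proof -
  have reg: "h1 (wpd j u)" for j
    unfolding h1_def
  proof
    fix i :: 'n
    let ?t = "\<lambda>n. inverse (real (Suc n))"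
    have t: "?t n > 0" for n by simp
    have "filterlim ?t (at_right 0) sequentially"
      by (rule tendsto_imp_filterlim_at_right[OF LIMSEQ_inverse_real_of_nat]) simp
    then have lim: "(\<lambda>n. steklov i (?t n) x) \<longlonglongrightarrow> x" for x
      by (rule filterlim_compose[OF steklov_tendsto])
    have diff: "norm (dq i (?t m) (wpd j u) - dq i (?t n) (wpd j u)) \<le> norm (steklov i (?t m) f - steklov i (?t n) f)" for m n
    proof -
      let ?z = "steklov i (?t m) u - steklov i (?t n) u"
      have h': "h1 (steklov i (?t m) u)" for m
        using wd_steklov_commute[OF t wd_wpd[OF h]] by (rule h1I)
      have w: "wpd j (steklov i (?t m) u) = steklov i (?t m) (wpd j u)" for m
        using wpd_eq[OF wd_steklov_commute[OF t wd_wpd[OF h]]] .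
      have z: "h1 ?z" by (intro h1_diff h')
      have "dirichlet ?z v = inner (steklov i (?t m) f - steklov i (?t n) f) v" if "h1 v" for v
        using that by (simp add: dirichlet_diff_left h' dirichlet_steklov[OF h weak t] inner_diff_left del: of_nat_Suc)
      from dq_wpd_le[OF z this]
      have b: "norm (dq i s (wpd j ?z)) \<le> norm (steklov i (?t m) f - steklov i (?t n) f)" for s .
      \<comment> \<open>For averages the derivative in direction \<open>i\<close> exists and is a
        quotient of \<open>wpd j u\<close>, so letting \<open>s\<close> tend to 0 in
        \<open>b\<close> bounds the difference of two such quotients.\<close>
      have "wd i (wpd j ?z) (dq i (?t m) (wpd j u) - dq i (?t n) (wpd j u))"
        unfolding wpd_diff[OF h' h'] w by (intro wd_diff wd_steklov t)
      then have "((\<lambda>s. dq i s (wpd j ?z)) \<longlongrightarrow> dq i (?t m) (wpd j u) - dq i (?t n) (wpd j u)) (at 0)"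
        by (simp add: wd_iff_dq)
      from tendsto_norm[OF this] show ?thesis
        by (rule tendsto_upperbound) (use b in auto)
    qed
    have "Cauchy (\<lambda>n. steklov i (?t n) f)" using lim by (rule LIMSEQ_imp_Cauchy)
    then have "Cauchy (\<lambda>n. dq i (?t n) (wpd j u))"
      unfolding Cauchy_iff using diff by (meson le_less_trans)
    then obtain w where "(\<lambda>n. dq i (?t n) (wpd j u)) \<longlonglongrightarrow> w"
      using Cauchy_convergent convergentD by blast
    from wd_closed[OF wd_steklov[OF t] lim this trivial_limit_sequentially]
    show "\<exists>w. wd i (wpd j u) w" by blast
  qed
  show "h1 (wpd j u)" by (rule reg)
  let ?L = "- (\<Sum>i\<in>UNIV. wpd i (wpd i u))"
  have "norm (?L - f) \<le> 0"
  proof (rule norm_le_if_inner_test_le)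
    fix \<phi> :: "real^'n \<Rightarrow> real" assume "test_fun \<phi>"
    then have "h1 (abs_lsq \<phi>)" by (rule h1_test)
    then have "inner (?L - f) (abs_lsq \<phi>) = 0"
      using dirichlet_by_parts[OF reg h, of "abs_lsq \<phi>"] weak[of "abs_lsq \<phi>"] by (simp add: inner_diff_left)
    then show "\<bar>inner (?L - f) (abs_lsq \<phi>)\<bar> \<le> 0 * norm (abs_lsq \<phi>)" by simp
  qed simp
  then show "?L = f" by simp
qed

text \<open>\<open>V\<close> stands for multiplication by the bounded potential and \<open>p\<close>
  for the class of \<phi>; the hyperplane \<open>B p u = 0\<close> is the tangent space of the
  constraint.\<close>

locale schroedinger_form =
  fixes V :: "'n::finite lsq \<Rightarrow> 'n lsq" and p :: "'n lsq"
  assumes bounded_linear_V: "bounded_linear V"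
    and V_symmetric: "inner (V u) v = inner u (V v)"
    and h1_p: "h1 p"
begin

definition B :: "'n lsq \<Rightarrow> 'n lsq \<Rightarrow> real" where
  "B u v = dirichlet u v + inner (V u) v"

lemmas V_linear = bounded_linear.linear[OF bounded_linear_V]

lemma B_commute: "B u v = B v u"
  unfolding B_def dirichlet_commute[of u] V_symmetric inner_commute[of u] ..

lemma B_left: "h1 u \<Longrightarrow> h1 v \<Longrightarrow> B (u + v) w = B u w + B v w"
  "h1 u \<Longrightarrow> h1 v \<Longrightarrow> B (u - v) w = B u w - B v w"
  "h1 u \<Longrightarrow> B (c *\<^sub>R u) w = c * B u w"
  by (simp_all add: B_def dirichlet_add_left dirichlet_diff_left dirichlet_scaleR_left
      linear_add[OF V_linear] linear_diff[OF V_linear] linear_scale[OF V_linear]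
      inner_add_left inner_diff_left algebra_simps)

lemma B_right: "h1 u \<Longrightarrow> h1 v \<Longrightarrow> B w (u + v) = B w u + B w v"
  "h1 u \<Longrightarrow> h1 v \<Longrightarrow> B w (u - v) = B w u - B w v"
  "h1 u \<Longrightarrow> B w (c *\<^sub>R u) = c * B w u"
  by (simp_all add: B_commute[of w] B_left)

lemma B_tendsto:
  assumes "\<And>n. h1 (u n)" "h1 a" "(u \<longlongrightarrow> a) F" "\<And>i. ((\<lambda>n. wpd i (u n)) \<longlongrightarrow> wpd i a) F"
    "\<And>n. h1 (v n)" "h1 b" "(v \<longlongrightarrow> b) F" "\<And>i. ((\<lambda>n. wpd i (v n)) \<longlongrightarrow> wpd i b) F"
  shows "((\<lambda>n. B (u n) (v n)) \<longlongrightarrow> B a b) F"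
  unfolding B_def dirichlet_def
  by (intro tendsto_intros assms bounded_linear.tendsto[OF bounded_linear_V])

text \<open>The approximations \<open>T n u\<close> leave the hyperplane \<open>B p u = 0\<close>; subtracting vanishing multiples of
  \<open>p\<close> restores the constraint.\<close>

lemma B_nonneg_extend:
  assumes Bp: "B p p < 0"
    and pos: "\<And>u. P u \<Longrightarrow> h1 u \<Longrightarrow> B p u = 0 \<Longrightarrow> B u u \<ge> 0"
    and P: "\<And>n. P (T n u)" "\<And>u c. P u \<Longrightarrow> P (u - c *\<^sub>R p)"
    and T: "\<And>u. (\<lambda>n. T n u) \<longlonglongrightarrow> u" "\<And>n i u w. wd i u w \<Longrightarrow> wd i (T n u) (T n w)"
    and u: "h1 u" "B p u = 0"
  shows "B u u \<ge> 0"
proof -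
  define c where "c n = B p (T n u) / B p p" for n
  define v where "v n = T n u - c n *\<^sub>R p" for n
  have hT: "h1 (T n u)" for n using T(2)[OF wd_wpd[OF u(1)]] by (rule h1I)
  have wT: "wpd i (T n u) = T n (wpd i u)" for i n using T(2)[OF wd_wpd[OF u(1)]] by (rule wpd_eq)
  have hv: "h1 (v n)" for n unfolding v_def by (intro h1_diff hT h1_scaleR h1_p)
  have "(\<lambda>n. B p (T n u)) \<longlonglongrightarrow> B p u"
    by (intro B_tendsto hT u h1_p tendsto_const T(1)) (simp add: wT T(1))
  then have "(\<lambda>n. B p (T n u) / B p p) \<longlonglongrightarrow> B p u / B p p"
    using Bp by (intro tendsto_intros) auto
  then have c: "c \<longlonglongrightarrow> 0" by (simp add: c_def[abs_def] u(2))
  have v: "v \<longlonglongrightarrow> u"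
    using tendsto_diff[OF T(1)[of u] tendsto_scaleR[OF c tendsto_const[of p]]] by (simp add: v_def[abs_def])
  have wv: "(\<lambda>n. wpd i (v n)) \<longlonglongrightarrow> wpd i u" for i
    using tendsto_diff[OF T(1)[of "wpd i u"] tendsto_scaleR[OF c tendsto_const[of "wpd i p"]]]
    by (simp add: v_def wpd_diff wpd_scaleR hT h1_p h1_scaleR wT)
  have "(\<lambda>n. B (v n) (v n)) \<longlonglongrightarrow> B u u" by (intro B_tendsto hv u v wv)
  moreover have "B (v n) (v n) \<ge> 0" for n
  proof (rule pos)
    show "P (v n)" unfolding v_def by (intro P)
    show "B p (v n) = 0" using Bp by (simp add: v_def B_right hT h1_p h1_scaleR c_def)
  qed (rule hv)
  ultimately show ?thesis by (intro LIMSEQ_le_const) auto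
qed

text \<open>The combination \<open>?w\<close> lies in the hyperplane, where the form is nonnegative.
  Distinct eigenvalues make the vectors orthogonal and the form negative at \<open>?w\<close>; equal
  ones give \<open>B ?w ?w = lam * inner ?w ?w\<close>, which forces \<open>?w = 0\<close>, a linear
  dependence.\<close>

lemma negative_direction_unique:
  assumes pos: "\<And>u. h1 u \<Longrightarrow> B p u = 0 \<Longrightarrow> B u u \<ge> 0"
    and e: "h1 e" "\<And>v. h1 v \<Longrightarrow> B e v = lam * inner e v" "lam < 0" "e \<noteq> 0"
    and u: "h1 u" "\<And>v. h1 v \<Longrightarrow> B u v = mu * inner u v" "mu < 0" "u \<noteq> 0"
  shows "mu = lam" "\<exists>c. u = c *\<^sub>R e"
proof -
  let ?w = "B p u *\<^sub>R e - B p e *\<^sub>R u"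
  have hw: "h1 ?w" by (intro h1_diff h1_scaleR e u)
  have "B p ?w = 0" by (simp add: B_right h1_scaleR e(1) u(1))
  then have pw: "B ?w ?w \<ge> 0" by (rule pos[OF hw])
  have neg: "B x x < 0" if "h1 x" "\<And>v. h1 v \<Longrightarrow> B x v = l * inner x v" "l < 0" "x \<noteq> 0" for x l
    using that(2)[OF that(1)] that(3,4) by (simp add: mult_neg_pos)
  \<comment> \<open>An eigenvector in the hyperplane would violate \<open>pos\<close>, so neither
    coefficient of \<open>?w\<close> vanishes.\<close>
  have Bp: "B p e \<noteq> 0" "B p u \<noteq> 0" using pos[OF e(1)] pos[OF u(1)] neg[OF e] neg[OF u] by fastforce+
  have orth: "lam * inner e u = mu * inner e u"
    using e(2)[OF u(1)] u(2)[OF e(1)] B_commute[of e u] by (metis inner_commute)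
  show "mu = lam"
  proof (rule ccontr)
    assume "mu \<noteq> lam"
    with orth have o: "inner e u = 0" by simp
    have "B ?w ?w = (B p u)\<^sup>2 * B e e + (B p e)\<^sup>2 * B u u"
      using e(2)[OF u(1)] u(2)[OF e(1)] o
      by (simp add: B_left B_right h1_scaleR h1_diff e(1) u(1) inner_commute power2_eq_square)
    also have "\<dots> < 0"
      using neg[OF e] neg[OF u] Bp by (intro add_neg_neg mult_pos_neg) auto
    finally show False using pw by simp
  qed
  then have "B ?w ?w = lam * inner ?w ?w"
    using e(2)[OF hw] u(2)[OF hw] by (simp add: B_left h1_scaleR e(1) u(1) inner_diff_left right_diff_distrib)
  with pw have "lam * inner ?w ?w \<ge> 0" by simp
  then have "inner ?w ?w = 0"
    using e(3) inner_ge_zero[of ?w] by (simp only: zero_le_mult_iff) auto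
  then have "B p u *\<^sub>R e = B p e *\<^sub>R u" by simp
  then have "(1 / B p e) *\<^sub>R (B p e *\<^sub>R u) = (1 / B p e) *\<^sub>R (B p u *\<^sub>R e)" by simp
  then have "u = (B p u / B p e) *\<^sub>R e" using Bp by simp
  then show "\<exists>c. u = c *\<^sub>R e" by blast
qed

text \<open>Since the form is nonnegative on a hyperplane, a minimizing sequence on the unit sphere is
  automatically Cauchy: no compactness is needed.\<close>

theorem negative_eigenvalue_exists:
  assumes pos: "\<And>u. h1 u \<Longrightarrow> B p u = 0 \<Longrightarrow> B u u \<ge> 0" and Bp: "B p p < 0"
  obtains lam e where "lam < 0" "e \<noteq> 0" "h1 e" "\<And>v. h1 v \<Longrightarrow> B e v = lam * inner e v"
proof -
  obtain K where K: "K > 0" "\<And>u. norm (V u) \<le> norm u * K"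
    using bounded_linear.pos_bounded[OF bounded_linear_V] by blast
  have Vle: "\<bar>inner (V u) u\<bar> \<le> K * (norm u)\<^sup>2" for u
  proof -
    have "\<bar>inner (V u) u\<bar> \<le> norm (V u) * norm u" by (rule Cauchy_Schwarz_ineq2)
    also have "\<dots> \<le> (norm u * K) * norm u" by (intro mult_right_mono K) simp
    finally show ?thesis by (simp add: power2_eq_square ac_simps)
  qed
  define S where "S = {B u u |u. h1 u \<and> norm u = 1}"
  define lam where "lam = Inf S"
  have lower: "- K \<le> B u u" if "norm u = 1" for u
    using Vle[of u] dirichlet_nonneg[of u] that by (simp add: B_def)
  have bdd: "bdd_below S" unfolding S_def bdd_below_def using lower by blast
  have p0: "p \<noteq> 0" using Bp by (auto simp: B_def dirichlet_def wpd_eq[OF wd_zero])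
  have pS: "B p p / (norm p)\<^sup>2 \<in> S"
    unfolding S_def using p0 h1_p
    by (intro CollectI exI[of _ "(1 / norm p) *\<^sub>R p"])
       (simp add: B_left B_right h1_scaleR power2_eq_square)
  have lam: "lam < 0"
  proof -
    have "lam \<le> B p p / (norm p)\<^sup>2" unfolding lam_def by (rule cInf_lower[OF pS bdd])
    also have "\<dots> < 0" using Bp p0 by (simp add: divide_neg_pos)
    finally show ?thesis .
  qed
  \<comment> \<open>Shifting by the infimum gives a nonnegative form whose small values mark the
    nearly minimizing unit vectors.\<close>
  define Q where "Q u v = B u v - lam * inner u v" for u v
  have Q0: "Q u u \<ge> 0" if "h1 u" for u
  proof (cases "u = 0")
    case False
    have "B u u / (norm u)\<^sup>2 \<in> S"
      unfolding S_def using False that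
      by (intro CollectI exI[of _ "(1 / norm u) *\<^sub>R u"])
         (simp add: B_left B_right h1_scaleR power2_eq_square)
    then have "lam \<le> B u u / (norm u)\<^sup>2" unfolding lam_def by (rule cInf_lower[OF _ bdd])
    then show ?thesis using False by (simp add: Q_def pos_le_divide_eq flip: power2_norm_eq_inner)
  qed (simp add: Q_def B_def dirichlet_def wpd_eq[OF wd_zero])
  have Q_expand: "Q (a *\<^sub>R u + b *\<^sub>R v) (a *\<^sub>R u + b *\<^sub>R v) = a\<^sup>2 * Q u u + 2 * a * b * Q u v + b\<^sup>2 * Q v v"
    if "h1 u" "h1 v" for a b u v
    using that by (simp add: Q_def B_left B_right h1_add h1_scaleR B_commute[of v u] inner_add_left inner_add_right
        inner_commute[of v u] power2_eq_square algebra_simps)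
  \<comment> \<open>Nonnegativity at the combination with \<open>- b\<close> absorbs the cross term,
    as in the parallelogram law.\<close>
  have Q_le: "Q (a *\<^sub>R u + b *\<^sub>R v) (a *\<^sub>R u + b *\<^sub>R v) \<le> 2 * a\<^sup>2 * Q u u + 2 * b\<^sup>2 * Q v v"
    if "h1 u" "h1 v" for a b u v
    using Q0[of "a *\<^sub>R u + (- b) *\<^sub>R v"] that Q_expand[OF that, of a b] Q_expand[OF that, of a "- b"]
    by (simp add: h1_add h1_scaleR mult.commute del: scaleR_minus_left)
  \<comment> \<open>Nearly minimizing unit vectors on the same side of the hyperplane are close: the
    combination \<open>?w\<close> in the hyperplane has \<open>Q ?w ?w\<close> at least
    \<open>- lam * (norm ?w)\<^sup>2\<close> and at most \<open>2 * d\<close>, so it is short and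
    the vectors are nearly parallel; the common side excludes opposite directions.\<close>
  have close: "(norm (u - v))\<^sup>2 \<le> 4 * d / (- lam)"
    if u: "h1 u" "norm u = 1" "Q u u \<le> d" "B p u \<ge> 0" and v: "h1 v" "norm v = 1" "Q v v \<le> d" "B p v \<ge> 0"
      and d: "2 * d < - lam" for u v d
  proof -
    have d0: "d \<ge> 0" using Q0[OF u(1)] u(3) by simp
    define r where "r = sqrt ((B p u)\<^sup>2 + (B p v)\<^sup>2)"
    have "B p u \<noteq> 0"
    proof
      assume "B p u = 0"
      from pos[OF u(1) this] have "Q u u \<ge> - lam" using u(2) by (simp add: Q_def flip: power2_norm_eq_inner)
      then show False using u(3) d lam by simp
    qed
    then have r: "r > 0" by (simp add: r_def add_pos_nonneg)
    \<comment> \<open>These coefficients put \<open>?w\<close> into the hyperplane, and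
      \<open>r\<close> normalizes them to \<open>a\<^sup>2 + b\<^sup>2 = 1\<close>.\<close>
    define a where "a = B p v / r"
    define b where "b = B p u / r"
    have ab: "a \<ge> 0" "b \<ge> 0" using u v r by (simp_all add: a_def b_def)
    have r2: "r\<^sup>2 = (B p u)\<^sup>2 + (B p v)\<^sup>2" by (simp add: r_def)
    have ab1: "a\<^sup>2 + b\<^sup>2 = 1"
    proof -
      have "a\<^sup>2 + b\<^sup>2 = ((B p u)\<^sup>2 + (B p v)\<^sup>2) / r\<^sup>2"
        by (simp add: a_def b_def power_divide add_divide_distrib)
      then show ?thesis using r unfolding r2[symmetric] by simp
    qed
    let ?w = "a *\<^sub>R u + (- b) *\<^sub>R v"
    have hw: "h1 ?w" by (intro h1_add h1_scaleR u v)
    have "B p ?w = a * B p u - b * B p v" using u v by (simp add: B_right h1_scaleR h1_add del: scaleR_minus_left)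
    also have "\<dots> = 0" by (simp add: a_def b_def)
    finally have "B ?w ?w \<ge> 0" by (rule pos[OF hw])
    then have "- lam * (norm ?w)\<^sup>2 \<le> Q ?w ?w" by (simp add: Q_def power2_norm_eq_inner)
    also have "\<dots> \<le> 2 * a\<^sup>2 * Q u u + 2 * (- b)\<^sup>2 * Q v v" by (rule Q_le[OF u(1) v(1)])
    also have "\<dots> \<le> 2 * a\<^sup>2 * d + 2 * (- b)\<^sup>2 * d" by (intro add_mono mult_left_mono u v) auto
    also have "\<dots> = 2 * d * (a\<^sup>2 + b\<^sup>2)" by (simp add: algebra_simps)
    also have "\<dots> = 2 * d" by (simp add: ab1)
    finally have w: "- lam * (norm ?w)\<^sup>2 \<le> 2 * d" .
    have "(norm ?w)\<^sup>2 = a\<^sup>2 * (norm u)\<^sup>2 + b\<^sup>2 * (norm v)\<^sup>2 - 2 * a * b * inner u v"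
      unfolding power2_norm_eq_inner
      by (simp add: inner_add_left inner_add_right inner_diff_left inner_diff_right
          inner_commute[of v u] power2_eq_square algebra_simps)
    then have nw: "(norm ?w)\<^sup>2 = 1 - 2 * a * b * inner u v" using u v ab1 by simp
    have "2 * d / (- lam) < 1" using d lam by (subst pos_divide_less_eq) auto
    have le: "1 - 2 * a * b * inner u v \<le> 2 * d / (- lam)"
      using w lam unfolding nw by (simp add: field_simps)
    then have "2 * a * b * inner u v > 0" using \<open>2 * d / (- lam) < 1\<close> by linarith
    moreover have "0 \<le> 2 * a * b" using ab by simp
    ultimately have uv: "inner u v > 0" by (simp only: zero_less_mult_iff) linarith
    \<comment> \<open>As \<open>inner u v\<close> is positive, the factor \<open>2 * a * b\<close>
      can be replaced by 1; what remains bounds \<open>1 - inner u v\<close>, half the squared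
      distance.\<close>
    have "2 * a * b \<le> 1" using ab1 sum_squares_bound[of a b] by simp
    then have "2 * a * b * inner u v \<le> 1 * inner u v" using uv by (intro mult_right_mono) auto
    with le have "1 - inner u v \<le> 2 * d / (- lam)" by linarith
    moreover have "(norm (u - v))\<^sup>2 = 2 - 2 * inner u v"
      using u(2) v(2) by (simp add: power2_norm_eq_inner inner_diff_left inner_diff_right inner_commute[of v u] norm_eq_1)
    ultimately show ?thesis by (simp add: field_simps)
  qed
  \<comment> \<open>Replacing \<open>u\<close> by \<open>- u\<close> changes the sign of
    \<open>B p u\<close> but not \<open>Q u u\<close>, so the side of the hyperplane can be
    prescribed.\<close>
  have ex: "\<exists>u. h1 u \<and> norm u = 1 \<and> Q u u \<le> inverse (real (Suc n)) \<and> B p u \<ge> 0" for n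
  proof -
    have "\<exists>s\<in>S. s < lam + inverse (real (Suc n))"
      unfolding lam_def by (rule cInf_lessD) (use pS in \<open>auto simp del: of_nat_Suc\<close>)
    then obtain u where u: "h1 u" "norm u = 1" "B u u < lam + inverse (real (Suc n))"
      unfolding S_def by blast
    then have Qu: "Q u u \<le> inverse (real (Suc n))" by (simp add: Q_def flip: power2_norm_eq_inner)
    show ?thesis
    proof (cases "B p u \<ge> 0")
      case False
      have m: "- u = (- 1) *\<^sub>R u" by simp
      have "h1 (- u)" unfolding m by (rule h1_scaleR[OF u(1)])
      moreover have "Q (- u) (- u) = Q u u"
        unfolding m Q_def B_left(3)[OF u(1)] B_right(3)[OF u(1)] by simp
      moreover have "B p (- u) = - B p u"
        unfolding m B_right(3)[OF u(1)] by simp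
      ultimately show ?thesis using u(2) Qu False by (intro exI[of _ "- u"]) simp
    qed (use u Qu in blast)
  qed
  then obtain U where U: "\<And>n. h1 (U n)" "\<And>n. norm (U n) = 1" "\<And>n. Q (U n) (U n) \<le> inverse (real (Suc n))" "\<And>n. B p (U n) \<ge> 0"
    by metis
  \<comment> \<open>The sequence is started where \<open>2 * d < - lam\<close>, the range in which
    \<open>close\<close> applies.\<close>
  obtain N0 where "inverse (real (Suc N0)) < - lam / 2"
    using reals_Archimedean[of "- lam / 2"] lam by auto
  then have N0: "2 * inverse (real (Suc N0)) < - lam" by simp
  define Y where "Y n = U (n + N0)" for n
  let ?d = "\<lambda>n. inverse (real (Suc n))"
  have Yh: "h1 (Y n)" for n by (simp add: Y_def U)
  have YQ: "Q (Y n) (Y n) \<le> ?d N" if "n \<ge> N" for n N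
  proof -
    have "?d (n + N0) \<le> ?d N" using that by (simp add: field_simps)
    then show ?thesis unfolding Y_def by (rule order_trans[OF U(3)])
  qed
  have YQ0: "Q (Y n) (Y n) \<le> ?d (N + N0)" if "n \<ge> N" for n N
  proof -
    have "?d (n + N0) \<le> ?d (N + N0)" using that by (simp add: field_simps)
    then show ?thesis unfolding Y_def by (rule order_trans[OF U(3)])
  qed
  have dN: "2 * ?d (N + N0) < - lam" for N
  proof -
    have "?d (N + N0) \<le> ?d N0" by (simp add: field_simps)
    then show ?thesis using N0 by linarith
  qed
  have dist1: "(norm (Y m - Y n))\<^sup>2 \<le> 4 * ?d (N + N0) / (- lam)" if "m \<ge> N" "n \<ge> N" for m n N
    by (rule close) (use that YQ0 dN U in \<open>auto simp: Y_def simp del: of_nat_Suc\<close>)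
  \<comment> \<open>The form controls gradients: the Dirichlet part is \<open>Q\<close> minus the
    potential term plus \<open>lam\<close> times the squared norm, and the last is nonpositive. So
    the derivatives are Cauchy together with the vectors.\<close>
  have dist2: "(norm (wpd i (Y m) - wpd i (Y n)))\<^sup>2 \<le> 4 * ?d (N + N0) + K * (4 * ?d (N + N0) / (- lam))"
    if "m \<ge> N" "n \<ge> N" for m n N i
  proof -
    let ?z = "1 *\<^sub>R Y m + (- 1) *\<^sub>R Y n"
    have z: "?z = Y m - Y n" by simp
    have "(norm (wpd i (Y m) - wpd i (Y n)))\<^sup>2 \<le> dirichlet ?z ?z"
      using norm_wpd_le_dirichlet[of i "Y m - Y n"] by (simp add: z wpd_diff Yh)
    also have "\<dots> = Q ?z ?z - inner (V ?z) ?z + lam * (norm ?z)\<^sup>2"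
      by (simp only: Q_def B_def power2_norm_eq_inner)
    also have "\<dots> \<le> Q ?z ?z + K * (norm ?z)\<^sup>2 + 0"
    proof (intro add_mono)
      show "Q ?z ?z - inner (V ?z) ?z \<le> Q ?z ?z + K * (norm ?z)\<^sup>2" using Vle[of ?z] by linarith
      show "lam * (norm ?z)\<^sup>2 \<le> 0" using lam by (intro mult_nonpos_nonneg) auto
    qed
    also have "\<dots> \<le> 4 * ?d (N + N0) + K * (4 * ?d (N + N0) / (- lam))"
    proof -
      have "Q ?z ?z \<le> 2 * 1\<^sup>2 * Q (Y m) (Y m) + 2 * (- 1)\<^sup>2 * Q (Y n) (Y n)" by (rule Q_le[OF Yh Yh])
      also have "\<dots> \<le> 4 * ?d (N + N0)" using YQ0[OF that(1)] YQ0[OF that(2)] by simp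
      finally have "Q ?z ?z \<le> 4 * ?d (N + N0)" .
      moreover have "K * (norm ?z)\<^sup>2 \<le> K * (4 * ?d (N + N0) / (- lam))"
        unfolding z by (intro mult_left_mono dist1 that) (use K in simp)
      ultimately show ?thesis by simp
    qed
    finally show ?thesis .
  qed
  have d_lim: "(\<lambda>N. ?d (N + N0)) \<longlonglongrightarrow> 0"
    by (rule LIMSEQ_ignore_initial_segment[OF LIMSEQ_inverse_real_of_nat])
  have "Cauchy Y"
  proof (rule Cauchy_if_norm_sq_le[OF dist1])
    show "(\<lambda>N. 4 * ?d (N + N0) / (- lam)) \<longlonglongrightarrow> 0"
      using tendsto_mult_left[OF d_lim, of "4 / (- lam)"] by simp
  qed
  then obtain e where e: "Y \<longlonglongrightarrow> e" using Cauchy_convergent convergentD by blast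
  have "\<exists>w. (\<lambda>n. wpd i (Y n)) \<longlonglongrightarrow> w" for i
  proof -
    have "Cauchy (\<lambda>n. wpd i (Y n))"
    proof (rule Cauchy_if_norm_sq_le[OF dist2])
      show "(\<lambda>N. 4 * ?d (N + N0) + K * (4 * ?d (N + N0) / (- lam))) \<longlonglongrightarrow> 0"
        using tendsto_add[OF tendsto_mult_left[OF d_lim, of 4] tendsto_mult_left[OF d_lim, of "K * (4 / (- lam))"]]
        by (simp add: mult.assoc)
    qed
    then show ?thesis using Cauchy_convergent convergentD by blast
  qed
  then obtain w where w: "\<And>i. (\<lambda>n. wpd i (Y n)) \<longlonglongrightarrow> w i" by metis
  have wde: "wd i e (w i)" for i
    by (rule wd_closed[OF wd_wpd[OF Yh] e w trivial_limit_sequentially])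
  have he: "h1 e" using wde by (rule h1I)
  have we: "wpd i e = w i" for i using wde by (rule wpd_eq)
  have ne: "norm e = 1"
    using tendsto_unique[OF trivial_limit_sequentially tendsto_norm[OF e] tendsto_eventually[of _ 1]] U(2)
    by (simp add: Y_def)
  have "(\<lambda>n. Q (Y n) (Y n)) \<longlonglongrightarrow> Q e e"
    unfolding Q_def by (intro tendsto_intros B_tendsto Yh he e) (simp_all add: we w)
  moreover have "(\<lambda>n. Q (Y n) (Y n)) \<longlonglongrightarrow> 0"
  proof (rule tendsto_sandwich[OF _ _ tendsto_const LIMSEQ_inverse_real_of_nat])
    show "\<forall>\<^sub>F n in sequentially. 0 \<le> Q (Y n) (Y n)" using Q0[OF Yh] by simp
    show "\<forall>\<^sub>F n in sequentially. Q (Y n) (Y n) \<le> ?d n" using YQ by (intro always_eventually) blast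
  qed
  ultimately have Qe: "Q e e = 0" using LIMSEQ_unique by blast
  have "B e v = lam * inner e v" if v: "h1 v" for v
  proof -
    \<comment> \<open>\<open>e\<close> minimizes the nonnegative form \<open>Q\<close> with value 0,
      so the linear term in every direction vanishes.\<close>
    have "Q e v = 0"
    proof (rule quadratic_nonneg_imp_linear_zero[OF Q0[OF v]])
      show "0 \<le> Q v v * t\<^sup>2 + 2 * Q e v * t" for t
        using Q0[of "1 *\<^sub>R e + t *\<^sub>R v"] Q_expand[OF he v, of 1 t] he v Qe
        by (simp add: h1_add h1_scaleR algebra_simps)
    qed
    then show ?thesis by (simp add: Q_def)
  qed
  moreover have "e \<noteq> 0" using ne by auto
  ultimately show ?thesis using that lam he by blast
qed

end

subsection \<open>The nonlinearity\<close>

text \<open>\<open>q\<close> is the critical exponent, \<open>r\<close> the restriction of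
  \<open>g\<close> to the real line and \<open>R\<close> its even primitive. The growth bound on
  \<open>r'\<close> is one-sided because \<open>r'_nonneg\<close> provides the other side.\<close>

locale nonlinearity =
  fixes q K :: real and r r' R :: "real \<Rightarrow> real"
  assumes q: "q > 2"
    and r_deriv: "\<And>t. (r has_real_derivative r' t) (at t)"
    and r'_cont: "continuous_on UNIV r'"
    and r_odd: "\<And>t. r (- t) = - r t"
    and r'_nonneg: "\<And>t. 0 \<le> r' t"
    and r'_le: "\<And>t. r' t \<le> K * (1 + \<bar>t\<bar> powr (q - 2))"
    and r_super: "\<And>t. t > 0 \<Longrightarrow> r t \<le> r' t * t"
    and R_deriv: "\<And>t. (R has_real_derivative r t) (at t)"
    and R_even: "\<And>t. R (- t) = R t"
    and R_0: "R 0 = 0"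

lemma deriv_odd:
  fixes f :: "real \<Rightarrow> real"
  assumes odd: "\<And>t. f (- t) = - f t" and der: "(f has_real_derivative d) (at t)"
  shows "(f has_real_derivative d) (at (- t))"
proof -
  have "((\<lambda>x. f (- x)) has_real_derivative d * (- 1)) (at (- t))"
    by (rule DERIV_chain2[of f]) (use der in \<open>auto intro!: derivative_eq_intros\<close>)
  from DERIV_minus[OF this] show ?thesis by (simp add: odd)
qed

text \<open>At a negative real the phase factor is -1. Sign-changing real functions can therefore be
  inserted directly.\<close>

lemma gr_odd:
  assumes "g 0 = 0" "\<And>z. z \<noteq> 0 \<Longrightarrow> g z = (z / complex_of_real (cmod z)) * g (complex_of_real (cmod z))"
  shows "gr g (- t) = - gr g t"
proof -
  have pos: "gr g (- t) = - gr g t" if "t > 0" for t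
    using that assms(2)[of "complex_of_real (- t)"] by (simp add: gr_def)
  consider "t > 0" | "t = 0" | "- t > 0" by linarith
  then show ?thesis
    by cases (use pos[of t] pos[of "- t"] assms(1) in \<open>auto simp: gr_def\<close>)
qed

text \<open>Continuity of \<open>g\<close> at \<open>0\<close> is not assumed directly: the inequality
  \<open>g(t) \<le> g'(t) t\<close> of (a) bounds \<open>g\<close> from above near \<open>0\<close>, and (c) bounds it from below.\<close>

lemma gr_near_zero:
  fixes g :: "complex \<Rightarrow> complex" and q \<delta> \<epsilon> :: real
  assumes q: "q \<ge> 2" and "\<epsilon> > 0" and g0: "gr g 0 = 0"
    and der: "\<And>t. t > 0 \<Longrightarrow> (gr g has_real_derivative d t) (at t)"
    and bound: "\<And>t. 0 < t \<Longrightarrow> t < \<delta> \<Longrightarrow> \<bar>d t\<bar> \<le> \<epsilon>"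
    and super: "\<And>t. t > 0 \<Longrightarrow> gr g t \<le> d t * t"
    and Gp: "\<And>t. t \<ge> 0 \<Longrightarrow> gr g t * t / q \<le> Gp g t"
    and t: "0 < t" "t < \<delta>"
  shows "\<bar>gr g t\<bar> \<le> 2 * \<epsilon> * t"
proof -
  have lip: "\<bar>gr g s - gr g t\<bar> \<le> \<epsilon> * \<bar>s - t\<bar>" if "0 < s" "s \<le> t" for s
  proof -
    have "norm (gr g s - gr g t) \<le> \<epsilon> * norm (s - t)"
    proof (rule field_differentiable_bound[of "{s..t}" _ d])
      show "(gr g has_field_derivative d z) (at z within {s..t})" if "z \<in> {s..t}" for z
        using der[of z] that \<open>0 < s\<close> by (auto intro: has_field_derivative_at_within)
      show "norm (d z) \<le> \<epsilon>" if "z \<in> {s..t}" for z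
        using bound[of z] that \<open>0 < s\<close> t by auto
    qed (use that in auto)
    then show ?thesis by simp
  qed
  have up: "gr g t \<le> \<epsilon> * t"
  proof -
    have "d t * t \<le> \<epsilon> * t" using bound[OF t] t by (intro mult_right_mono) auto
    then show ?thesis using super[OF t(1)] by simp
  qed
  have le: "\<bar>gr g s\<bar> \<le> \<bar>gr g t\<bar> + \<epsilon> * t" if "s \<in> {0..t}" for s
  proof (cases "s = 0")
    case False
    then have "\<bar>gr g s - gr g t\<bar> \<le> \<epsilon> * \<bar>s - t\<bar>" using that by (intro lip) auto
    also have "\<dots> \<le> \<epsilon> * t" using that \<open>\<epsilon> > 0\<close> by (intro mult_left_mono) auto
    finally show ?thesis by linarith
  qed (use g0 t \<open>\<epsilon> > 0\<close> in simp)
  have int: "gr g integrable_on {0..t}"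
  proof (rule measurable_bounded_by_integrable_imp_integrable)
    have "continuous_on {0<..} (gr g)"
      using der by (intro continuous_at_imp_continuous_on) (auto intro: DERIV_isCont)
    then have "(\<lambda>x. indicator {0<..} x *\<^sub>R gr g x) \<in> borel_measurable borel"
      by (intro borel_measurable_continuous_on_indicator) auto
    then have "(\<lambda>x. indicator {0<..} x *\<^sub>R gr g x) \<in> borel_measurable (lebesgue_on {0..t})"
      by (intro measurable_restrict_space1 measurable_completion) simp
    moreover have "gr g x = indicator {0<..} x *\<^sub>R gr g x" if "x \<in> {0..t}" for x
      using that g0 by (cases "x = 0") (auto simp: indicator_def)
    ultimately show "gr g \<in> borel_measurable (lebesgue_on {0..t})"
      by (subst measurable_cong[where g = "\<lambda>x. indicator {0<..} x *\<^sub>R gr g x"]) auto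
    show "norm (gr g s) \<le> \<bar>gr g t\<bar> + \<epsilon> * t" if "s \<in> {0..t}" for s using le[OF that] by simp
  qed auto
  \<comment> \<open>The Lipschitz bound covers positive arguments only; altering the value at the
    single point 0 leaves the integral unchanged.\<close>
  let ?h = "\<lambda>s. if s = 0 then gr g t else gr g s"
  have "Gp g t = integral {0..t} ?h"
    unfolding Gp_def by (rule integral_spike[of "{0}"]) auto
  also have "\<dots> \<le> integral {0..t} (\<lambda>s. gr g t + \<epsilon> * t)"
  proof (rule integral_le)
    show "?h integrable_on {0..t}" by (rule integrable_spike[OF int, of "{0}"]) auto
    fix s assume s: "s \<in> {0..t}"
    show "?h s \<le> gr g t + \<epsilon> * t"
    proof (cases "s = 0")
      case False
      then have "\<bar>gr g s - gr g t\<bar> \<le> \<epsilon> * \<bar>s - t\<bar>" using s by (intro lip) auto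
      also have "\<dots> \<le> \<epsilon> * t" using s \<open>\<epsilon> > 0\<close> by (intro mult_left_mono) auto
      finally show ?thesis using False by simp
    qed (use t \<open>\<epsilon> > 0\<close> in simp)
  qed auto
  finally have "Gp g t \<le> integral {0..t} (\<lambda>s. gr g t + \<epsilon> * t)" .
  then have "Gp g t \<le> t * (gr g t + \<epsilon> * t)" using t by simp
  with Gp[of t] t have "gr g t * t / q \<le> (gr g t + \<epsilon> * t) * t" by (simp add: mult.commute)
  then have "(gr g t / q) * t \<le> (gr g t + \<epsilon> * t) * t" by simp
  then have "gr g t / q \<le> gr g t + \<epsilon> * t" using t(1) by (rule mult_right_le_imp_le)
  \<comment> \<open>The primitive is at least \<open>gr g t * t / q\<close> and, by the Lipschitz
    bound, at most \<open>t * (gr g t + \<epsilon> * t)\<close>. As \<open>1 - 1 / q\<close> is at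
    least 1/2, the lower bound for \<open>gr g t\<close> costs a factor 2.\<close>
  then have low: "gr g t * (1 - 1 / q) \<ge> - (\<epsilon> * t)" by (simp add: algebra_simps)
  have "gr g t \<ge> - (2 * \<epsilon> * t)"
  proof (rule ccontr)
    assume "\<not> ?thesis"
    then have "gr g t < - (2 * \<epsilon> * t)" by simp
    moreover have "1 - 1 / q \<ge> 1 / 2" using q by (simp add: field_simps)
    moreover have "\<epsilon> * t > 0" using t \<open>\<epsilon> > 0\<close> by simp
    ultimately have "gr g t * (1 - 1 / q) \<le> gr g t * (1 / 2)" by (intro mult_left_mono_neg) auto
    also have "\<dots> < - (\<epsilon> * t)" using \<open>gr g t < - (2 * \<epsilon> * t)\<close> by simp
    finally show False using low by simp
  qed
  then show ?thesis using up t \<open>\<epsilon> > 0\<close> by (auto simp: abs_le_iff intro: order_trans)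
qed

text \<open>The delicate point is 0: since \<open>p1 > 1\<close>, (b) makes the derivative small
  near 0, and with \<open>gr_near_zero\<close> the function becomes differentiable there with
  derivative 0. Oddness transports everything to the negative axis.\<close>

theorem g_assms_nonlinearity:
  assumes d3: "CARD('n::finite) \<ge> 3" and g: "g_assms TYPE('n) g"
  obtains K where "nonlinearity (crit TYPE('n)) K (gr g) (deriv (gr g)) (\<lambda>t. Gp g \<bar>t\<bar>)"
proof -
  let ?d = "real CARD('n)" and ?q = "crit TYPE('n)"
  let ?r' = "deriv (gr g)"
  have d: "?d - 2 > 0" using d3 by linarith
  have q: "?q > 2" using d by (simp add: crit_def dimR_def field_simps)
  have q1: "(?d + 2) / (?d - 2) = ?q - 1" using d by (simp add: crit_def dimR_def field_simps)
  have diff: "\<And>t. t > 0 \<Longrightarrow> gr g differentiable (at t)"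
    and diff2: "\<And>t. t > 0 \<Longrightarrow> ?r' differentiable (at t)"
    and g0: "g 0 = 0"
    and gz: "\<And>z. z \<noteq> 0 \<Longrightarrow> g z = (z / complex_of_real (cmod z)) * g (complex_of_real (cmod z))"
    and super: "\<And>t. t > 0 \<Longrightarrow> ?r' t * t - gr g t \<ge> 0"
    using g unfolding g_assms_def by blast+
  obtain p1 p2 C1 C2 C3 where P:
    "max (2 / (dimR TYPE('n) - 2)) 1 < p1"
    "max ((dimR TYPE('n) + 2) / (dimR TYPE('n) - 2) - 2) p1 < p2"
    "p2 < (dimR TYPE('n) + 2) / (dimR TYPE('n) - 2)"
    and C: "C1 > 0" "C2 > 0" "C3 > 0"
    and ls: "Limsup (at_right 0) (\<lambda>t. ereal (\<bar>?r' t\<bar> / t powr (p1 - 1))) \<le> ereal C1"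
    and li: "((\<lambda>t. ?r' t / t powr (p2 - 1)) \<longlongrightarrow> C2) at_top"
    and Gp: "\<forall>t\<ge>0. Gp g t - (1 / ?q) * gr g t * t \<ge> C3 * t powr (p2 + 1)"
    using g unfolding g_assms_def by - (elim conjE exE, rule that, assumption+)
  have p1: "p1 > 1" and p2: "p2 < ?q - 1" "p2 > 1"
    using P q1 by (auto simp: dimR_def)
  have gr0: "gr g 0 = 0" by (simp add: gr_def g0)
  note odd = gr_odd[of g, OF g0 gz]
  have der: "(gr g has_real_derivative ?r' t) (at t)" if "t > 0" for t
    using diff[OF that] by (metis DERIV_deriv_iff_real_differentiable)
  have Gp': "gr g t * t / ?q \<le> Gp g t" if "t \<ge> 0" for t
  proof -
    have "0 \<le> C3 * t powr (p2 + 1)" using C by simp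
    then show ?thesis using Gp[rule_format, OF that] by simp
  qed
  have small: "\<exists>\<delta>>0. \<forall>t. 0 < t \<and> t < \<delta> \<longrightarrow> \<bar>?r' t\<bar> \<le> \<epsilon>" if "\<epsilon> > 0" for \<epsilon>
  proof -
    have "Limsup (at_right 0) (\<lambda>t. ereal (\<bar>?r' t\<bar> / t powr (p1 - 1))) < ereal (C1 + 1)"
      using ls by (rule le_less_trans) simp
    then have e1: "\<forall>\<^sub>F t in at_right 0. \<bar>?r' t\<bar> / t powr (p1 - 1) < C1 + 1"
      by (auto dest: Limsup_lessD)
    have "((\<lambda>t. (C1 + 1) * t powr (p1 - 1)) \<longlongrightarrow> (C1 + 1) * 0 powr (p1 - 1)) (at_right 0)"
      by (intro tendsto_intros tendsto_powr2) (use p1 in \<open>auto simp: eventually_at_right_field intro!: exI[of _ 1]\<close>)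
    then have "((\<lambda>t. (C1 + 1) * t powr (p1 - 1)) \<longlongrightarrow> 0) (at_right 0)" by simp
    then have e2: "\<forall>\<^sub>F t in at_right 0. (C1 + 1) * t powr (p1 - 1) < \<epsilon>"
      using that by (rule order_tendstoD)
    have "\<forall>\<^sub>F t in at_right 0. \<bar>?r' t\<bar> \<le> \<epsilon>"
      using e1 e2 eventually_at_right_less[of 0]
    proof eventually_elim
      case (elim t)
      then have "\<bar>?r' t\<bar> < (C1 + 1) * t powr (p1 - 1)" by (simp add: divide_simps split: if_splits)
      then show ?case using elim by linarith
    qed
    then show ?thesis unfolding eventually_at_right_field by auto
  qed
  have near: "\<exists>\<delta>>0. \<forall>t. \<bar>t\<bar> < \<delta> \<longrightarrow> \<bar>gr g t\<bar> \<le> \<epsilon> * \<bar>t\<bar>" if "\<epsilon> > 0" for \<epsilon>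
  proof -
    obtain \<delta> where \<delta>: "\<delta> > 0" "\<And>t. 0 < t \<Longrightarrow> t < \<delta> \<Longrightarrow> \<bar>?r' t\<bar> \<le> \<epsilon> / 2"
      using small[of "\<epsilon> / 2"] \<open>\<epsilon> > 0\<close> by auto
    have pos: "\<bar>gr g t\<bar> \<le> \<epsilon> * t" if "0 < t" "t < \<delta>" for t
      using gr_near_zero[of ?q "\<epsilon> / 2" g ?r' \<delta> t] q \<open>\<epsilon> > 0\<close> gr0 der \<delta>(2) super Gp' that by auto
    have "\<bar>gr g t\<bar> \<le> \<epsilon> * \<bar>t\<bar>" if "\<bar>t\<bar> < \<delta>" for t
      using pos[of "\<bar>t\<bar>"] that odd[of t] gr0 by (cases "t = 0"; cases "t > 0") auto
    then show ?thesis using \<delta>(1) by blast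
  qed
  have der0: "(gr g has_real_derivative 0) (at 0)"
    unfolding DERIV_def
  proof (rule tendstoI)
    fix \<epsilon> :: real assume \<epsilon>: "\<epsilon> > 0"
    obtain \<delta> where \<delta>: "\<delta> > 0" "\<And>t. \<bar>t\<bar> < \<delta> \<Longrightarrow> \<bar>gr g t\<bar> \<le> \<epsilon> / 2 * \<bar>t\<bar>"
      using near[of "\<epsilon> / 2"] \<epsilon> by auto
    have "\<bar>gr g h\<bar> / \<bar>h\<bar> < \<epsilon>" if "h \<noteq> 0" "\<bar>h\<bar> < \<delta>" for h
    proof -
      have "\<bar>gr g h\<bar> / \<bar>h\<bar> \<le> \<epsilon> / 2" using \<delta>(2)[OF that(2)] that(1) by (simp add: divide_simps)
      also have "\<epsilon> / 2 < \<epsilon>" using \<epsilon> by simp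
      finally show ?thesis .
    qed
    then show "\<forall>\<^sub>F h in at 0. dist ((gr g (0 + h) - gr g 0) / h) 0 < \<epsilon>"
      unfolding eventually_at using \<delta>(1) gr0 by (intro exI[of _ \<delta>]) auto
  qed
  have der_all: "(gr g has_real_derivative ?r' t) (at t)" for t
  proof -
    consider "t > 0" | "t = 0" | "- t > 0" by linarith
    then show ?thesis
    proof cases
      case 3
      from deriv_odd[OF odd der[OF this]] have "(gr g has_real_derivative ?r' (- t)) (at t)" by simp
      then show ?thesis using DERIV_imp_deriv by metis
    qed (use der der0 DERIV_imp_deriv in metis)+
  qed
  have r'_even: "?r' (- t) = ?r' t" for t
    by (rule DERIV_imp_deriv) (rule deriv_odd[OF odd der_all])
  have r'_0: "?r' 0 = 0" using der0 by (rule DERIV_imp_deriv)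
  have r'_cont: "continuous_on UNIV ?r'"
  proof (rule continuous_at_imp_continuous_on, rule)
    fix t :: real
    consider "t > 0" | "t = 0" | "- t > 0" by linarith
    then show "isCont ?r' t"
    proof cases
      case 1 then show ?thesis using diff2 differentiable_imp_continuous_within by blast
    next
      case 3
      have "isCont ?r' (- t)" using 3 diff2 differentiable_imp_continuous_within by blast
      then have "isCont (\<lambda>x. ?r' (- x)) t"
        using isCont_o2[where f = uminus and g = ?r' and a = t] by (simp add: isCont_minus)
      then show ?thesis by (simp add: r'_even)
    next
      case 2
      have "(?r' \<longlongrightarrow> 0) (at 0)"
      proof (rule tendstoI)
        fix \<epsilon> :: real assume \<epsilon>: "\<epsilon> > 0"
        obtain \<delta> where \<delta>: "\<delta> > 0" "\<And>t. 0 < t \<Longrightarrow> t < \<delta> \<Longrightarrow> \<bar>?r' t\<bar> \<le> \<epsilon> / 2"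
          using small[of "\<epsilon> / 2"] \<epsilon> by auto
        have "\<bar>?r' h\<bar> < \<epsilon>" if "h \<noteq> 0" "\<bar>h\<bar> < \<delta>" for h
          using \<delta>(2)[of "\<bar>h\<bar>"] that \<epsilon> r'_even[of h] by (cases "h > 0") auto
        then show "\<forall>\<^sub>F h in at 0. dist (?r' h) 0 < \<epsilon>"
          unfolding eventually_at using \<delta>(1) by (intro exI[of _ \<delta>]) auto
      qed
      then show ?thesis using 2 by (simp add: isCont_def r'_0)
    qed
  qed
  \<comment> \<open>By (a) \<open>gr g x / x\<close> is nondecreasing for \<open>x > 0\<close>. A
    negative value \<open>m\<close> at \<open>t\<close> would bound it above by \<open>m\<close> at
    small \<open>s\<close>, where it is at least \<open>m / 2\<close>.\<close>
  have gr_nonneg: "0 \<le> gr g t" if t: "t > 0" for t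
  proof (rule ccontr)
    assume "\<not> 0 \<le> gr g t"
    define m where "m = gr g t / t"
    have \<epsilon>: "- m / 2 > 0" using t \<open>\<not> 0 \<le> gr g t\<close> by (simp add: m_def divide_neg_pos)
    obtain \<delta> where \<delta>: "\<delta> > 0" "\<And>s. \<bar>s\<bar> < \<delta> \<Longrightarrow> \<bar>gr g s\<bar> \<le> - m / 2 * \<bar>s\<bar>"
      using near[OF \<epsilon>] by blast
    define s where "s = min t (\<delta> / 2)"
    have s: "0 < s" "s \<le> t" "s < \<delta>" using t \<delta>(1) by (auto simp: s_def)
    have "gr g s / s \<le> m" unfolding m_def
    proof (rule DERIV_nonneg_imp_nondecreasing[OF s(2)])
      fix x assume x: "s \<le> x" "x \<le> t"
      have "((\<lambda>x. gr g x / x) has_real_derivative (?r' x * x - gr g x * 1) / (x * x)) (at x)"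
        by (intro DERIV_divide der_all DERIV_ident) (use s x in simp)
      moreover have "(?r' x * x - gr g x * 1) / (x * x) \<ge> 0" using super[of x] s x by simp
      ultimately show "\<exists>y. ((\<lambda>x. gr g x / x) has_real_derivative y) (at x) \<and> 0 \<le> y" by blast
    qed
    moreover have "gr g s / s \<ge> m / 2"
    proof -
      have "- gr g s \<le> - m / 2 * s" using \<delta>(2)[of s] s by auto
      then show ?thesis using s by (simp add: field_simps)
    qed
    ultimately show False using \<epsilon> by linarith
  qed
  have r'_nonneg: "0 \<le> ?r' t" for t
  proof -
    have pos: "0 \<le> ?r' t" if "t > 0" for t
    proof -
      have "0 \<le> ?r' t * t" using super[OF that] gr_nonneg[OF that] by linarith
      then show ?thesis using that by (simp add: zero_le_mult_iff)
    qed
    consider "t > 0" | "t = 0" | "- t > 0" by linarith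
    then show ?thesis by cases (use pos[of t] pos[of "- t"] r'_0 r'_even[of t] in auto)
  qed
  \<comment> \<open>Continuity bounds the derivative on a compact interval; beyond it the limit in
    (b) gives the power \<open>p2 - 1\<close>, which is below \<open>?q - 2\<close>.\<close>
  obtain K where K: "\<And>t. ?r' t \<le> K * (1 + \<bar>t\<bar> powr (?q - 2))"
  proof -
    have "\<forall>\<^sub>F t in at_top. ?r' t / t powr (p2 - 1) < C2 + 1" by (rule order_tendstoD[OF li]) simp
    then obtain T where T: "\<And>t. t \<ge> T \<Longrightarrow> ?r' t / t powr (p2 - 1) < C2 + 1"
      by (auto simp: eventually_at_top_linorder)
    let ?T = "max T 1"
    have "compact (?r' ` {0..?T})" by (intro compact_continuous_image continuous_on_subset[OF r'_cont]) auto
    then have "\<exists>M. \<forall>t\<in>{0..?T}. \<bar>?r' t\<bar> \<le> M"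
      by (auto dest!: compact_imp_bounded simp: bounded_iff)
    then obtain M where M: "\<And>t. t \<in> {0..?T} \<Longrightarrow> \<bar>?r' t\<bar> \<le> M" by blast
    have M0: "M \<ge> 0" using M[of 0] by (simp add: r'_0)
    have pos: "?r' t \<le> (M + (C2 + 1)) * (1 + t powr (?q - 2))" if "t \<ge> 0" for t
    proof (cases "t \<le> ?T")
      case True
      then have "?r' t \<le> M * 1" using M[of t] that by auto
      also have "\<dots> \<le> (M + (C2 + 1)) * (1 + t powr (?q - 2))" using M0 C by (intro mult_mono) auto
      finally show ?thesis .
    next
      case False
      then have t: "t \<ge> T" "t \<ge> 1" by auto
      then have "?r' t \<le> (C2 + 1) * t powr (p2 - 1)" using T[OF t(1)] by (simp add: divide_simps split: if_splits)
      also have "\<dots> \<le> (C2 + 1) * t powr (?q - 2)" using t p2 C by (intro mult_left_mono powr_mono) auto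
      also have "\<dots> \<le> (M + (C2 + 1)) * (1 + t powr (?q - 2))" using M0 C by (intro mult_mono) auto
      finally show ?thesis .
    qed
    show ?thesis
    proof (rule that)
      show "?r' t \<le> (M + (C2 + 1)) * (1 + \<bar>t\<bar> powr (?q - 2))" for t
        using pos[of "\<bar>t\<bar>"] r'_even[of t] by (cases "t \<ge> 0") auto
    qed
  qed
  have gr_cont: "continuous_on S (gr g)" for S
    by (intro continuous_at_imp_continuous_on) (auto intro: DERIV_isCont der_all)
  have Gp_deriv: "((\<lambda>t. Gp g \<bar>t\<bar>) has_real_derivative gr g t) (at t)" for t
  proof -
    let ?N = "\<bar>t\<bar> + 1"
    \<comment> \<open>An antiderivative of an odd function on a symmetric interval is even, so
      \<open>Gp g \<bar>x\<bar>\<close> is \<open>H x - H 0\<close> on both sides of 0.\<close>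
    obtain H where H: "\<And>x. x \<in> {- ?N..?N} \<Longrightarrow> (H has_vector_derivative gr g x) (at x within {- ?N..?N})"
      using antiderivative_continuous[OF gr_cont[of "{- ?N..?N}"]] by blast
    have Hd: "(H has_real_derivative gr g x) (at x)" if "x \<in> {- ?N<..<?N}" for x
      using H[of x] that
      by (auto simp: has_real_derivative_iff_has_vector_derivative at_within_Icc_at)
    have even: "H \<bar>x\<bar> = H x" if "x \<in> {- ?N<..<?N}" for x
    proof -
      have "H x - H (- x) = H 0 - H (- 0)"
      proof (rule DERIV_isconst3[of "- ?N" ?N x 0 "\<lambda>x. H x - H (- x)"])
        fix y assume y: "y \<in> {- ?N<..<?N}"
        have "((\<lambda>y. H (- y)) has_real_derivative gr g (- y) * (- 1)) (at y)"
          by (rule DERIV_chain2[OF Hd]) (use y in \<open>auto intro!: derivative_eq_intros\<close>)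
        from DERIV_diff[OF Hd[OF y] this] show "((\<lambda>x. H x - H (- x)) has_real_derivative 0) (at y)"
          by (simp add: odd)
      qed (use that in auto)
      then show ?thesis by (cases "x \<ge> 0") auto
    qed
    have Gp_H: "Gp g \<bar>x\<bar> = H x - H 0" if "x \<in> {- ?N<..<?N}" for x
    proof -
      have "(gr g has_integral (H \<bar>x\<bar> - H 0)) {0..\<bar>x\<bar>}"
      proof (rule fundamental_theorem_of_calculus)
        fix y assume "y \<in> {0..\<bar>x\<bar>}"
        then have "y \<in> {- ?N<..<?N}" using that by auto
        from Hd[OF this] show "(H has_vector_derivative gr g y) (at y within {0..\<bar>x\<bar>})"
          by (simp add: has_real_derivative_iff_has_vector_derivative has_vector_derivative_at_within)
      qed simp
      then show ?thesis by (simp add: Gp_def integral_unique even[OF that])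
    qed
    have t: "t \<in> {- ?N<..<?N}" by auto
    have "((\<lambda>x. H x - H 0) has_real_derivative gr g t) (at t)"
      using Hd[OF t] by (auto intro!: derivative_eq_intros)
    then show ?thesis
      by (rule has_field_derivative_transform_within_open[of _ _ _ "{- ?N<..<?N}"]) (use t Gp_H in auto)
  qed
  show ?thesis
  proof (rule that, unfold_locales)
    show "Gp g \<bar>0\<bar> = 0" by (simp add: Gp_def)
    show "gr g t \<le> ?r' t * t" if "t > 0" for t using super[OF that] by simp
  qed (use q der_all r'_cont odd r'_nonneg K Gp_deriv in auto)
qed

context nonlinearity
begin

text \<open>Critical power and perturbation merged, so that the Nehari functional and the action
  each carry a single nonlinear integrand, \<open>f t * t\<close> and \<open>F t\<close>.\<close>

definition f :: "real \<Rightarrow> real" where "f t = \<bar>t\<bar> powr (q - 2) * t + r t"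
definition f' :: "real \<Rightarrow> real" where "f' t = (q - 1) * \<bar>t\<bar> powr (q - 2) + r' t"
definition F :: "real \<Rightarrow> real" where "F t = \<bar>t\<bar> powr q / q + R t"

lemma powr_abs_mult_deriv:
  assumes a: "a > 0"
  shows "((\<lambda>t::real. \<bar>t\<bar> powr a * t) has_real_derivative (a + 1) * \<bar>t\<bar> powr a) (at t)"
proof -
  have pos: "((\<lambda>t::real. \<bar>t\<bar> powr a * t) has_real_derivative (a + 1) * \<bar>t\<bar> powr a) (at t)" if "t > 0" for t
  proof -
    have "((\<lambda>t::real. t powr (a + 1)) has_real_derivative (a + 1) * \<bar>t\<bar> powr a) (at t)"
      using has_real_derivative_powr[OF that, of "a + 1"] that by simp
    then show ?thesis
      by (rule has_field_derivative_transform_within_open[of _ _ _ "{0<..}"])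
         (use that in \<open>auto simp: powr_add\<close>)
  qed
  consider "t > 0" | "t = 0" | "- t > 0" by linarith
  then show ?thesis
  proof cases
    case 2
    have "((\<lambda>h::real. \<bar>h\<bar> powr a) \<longlongrightarrow> 0 powr a) (at 0)"
      by (intro tendsto_powr2 tendsto_const) (use a in \<open>auto intro!: tendsto_eq_intros\<close>)
    then have lim: "((\<lambda>h::real. \<bar>h\<bar> powr a) \<longlongrightarrow> 0) (at 0)" by simp
    have "((\<lambda>h::real. \<bar>h\<bar> powr a * h / h) \<longlongrightarrow> 0) (at 0)"
      by (rule Lim_transform_eventually[OF lim]) (auto simp: eventually_at_filter)
    then show ?thesis using 2 by (simp add: DERIV_def)
  next
    case 3
    from deriv_odd[OF _ pos[OF this]] show ?thesis by simp
  qed (use pos in blast)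
qed

lemma powr_abs_deriv:
  assumes a: "a > 0"
  shows "((\<lambda>t::real. \<bar>t\<bar> powr (a + 2) / (a + 2)) has_real_derivative \<bar>t\<bar> powr a * t) (at t)"
proof -
  have eq: "\<bar>t\<bar> powr (a + 2) = (\<bar>t\<bar> powr a * t) * t" for t :: real
    by (cases "t = 0") (auto simp: powr_add power2_eq_square)
  have "((\<lambda>t. (\<bar>t\<bar> powr a * t) * t / (a + 2)) has_real_derivative
     (((a + 1) * \<bar>t\<bar> powr a) * t + (\<bar>t\<bar> powr a * t)) / (a + 2)) (at t)"
    using DERIV_cdivide[OF DERIV_mult[OF powr_abs_mult_deriv[OF a] DERIV_ident]] by simp
  moreover have "(((a + 1) * \<bar>t\<bar> powr a) * t + (\<bar>t\<bar> powr a * t)) / (a + 2) = \<bar>t\<bar> powr a * t"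
    using a by (simp add: field_simps)
  ultimately show ?thesis by (simp add: eq)
qed

lemma f_deriv: "(f has_real_derivative f' t) (at t)"
  unfolding f_def f'_def using powr_abs_mult_deriv[of "q - 2" t] q
  by (auto intro!: DERIV_add r_deriv)

lemma F_deriv: "(F has_real_derivative f t) (at t)"
  unfolding f_def F_def using powr_abs_deriv[of "q - 2" t] q
  by (auto intro!: DERIV_add R_deriv)

lemma continuous_powr_abs: "a > 0 \<Longrightarrow> continuous_on UNIV (\<lambda>t::real. \<bar>t\<bar> powr a)"
  by (intro continuous_on_powr' continuous_intros) auto

lemma f'_cont: "continuous_on UNIV f'"
  unfolding f'_def using q by (intro continuous_intros r'_cont continuous_powr_abs) auto

lemma f_cont: "continuous_on UNIV f"
  by (intro continuous_at_imp_continuous_on) (auto intro: DERIV_isCont f_deriv)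

lemma F_cont: "continuous_on UNIV F"
  by (intro continuous_at_imp_continuous_on) (auto intro: DERIV_isCont F_deriv)

lemma r_cont: "continuous_on UNIV r"
  by (intro continuous_at_imp_continuous_on) (auto intro: DERIV_isCont r_deriv)

lemma R_cont: "continuous_on UNIV R"
  by (intro continuous_at_imp_continuous_on) (auto intro: DERIV_isCont R_deriv)

lemma r_0 [simp]: "r 0 = 0" using r_odd[of 0] by simp

lemma r_mono: "s \<le> t \<Longrightarrow> r s \<le> r t"
  by (rule DERIV_nonneg_imp_nondecreasing) (use r_deriv r'_nonneg in blast)+

lemma r_abs: "r \<bar>t\<bar> = \<bar>r t\<bar>" "r \<bar>t\<bar> * \<bar>t\<bar> = r t * t"
  using r_mono[of 0 t] r_mono[of t 0] r_odd[of t] by (cases "t \<ge> 0"; auto)+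

lemma K_nonneg: "K \<ge> 0"
  using r'_nonneg[of 0] r'_le[of 0] by simp

lemma powr_mono_abs: "\<bar>s\<bar> \<le> m \<Longrightarrow> a > 0 \<Longrightarrow> \<bar>s\<bar> powr a \<le> m powr a" for s m a :: real
  by (intro powr_mono2) auto

lemma r_le:
  assumes "\<bar>t\<bar> \<le> m" shows "\<bar>r t\<bar> \<le> K * (m + m powr (q - 1))"
proof -
  have m: "m \<ge> 0" using assms by linarith
  have "norm (r t - r 0) \<le> (K * (1 + m powr (q - 2))) * norm (t - 0)"
  proof (rule field_differentiable_bound[of "{- m..m}" _ r'])
    show "norm (r' z) \<le> K * (1 + m powr (q - 2))" if "z \<in> {- m..m}" for z
    proof -
      have "\<bar>z\<bar> powr (q - 2) \<le> m powr (q - 2)" using that q by (intro powr_mono_abs) auto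
      then have "K * (1 + \<bar>z\<bar> powr (q - 2)) \<le> K * (1 + m powr (q - 2))"
        using K_nonneg by (intro mult_left_mono) auto
      then show ?thesis using r'_le[of z] r'_nonneg[of z] by simp
    qed
  qed (use assms in \<open>auto simp: abs_le_iff intro: has_field_derivative_at_within[OF r_deriv]\<close>)
  then have "\<bar>r t\<bar> \<le> (K * (1 + m powr (q - 2))) * \<bar>t\<bar>" by simp
  also have "\<dots> \<le> (K * (1 + m powr (q - 2))) * m" using assms K_nonneg by (intro mult_left_mono) auto
  also have "\<dots> = K * (m + m powr (q - 1))"
  proof -
    have "m powr (q - 2) * m = m powr (q - 1)"
      using powr_add[of m "q - 2" 1] m by (cases "m = 0") auto
    then show ?thesis by (simp add: algebra_simps)
  qed
  finally show ?thesis .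
qed

lemma powr_q_split: "m \<ge> 0 \<Longrightarrow> m powr (q - 1) * m = m powr q" "m \<ge> 0 \<Longrightarrow> m powr (q - 2) * m = m powr (q - 1)"
  "m \<ge> 0 \<Longrightarrow> m powr (q - 2) * m\<^sup>2 = m powr q"
  using powr_add[of m "q - 1" 1] powr_add[of m "q - 2" 1] powr_add[of m "q - 2" 2]
  by (cases "m = 0"; auto)+

lemma r_mult_le:
  assumes "\<bar>t\<bar> \<le> m" shows "\<bar>r t * t\<bar> \<le> K * (m\<^sup>2 + m powr q)"
proof -
  have m: "m \<ge> 0" using assms by linarith
  have "\<bar>r t\<bar> * \<bar>t\<bar> \<le> (K * (m + m powr (q - 1))) * m"
    using r_le[OF assms] assms m K_nonneg by (intro mult_mono) auto
  also have "\<dots> = K * (m\<^sup>2 + m powr q)"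
    using powr_q_split(1)[OF m] by (simp add: power2_eq_square algebra_simps)
  finally show ?thesis by (simp add: abs_mult)
qed

lemma R_le:
  assumes "\<bar>t\<bar> \<le> m" shows "\<bar>R t\<bar> \<le> K * (m\<^sup>2 + m powr q)"
proof -
  have m: "m \<ge> 0" using assms by linarith
  have "norm (R t - R 0) \<le> (K * (m + m powr (q - 1))) * norm (t - 0)"
    by (rule field_differentiable_bound[of "{- m..m}" _ r])
       (use assms r_le in \<open>auto simp: abs_le_iff intro: has_field_derivative_at_within[OF R_deriv]\<close>)
  also have "\<dots> \<le> (K * (m + m powr (q - 1))) * m"
    using assms K_nonneg m by (intro mult_left_mono) auto
  also have "\<dots> = K * (m\<^sup>2 + m powr q)"
    using powr_q_split(1)[OF m] by (simp add: power2_eq_square algebra_simps)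
  finally show ?thesis by (simp add: R_0)
qed

text \<open>One constant for the bounds on both \<open>f\<close> and \<open>f'\<close>:
  \<open>K\<close> comes from \<open>r'\<close>, and \<open>q\<close> absorbs the coefficients of
  the critical power.\<close>

definition c :: real where "c = K + q"

lemma c_pos: "c > 0" using K_nonneg q by (simp add: c_def)

lemma f'_le: assumes "\<bar>t\<bar> \<le> m" shows "\<bar>f' t\<bar> \<le> c * (1 + m powr (q - 2))"
proof -
  have p: "\<bar>t\<bar> powr (q - 2) \<le> m powr (q - 2)" using assms q by (intro powr_mono_abs) auto
  have "\<bar>f' t\<bar> = (q - 1) * \<bar>t\<bar> powr (q - 2) + r' t" using q r'_nonneg[of t] by (simp add: f'_def)
  also have "\<dots> \<le> (q - 1) * m powr (q - 2) + K * (1 + m powr (q - 2))"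
  proof (intro add_mono mult_left_mono p)
    show "r' t \<le> K * (1 + m powr (q - 2))"
      using r'_le[of t] mult_left_mono[OF add_left_mono[OF p, of 1] K_nonneg] by linarith
  qed (use q in simp)
  also have "\<dots> \<le> c * (1 + m powr (q - 2))"
    using q by (simp add: c_def algebra_simps)
  finally show ?thesis .
qed

lemma f_le: assumes "\<bar>t\<bar> \<le> m" shows "\<bar>f t\<bar> \<le> c * (m + m powr (q - 1))"
proof -
  have m: "m \<ge> 0" using assms by linarith
  have "\<bar>f t\<bar> \<le> \<bar>\<bar>t\<bar> powr (q - 2) * t\<bar> + \<bar>r t\<bar>" unfolding f_def by (rule abs_triangle_ineq)
  also have "\<bar>\<bar>t\<bar> powr (q - 2) * t\<bar> = \<bar>t\<bar> powr (q - 1)" using powr_q_split(2)[of "\<bar>t\<bar>"] by (simp add: abs_mult)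
  also have "\<dots> \<le> m powr (q - 1)" using assms q by (intro powr_mono_abs) auto
  also have "m powr (q - 1) + \<bar>r t\<bar> \<le> m powr (q - 1) + K * (m + m powr (q - 1))" using r_le[OF assms] by simp
  also have "\<dots> \<le> c * (m + m powr (q - 1))"
  proof -
    have "1 * m powr (q - 1) \<le> q * (m + m powr (q - 1))" using q m by (intro mult_mono) auto
    then show ?thesis by (simp add: c_def algebra_simps)
  qed
  finally show ?thesis by simp
qed

text \<open>(a) contributes a weak inequality only; strictness is the surplus
  \<open>(q - 2) * t powr (q - 1)\<close> of the critical power. It is the origin of the negative
  direction \<phi>.\<close>

lemma f_super: "t > 0 \<Longrightarrow> f' t * t - f t > 0"
proof -
  assume t: "t > 0"
  have "f' t * t - f t = (q - 2) * (t powr (q - 2) * t) + (r' t * t - r t)"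
    using t by (simp add: f_def f'_def algebra_simps)
  moreover have "(q - 2) * (t powr (q - 2) * t) > 0" using t q by simp
  ultimately show ?thesis using r_super[OF t] by linarith
qed

lemma f_mult: "f t * t = \<bar>t\<bar> powr q + r \<bar>t\<bar> * \<bar>t\<bar>"
  using powr_q_split(3)[of "\<bar>t\<bar>"] by (simp add: f_def r_abs(2) distrib_right power2_eq_square mult.assoc)

lemma F_abs: "F t = \<bar>t\<bar> powr q / q + R \<bar>t\<bar>"
  using R_even[of t] by (cases "t \<ge> 0") (auto simp: F_def)

end

subsection \<open>Second-order expansion of the action at a ground state\<close>

definition mulop :: "(real^'n \<Rightarrow> real) \<Rightarrow> 'n::finite lsq \<Rightarrow> 'n lsq" where
  "mulop m u = abs_lsq (\<lambda>x. m x * rep_lsq u x)"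

lemma L2_mult_bounded:
  fixes m u :: "real^'n \<Rightarrow> real"
  assumes "m \<in> borel_measurable lebesgue" "\<And>x. \<bar>m x\<bar> \<le> b" "L2 u"
  shows "L2 (\<lambda>x. m x * u x)"
proof (rule L2_bound[OF L2_scale[OF assms(3), of b]])
  have "\<bar>m x\<bar> * \<bar>u x\<bar> \<le> \<bar>b\<bar> * \<bar>u x\<bar>" for x using assms(2)[of x] by (intro mult_right_mono) auto
  then show "AE x in lebesgue. \<bar>m x * u x\<bar> \<le> \<bar>b * u x\<bar>" by (simp add: abs_mult)
qed (use assms in \<open>auto simp: L2_real\<close>)

lemma mulop_abs:
  assumes m: "m \<in> borel_measurable lebesgue" "\<And>x. \<bar>m x\<bar> \<le> b" and u: "L2 u"
  shows "mulop m (abs_lsq u) = abs_lsq (\<lambda>x. m x * u x)"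
  unfolding mulop_def abs_lsq_eq_iff[OF L2_mult_bounded[OF m L2_rep] L2_mult_bounded[OF m u]]
  using rep_abs_AE[OF u] by eventually_elim simp

lemma mulop_props:
  assumes m: "m \<in> borel_measurable lebesgue" "\<And>x. \<bar>m x\<bar> \<le> b"
  shows "bounded_linear (mulop m)" "inner (mulop m u) v = inner u (mulop m v)"
proof -
  have ex: "\<exists>w. L2 w \<and> z = abs_lsq w" for z :: "'a lsq" using L2_rep[of z] abs_rep_lsq[of z] by metis
  show "bounded_linear (mulop m)"
  proof (rule bounded_linear_intro[of _ "\<bar>b\<bar>"])
    show "mulop m (u + v) = mulop m u + mulop m v" for u v
    proof -
      obtain u' v' where [simp]: "L2 u'" "u = abs_lsq u'" "L2 v'" "v = abs_lsq v'" using ex by metis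
      show ?thesis
        by (simp add: mulop_abs[OF m] L2_add L2_mult_bounded[OF m] distrib_left flip: abs_lsq_add)
    qed
    show "mulop m (c *\<^sub>R u) = c *\<^sub>R mulop m u" for c u
    proof -
      obtain u' where [simp]: "L2 u'" "u = abs_lsq u'" using ex by metis
      show ?thesis
        by (simp add: mulop_abs[OF m] L2_scale L2_mult_bounded[OF m] mult.left_commute flip: abs_lsq_scale)
    qed
    show "norm (mulop m u) \<le> norm u * \<bar>b\<bar>" for u
    proof -
      obtain u' where u': "L2 u'" "u = abs_lsq u'" using ex by metis
      have L: "L2 (\<lambda>x. m x * u' x)" by (rule L2_mult_bounded[OF m u'(1)])
      have "(norm (mulop m u))\<^sup>2 = (\<integral>x. (m x * u' x)\<^sup>2 \<partial>lebesgue)"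
        by (simp add: u' mulop_abs[OF m u'(1)] norm_abs_lsq[OF L])
      also have "\<dots> \<le> (\<integral>x. b\<^sup>2 * (u' x)\<^sup>2 \<partial>lebesgue)"
      proof (rule integral_mono)
        show "(m x * u' x)\<^sup>2 \<le> b\<^sup>2 * (u' x)\<^sup>2" for x
          unfolding power_mult_distrib using m(2)[of x]
          by (intro mult_right_mono) (auto simp: abs_le_square_iff[symmetric])
      qed (use L u'(1) in \<open>auto simp: L2_real\<close>)
      also have "\<dots> = (norm u * \<bar>b\<bar>)\<^sup>2" by (simp add: u' norm_abs_lsq[OF u'(1)] power_mult_distrib)
      finally show ?thesis by (rule power2_le_imp_le) simp
    qed
  qed
  obtain u' v' where uv: "L2 u'" "u = abs_lsq u'" "L2 v'" "v = abs_lsq v'" using ex by metis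
  show "inner (mulop m u) v = inner u (mulop m v)"
    unfolding uv mulop_abs[OF m uv(1)] mulop_abs[OF m uv(3)]
      inner_abs_lsq[OF L2_mult_bounded[OF m uv(1)] uv(3)] inner_abs_lsq[OF uv(1) L2_mult_bounded[OF m uv(3)]]
    by (simp add: ac_simps)
qed

section \<open>Differentiating the nonlinear integrals\<close>

context nonlinearity
begin

text \<open>On these functions the growth bounds make all nonlinear integrals converge. They form a
  vector space closed under absolute values, hence containing the dominating functions used
  below.\<close>

definition adm :: "(real^'n \<Rightarrow> real) \<Rightarrow> bool" where
  "adm u \<longleftrightarrow> L2 u \<and> integrable lebesgue (\<lambda>x. \<bar>u x\<bar> powr q)"

lemma adm_measurable: "adm u \<Longrightarrow> u \<in> borel_measurable lebesgue"
  by (simp add: adm_def L2_real)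

lemma powr_q_add_le: "\<bar>a + b\<bar> powr q \<le> 2 powr q * (\<bar>a\<bar> powr q + \<bar>b\<bar> powr q)" for a b :: real
proof -
  have "\<bar>a + b\<bar> powr q \<le> (2 * max \<bar>a\<bar> \<bar>b\<bar>) powr q" using q by (intro powr_mono2) auto
  also have "\<dots> = 2 powr q * (max \<bar>a\<bar> \<bar>b\<bar>) powr q" by (simp add: powr_mult)
  also have "\<dots> \<le> 2 powr q * (\<bar>a\<bar> powr q + \<bar>b\<bar> powr q)"
    by (intro mult_left_mono) (auto simp: max_def)
  finally show ?thesis .
qed

lemma integrable_powr_q_add:
  assumes [measurable]: "u \<in> borel_measurable lebesgue" "v \<in> borel_measurable lebesgue"
    and "integrable lebesgue (\<lambda>x. \<bar>u x\<bar> powr q)" "integrable lebesgue (\<lambda>x. \<bar>v x\<bar> powr q)"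
  shows "integrable lebesgue (\<lambda>x. \<bar>u x + v x\<bar> powr q)"
proof (rule Bochner_Integration.integrable_bound)
  show "integrable lebesgue (\<lambda>x. 2 powr q * (\<bar>u x\<bar> powr q + \<bar>v x\<bar> powr q))" using assms by simp
  show "AE x in lebesgue. norm (\<bar>u x + v x\<bar> powr q) \<le> norm (2 powr q * (\<bar>u x\<bar> powr q + \<bar>v x\<bar> powr q))"
    using powr_q_add_le by (auto simp: abs_mult)
qed measurable

lemma integrable_powr_q_scale:
  "integrable lebesgue (\<lambda>x. \<bar>u x\<bar> powr q) \<Longrightarrow> integrable lebesgue (\<lambda>x. \<bar>a * u x\<bar> powr q)"
  for u :: "real^'n \<Rightarrow> real"
  by (simp add: abs_mult powr_mult)

lemma adm_add: "adm u \<Longrightarrow> adm v \<Longrightarrow> adm (\<lambda>x. u x + v x)"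
  by (auto simp: adm_def L2_add L2_real intro!: integrable_powr_q_add)
     (metis L2_add L2_real)+

lemma adm_scale: "adm u \<Longrightarrow> adm (\<lambda>x. a * u x)"
  by (auto simp: adm_def L2_scale integrable_powr_q_scale)

lemma adm_abs: "adm u \<Longrightarrow> adm (\<lambda>x. \<bar>u x\<bar>)"
  by (auto simp: adm_def L2_real)

lemma adm_dominating_integrable: "adm m \<Longrightarrow> integrable lebesgue (\<lambda>x. c1 * ((m x)\<^sup>2 + \<bar>m x\<bar> powr q))"
  by (simp add: adm_def L2_real)

lemma measurable_comp_continuous:
  fixes h :: "real \<Rightarrow> real"
  assumes "continuous_on UNIV h" "u \<in> borel_measurable lebesgue"
  shows "(\<lambda>x. h (u x)) \<in> borel_measurable lebesgue"
  using measurable_compose[OF assms(2) borel_measurable_continuous_onI[OF assms(1)]] .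

lemma integrable_by_adm:
  fixes h :: "real^'n \<Rightarrow> real"
  assumes "adm u" "h \<in> borel_measurable lebesgue" "\<And>x. \<bar>h x\<bar> \<le> C * ((u x)\<^sup>2 + \<bar>u x\<bar> powr q)"
  shows "integrable lebesgue h"
proof (rule Bochner_Integration.integrable_bound[OF adm_dominating_integrable[OF assms(1), of C]])
  show "AE x in lebesgue. norm (h x) \<le> norm (C * ((u x)\<^sup>2 + \<bar>u x\<bar> powr q))"
    by (rule AE_I2) (metis abs_ge_self order_trans real_norm_def assms(3))
qed (rule assms(2))

lemma integrable_nonlinear:
  assumes u: "adm u"
  shows "integrable lebesgue (\<lambda>x. r \<bar>u x\<bar> * \<bar>u x\<bar>)" "integrable lebesgue (\<lambda>x. R \<bar>u x\<bar>)"
    "integrable lebesgue (\<lambda>x. \<bar>u x\<bar> powr q)"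
    "integrable lebesgue (\<lambda>x. f (u x) * u x)" "integrable lebesgue (\<lambda>x. F (u x))"
proof -
  note [measurable] = adm_measurable[OF u] measurable_comp_continuous[OF r_cont] measurable_comp_continuous[OF R_cont]
  show 1: "integrable lebesgue (\<lambda>x. r \<bar>u x\<bar> * \<bar>u x\<bar>)"
    by (rule integrable_by_adm[OF u, of _ K]) (use r_mult_le[of "\<bar>_\<bar>" "\<bar>_\<bar>"] in auto)
  show 2: "integrable lebesgue (\<lambda>x. R \<bar>u x\<bar>)"
    by (rule integrable_by_adm[OF u, of _ K]) (use R_le[of "\<bar>_\<bar>" "\<bar>_\<bar>"] in auto)
  show 3: "integrable lebesgue (\<lambda>x. \<bar>u x\<bar> powr q)" using u by (simp add: adm_def)
  show "integrable lebesgue (\<lambda>x. f (u x) * u x)" unfolding f_mult using 1 3 by simp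
  show "integrable lebesgue (\<lambda>x. F (u x))" unfolding F_abs using 2 3 by simp
qed

lemma deriv_by_sequences:
  fixes h :: "real \<Rightarrow> real"
  assumes "\<And>X. X \<longlonglongrightarrow> 0 \<Longrightarrow> (\<And>n. X n \<noteq> 0) \<Longrightarrow> (\<lambda>n. (h (X n) - h 0) / X n) \<longlonglongrightarrow> l"
  shows "(h has_real_derivative l) (at 0)"
  unfolding DERIV_def tendsto_at_iff_sequentially using assms by (auto simp: o_def)

lemma integral_f_deriv:
  assumes \<phi>: "adm \<phi>" and u: "adm u"
  shows "((\<lambda>s. \<integral>x. f (\<phi> x + s * u x) * (\<phi> x + s * u x) \<partial>lebesgue) has_real_derivative
     (\<integral>x. (f' (\<phi> x) * \<phi> x + f (\<phi> x)) * u x \<partial>lebesgue)) (at 0)"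
proof (rule deriv_by_sequences)
  fix X :: "nat \<Rightarrow> real" assume X: "X \<longlonglongrightarrow> 0" "\<And>n. X n \<noteq> 0"
  let ?k = "\<lambda>t. f t * t" and ?k' = "\<lambda>t. f' t * t + f t"
  have kd: "(?k has_real_derivative ?k' t) (at t)" for t
    by (auto intro!: derivative_eq_intros f_deriv)
  obtain B0 where B0: "\<And>n. \<bar>X n\<bar> \<le> B0"
    using convergent_imp_Bseq[OF convergentI[OF X(1)]] by (auto simp: Bseq_def)
  \<comment> \<open>Bounds the sequence of parameters; being at least 1, it lets the one admissible
    function \<open>m\<close> dominate the segments as well as the direction
    \<open>u\<close>.\<close>
  define b where "b = max B0 1"
  have b: "b \<ge> 1" "\<bar>X n\<bar> \<le> b" for n using B0[of n] by (auto simp: b_def)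
  define m where "m x = \<bar>\<phi> x\<bar> + b * \<bar>u x\<bar>" for x
  have m0: "m x \<ge> 0" for x using b by (simp add: m_def)
  have adm_m: "adm m" unfolding m_def[abs_def] by (intro adm_add adm_scale adm_abs \<phi> u)
  note [measurable] = adm_measurable[OF u] adm_measurable[OF \<phi>] measurable_comp_continuous[OF f_cont]
    measurable_comp_continuous[OF f'_cont]
  have adm_X: "adm (\<lambda>x. \<phi> x + X n * u x)" for n by (intro adm_add adm_scale \<phi> u)
  have "(\<lambda>n. \<integral>x. (?k (\<phi> x + X n * u x) - ?k (\<phi> x)) / X n \<partial>lebesgue)
      \<longlonglongrightarrow> (\<integral>x. ?k' (\<phi> x) * u x \<partial>lebesgue)"
  proof (rule integral_dominated_convergence)
    show "integrable lebesgue (\<lambda>x. 2 * c * ((m x)\<^sup>2 + \<bar>m x\<bar> powr q))"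
      by (rule adm_dominating_integrable[OF adm_m])
    show "AE x in lebesgue. (\<lambda>n. (?k (\<phi> x + X n * u x) - ?k (\<phi> x)) / X n) \<longlonglongrightarrow> ?k' (\<phi> x) * u x"
    proof (rule AE_I2)
      fix x
      have "((\<lambda>s. ?k (\<phi> x + s * u x)) has_real_derivative ?k' (\<phi> x + 0 * u x) * u x) (at 0)"
        by (rule DERIV_chain2[OF kd]) (auto intro!: derivative_eq_intros)
      then show "(\<lambda>n. (?k (\<phi> x + X n * u x) - ?k (\<phi> x)) / X n) \<longlonglongrightarrow> ?k' (\<phi> x) * u x"
        using X unfolding DERIV_def tendsto_at_iff_sequentially by (auto simp: o_def)
    qed
    show "AE x in lebesgue. norm ((?k (\<phi> x + X n * u x) - ?k (\<phi> x)) / X n) \<le> 2 * c * ((m x)\<^sup>2 + \<bar>m x\<bar> powr q)" for n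
    proof (rule AE_I2)
      fix x
      let ?M = "c * (1 + m x powr (q - 2)) * m x + c * (m x + m x powr (q - 1))"
      have Xu: "\<bar>X n * u x\<bar> \<le> b * \<bar>u x\<bar>" using b by (simp add: abs_mult mult_right_mono)
      have "norm (?k (\<phi> x + X n * u x) - ?k (\<phi> x)) \<le> ?M * norm (\<phi> x + X n * u x - \<phi> x)"
      proof (rule field_differentiable_bound[of "{- m x..m x}" _ ?k'])
        show "(?k has_field_derivative ?k' z) (at z within {- m x..m x})" for z
          using kd by (rule has_field_derivative_at_within)
        show "norm (?k' z) \<le> ?M" if "z \<in> {- m x..m x}" for z
        proof -
          have z: "\<bar>z\<bar> \<le> m x" using that by auto
          have "\<bar>f' z * z\<bar> \<le> c * (1 + m x powr (q - 2)) * m x"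
            unfolding abs_mult using f'_le[OF z] z by (intro mult_mono) (auto intro: order_trans[OF abs_ge_zero])
          then show ?thesis using f_le[OF z] abs_triangle_ineq[of "f' z * z" "f z"] by simp
        qed
        show "\<phi> x + X n * u x \<in> {- m x..m x}" "\<phi> x \<in> {- m x..m x}"
          using Xu b by (auto simp: m_def abs_le_iff)
      qed simp
      also have "?M = 2 * c * (m x + m x powr (q - 1))"
        using powr_q_split(2)[OF m0[of x]] by (simp add: algebra_simps)
      finally have "\<bar>(?k (\<phi> x + X n * u x) - ?k (\<phi> x)) / X n\<bar> \<le> 2 * c * (m x + m x powr (q - 1)) * \<bar>u x\<bar>"
        using X(2)[of n] by (simp add: pos_divide_le_eq abs_mult ac_simps)
      also have "\<dots> \<le> 2 * c * (m x + m x powr (q - 1)) * m x"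
      proof (intro mult_left_mono)
        have "1 * \<bar>u x\<bar> \<le> b * \<bar>u x\<bar>" using b by (intro mult_right_mono) auto
        then show "\<bar>u x\<bar> \<le> m x" by (simp add: m_def)
      qed (use c_pos m0 in simp)
      also have "\<dots> = 2 * c * ((m x)\<^sup>2 + \<bar>m x\<bar> powr q)"
        using powr_q_split(1)[OF m0[of x]] m0[of x] by (simp add: power2_eq_square algebra_simps)
      finally show "norm ((?k (\<phi> x + X n * u x) - ?k (\<phi> x)) / X n) \<le> 2 * c * ((m x)\<^sup>2 + \<bar>m x\<bar> powr q)" by simp
    qed
  qed measurable
  moreover have "(\<integral>x. (?k (\<phi> x + X n * u x) - ?k (\<phi> x)) / X n \<partial>lebesgue)
    = ((\<integral>x. ?k (\<phi> x + X n * u x) \<partial>lebesgue) - (\<integral>x. ?k (\<phi> x) \<partial>lebesgue)) / X n" for n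
    using integrable_nonlinear(4)[OF adm_X[of n]] integrable_nonlinear(4)[OF \<phi>] by simp
  ultimately show "(\<lambda>n. ((\<integral>x. ?k (\<phi> x + X n * u x) \<partial>lebesgue) - (\<integral>x. ?k (\<phi> x + 0 * u x) \<partial>lebesgue)) / X n)
      \<longlonglongrightarrow> (\<integral>x. ?k' (\<phi> x) * u x \<partial>lebesgue)" by (simp only: mult_zero_left add_0_right)
qed

lemma F_taylor: "\<exists>\<xi>. \<bar>\<xi> - a\<bar> \<le> \<bar>h\<bar> \<and> F (a + h) - F a - h * f a = 1/2 * f' \<xi> * h\<^sup>2"
proof (cases "h = 0")
  case False
  define diff where "diff m = (if m = 0 then F else if m = 1 then f else f')" for m :: nat
  have "\<exists>t. (if a + h < a then a + h < t \<and> t < a else a < t \<and> t < a + h) \<and>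
     F (a + h) = (\<Sum>m<2. (diff m a / fact m) * (a + h - a)^m) + (diff 2 t / fact 2) * (a + h - a)^2"
    by (rule Taylor[of _ _ _ "a - \<bar>h\<bar>" "a + \<bar>h\<bar>"])
       (use False f_deriv F_deriv in \<open>auto simp: diff_def less_2_cases_iff\<close>)
  then obtain t where t: "if a + h < a then a + h < t \<and> t < a else a < t \<and> t < a + h"
     "F (a + h) = (\<Sum>m<2. (diff m a / fact m) * (a + h - a)^m) + (diff 2 t / fact 2) * (a + h - a)^2"
    by blast
  have "\<bar>t - a\<bar> \<le> \<bar>h\<bar>" using t(1) by (auto split: if_splits)
  moreover have "F (a + h) = F a + f a * h + (f' t / 2) * h\<^sup>2"
    using t(2) by (simp add: diff_def lessThan_Suc numeral_2_eq_2)
  ultimately show ?thesis by (intro exI[of _ t]) (simp add: algebra_simps)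
qed (auto intro: exI[of _ a])

text \<open>The direction varies with \<open>n\<close> because the points on the constraint approach
  \<phi> along \<open>u\<close> only in the limit. Subtracting the exact first-order term makes the
  rate at which \<open>\<rho>\<close> tends to 0 irrelevant.\<close>

lemma integral_F_second_order:
  fixes \<phi> u :: "real^'n \<Rightarrow> real"
  assumes \<phi>: "adm \<phi>" and u: "adm u" and s: "s \<longlonglongrightarrow> 0" "\<And>n. s n \<noteq> 0" and \<rho>: "\<rho> \<longlonglongrightarrow> 0"
  shows "(\<lambda>n. \<integral>x. (F (\<phi> x + s n * (u x + \<rho> n * \<phi> x)) - F (\<phi> x) - s n * (u x + \<rho> n * \<phi> x) * f (\<phi> x)) / (s n)\<^sup>2 \<partial>lebesgue)
    \<longlonglongrightarrow> (\<integral>x. 1/2 * f' (\<phi> x) * (u x)\<^sup>2 \<partial>lebesgue)"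
proof -
  let ?v = "\<lambda>n x. u x + \<rho> n * \<phi> x"
  obtain B1 B2 where B: "\<And>n. \<bar>s n\<bar> \<le> B1" "\<And>n. \<bar>\<rho> n\<bar> \<le> B2"
    using convergent_imp_Bseq[OF convergentI[OF s(1)]] convergent_imp_Bseq[OF convergentI[OF \<rho>]]
    by (auto simp: Bseq_def)
  define b where "b = max (max B1 B2) 1"
  have b: "b \<ge> 1" "\<bar>s n\<bar> \<le> b" "\<bar>\<rho> n\<bar> \<le> b" for n using B(1)[of n] B(2)[of n] by (auto simp: b_def)
  define v where "v x = \<bar>u x\<bar> + b * \<bar>\<phi> x\<bar>" for x
  define m where "m x = \<bar>\<phi> x\<bar> + b * v x" for x
  have v0: "v x \<ge> 0" for x using b by (simp add: v_def)
  have m0: "m x \<ge> 0" for x using b v0 by (simp add: m_def)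
  have adm_m: "adm m" unfolding m_def[abs_def] v_def[abs_def]
    by (intro adm_add adm_scale adm_abs \<phi> u)
  have v_le: "\<bar>?v n x\<bar> \<le> v x" for n x
  proof -
    have "\<bar>\<rho> n * \<phi> x\<bar> \<le> b * \<bar>\<phi> x\<bar>" using b by (simp add: abs_mult mult_right_mono)
    then show ?thesis unfolding v_def by linarith
  qed
  have vm: "v x \<le> m x" for x
  proof -
    have "1 * v x \<le> b * v x" using b v0 by (intro mult_right_mono) auto
    then show ?thesis by (simp add: m_def)
  qed
  note [measurable] = adm_measurable[OF u] adm_measurable[OF \<phi>] measurable_comp_continuous[OF f_cont]
    measurable_comp_continuous[OF f'_cont] measurable_comp_continuous[OF F_cont]
  \<comment> \<open>Chosen point by point, without measurability: the integrand is always the left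
    side of \<open>eq\<close>, and \<xi> only supplies its bound and its pointwise limit.\<close>
  define \<xi> where "\<xi> n x = (SOME z. \<bar>z - \<phi> x\<bar> \<le> \<bar>s n * ?v n x\<bar> \<and>
     F (\<phi> x + s n * ?v n x) - F (\<phi> x) - s n * ?v n x * f (\<phi> x) = 1/2 * f' z * (s n * ?v n x)\<^sup>2)" for n x
  have "\<bar>\<xi> n x - \<phi> x\<bar> \<le> \<bar>s n * ?v n x\<bar> \<and>
     F (\<phi> x + s n * ?v n x) - F (\<phi> x) - s n * ?v n x * f (\<phi> x) = 1/2 * f' (\<xi> n x) * (s n * ?v n x)\<^sup>2" for n x
    unfolding \<xi>_def by (rule someI_ex) (rule F_taylor)
  then have \<xi>: "\<And>n x. \<bar>\<xi> n x - \<phi> x\<bar> \<le> \<bar>s n * ?v n x\<bar>"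
    "\<And>n x. F (\<phi> x + s n * ?v n x) - F (\<phi> x) - s n * ?v n x * f (\<phi> x) = 1/2 * f' (\<xi> n x) * (s n * ?v n x)\<^sup>2"
    by blast+
  have eq: "(F (\<phi> x + s n * ?v n x) - F (\<phi> x) - s n * ?v n x * f (\<phi> x)) / (s n)\<^sup>2 = 1/2 * f' (\<xi> n x) * (?v n x)\<^sup>2" for n x
    unfolding \<xi>(2) using s(2)[of n] by (simp add: power_mult_distrib)
  show ?thesis
  proof (rule integral_dominated_convergence)
    show "integrable lebesgue (\<lambda>x. c * ((m x)\<^sup>2 + \<bar>m x\<bar> powr q))"
      by (rule adm_dominating_integrable[OF adm_m])
    show "AE x in lebesgue. (\<lambda>n. (F (\<phi> x + s n * ?v n x) - F (\<phi> x) - s n * ?v n x * f (\<phi> x)) / (s n)\<^sup>2)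
       \<longlonglongrightarrow> 1/2 * f' (\<phi> x) * (u x)\<^sup>2"
    proof (rule AE_I2)
      fix x
      have v: "(\<lambda>n. ?v n x) \<longlonglongrightarrow> u x"
        using tendsto_add[OF tendsto_const[of "u x"] tendsto_mult[OF \<rho> tendsto_const[of "\<phi> x"]]] by simp
      have "(\<lambda>n. \<bar>s n * ?v n x\<bar>) \<longlonglongrightarrow> 0"
        using tendsto_rabs[OF tendsto_mult[OF s(1) v]] by simp
      then have "(\<lambda>n. \<xi> n x - \<phi> x) \<longlonglongrightarrow> 0"
        by (rule Lim_null_comparison[rotated]) (use \<xi>(1) in auto)
      then have "(\<lambda>n. \<xi> n x) \<longlonglongrightarrow> \<phi> x" by (rule LIM_zero_cancel)
      then have "(\<lambda>n. f' (\<xi> n x)) \<longlonglongrightarrow> f' (\<phi> x)"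
        by (rule continuous_on_tendsto_compose[OF f'_cont]) auto
      then show "(\<lambda>n. (F (\<phi> x + s n * ?v n x) - F (\<phi> x) - s n * ?v n x * f (\<phi> x)) / (s n)\<^sup>2)
         \<longlonglongrightarrow> 1/2 * f' (\<phi> x) * (u x)\<^sup>2"
        unfolding eq by (intro tendsto_intros v)
    qed
    show "AE x in lebesgue. norm ((F (\<phi> x + s n * ?v n x) - F (\<phi> x) - s n * ?v n x * f (\<phi> x)) / (s n)\<^sup>2)
       \<le> c * ((m x)\<^sup>2 + \<bar>m x\<bar> powr q)" for n
    proof (rule AE_I2)
      fix x
      have "\<bar>s n * ?v n x\<bar> \<le> b * v x"
        unfolding abs_mult using b v_le[of x n] by (intro mult_mono) auto
      then have "\<bar>\<xi> n x\<bar> \<le> m x" using \<xi>(1)[of n x] unfolding m_def by linarith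
      then have "\<bar>f' (\<xi> n x)\<bar> \<le> c * (1 + m x powr (q - 2))" by (rule f'_le)
      moreover have "(?v n x)\<^sup>2 \<le> (m x)\<^sup>2"
        using order_trans[OF v_le vm, of x n] m0[of x] by (simp add: abs_le_square_iff[symmetric])
      ultimately have "\<bar>f' (\<xi> n x)\<bar> * (?v n x)\<^sup>2 \<le> c * (1 + m x powr (q - 2)) * (m x)\<^sup>2"
        by (intro mult_mono) (auto intro: order_trans[OF abs_ge_zero])
      also have "\<dots> = c * ((m x)\<^sup>2 + \<bar>m x\<bar> powr q)"
        using powr_q_split(3)[OF m0[of x]] m0[of x] by (simp add: algebra_simps)
      finally have *: "\<bar>f' (\<xi> n x)\<bar> * (?v n x)\<^sup>2 \<le> c * ((m x)\<^sup>2 + \<bar>m x\<bar> powr q)" .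
      have "norm (1/2 * f' (\<xi> n x) * (?v n x)\<^sup>2) = 1/2 * (\<bar>f' (\<xi> n x)\<bar> * (?v n x)\<^sup>2)"
        by (simp add: abs_mult)
      also have "\<dots> \<le> \<bar>f' (\<xi> n x)\<bar> * (?v n x)\<^sup>2" by simp
      finally show "norm ((F (\<phi> x + s n * ?v n x) - F (\<phi> x) - s n * ?v n x * f (\<phi> x)) / (s n)\<^sup>2)
         \<le> c * ((m x)\<^sup>2 + \<bar>m x\<bar> powr q)"
        unfolding eq using * by (rule order_trans)
    qed
  qed measurable
qed

text \<open>If \<open>|u|^q\<close> were not integrable, the Bochner integral of \<open>|\<phi> + s u|^q\<close> would be the
  junk value \<open>0\<close> for all \<open>s \<noteq> 0\<close>, so the functional below would jump at \<open>s = 0\<close>. This replaces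
  the Sobolev embedding.\<close>

lemma integrable_powr_q_if_continuous:
  fixes \<phi> u :: "real^'n \<Rightarrow> real"
  assumes \<phi>: "adm \<phi>" "\<And>x. \<phi> x > 0" and u: "L2 u"
    and cont: "isCont (\<lambda>s. E s - (\<integral>x. \<bar>\<phi> x + s * u x\<bar> powr q \<partial>lebesgue)
        - (\<integral>x. r \<bar>\<phi> x + s * u x\<bar> * \<bar>\<phi> x + s * u x\<bar> \<partial>lebesgue)) 0"
    and E: "isCont E (0::real)"
  shows "integrable lebesgue (\<lambda>x. \<bar>u x\<bar> powr q)"
proof (rule ccontr)
  assume non: "\<not> integrable lebesgue (\<lambda>x. \<bar>u x\<bar> powr q)"
  let ?I = "\<lambda>s. \<integral>x. \<bar>\<phi> x + s * u x\<bar> powr q \<partial>lebesgue"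
  let ?j = "\<lambda>s x. r \<bar>\<phi> x + s * u x\<bar> * \<bar>\<phi> x + s * u x\<bar>"
  let ?J = "\<lambda>s. \<integral>x. ?j s x \<partial>lebesgue"
  note [measurable] = adm_measurable[OF \<phi>(1)] L2D(1)[OF u] measurable_comp_continuous[OF r_cont]
  have I0: "?I s = 0" if "s \<noteq> 0" for s
  proof (rule not_integrable_integral_eq, rule notI)
    assume i: "integrable lebesgue (\<lambda>x. \<bar>\<phi> x + s * u x\<bar> powr q)"
    have "integrable lebesgue (\<lambda>x. \<bar>(\<phi> x + s * u x) + (- 1) * \<phi> x\<bar> powr q)"
      by (intro integrable_powr_q_add integrable_powr_q_scale i integrable_nonlinear(3)[OF \<phi>(1)]) measurable
    then have "integrable lebesgue (\<lambda>x. \<bar>(1 / s) * (s * u x)\<bar> powr q)"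
      by (intro integrable_powr_q_scale[of "\<lambda>x. s * u x"]) simp
    then show False using non that by simp
  qed
  \<comment> \<open>Away from 0 the sum \<open>?I + ?J\<close> is \<open>?J\<close> alone, so
    continuity forces \<open>?J\<close> to tend to \<open>?I 0 + ?J 0\<close>, where
    \<open>?I 0\<close> is positive.\<close>
  have "continuous (at 0) (\<lambda>s. E s - (E s - ?I s - ?J s))" by (intro continuous_intros cont E)
  then have IJ: "isCont (\<lambda>s. ?I s + ?J s) 0" by simp
  have lim: "(\<lambda>n. ?J (X n)) \<longlonglongrightarrow> ?I 0 + ?J 0" if "X \<longlonglongrightarrow> 0" "\<And>n. X n \<noteq> 0" for X
    using isCont_tendsto_compose[OF IJ that(1)] by (simp add: I0[OF that(2)])
  have "?I 0 > 0"
  proof -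
    have nn: "0 \<le> ?I 0" by (intro integral_nonneg_AE) auto
    have "?I 0 \<noteq> 0"
    proof
      assume "?I 0 = 0"
      then have "AE x in lebesgue. \<bar>\<phi> x\<bar> powr q = 0"
        using integrable_nonlinear(3)[OF \<phi>(1)] by (subst (asm) integral_nonneg_eq_0_iff_AE) auto
      then have "AE x in (lebesgue :: (real^'n) measure). False"
        by eventually_elim (use \<phi>(2) in \<open>simp add: less_le\<close>)
      then show False
        using ae_filter_eq_bot_iff[of "lebesgue :: (real^'n) measure"]
        by (simp add: trivial_limit_def emeasure_lborel_UNIV)
    qed
    then show ?thesis using nn by (metis order.not_eq_order_implies_strict)
  qed
  have j0: "?j s x \<ge> 0" for s x using r_abs(1) by simp
  \<comment> \<open>The integral of \<open>?j\<close> may diverge too. If it converges for some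
    \<open>s\<close>, convexity of the absolute value dominates \<open>?j\<close> along a sequence
    of multiples of \<open>s\<close> and \<open>?J\<close> tends to \<open>?J 0\<close>; if it never
    does, \<open>?J\<close> is 0 away from 0. Both limits are too small.\<close>
  show False
  proof (cases "\<exists>s. s \<noteq> 0 \<and> integrable lebesgue (?j s)")
    case True
    then obtain s where s: "s \<noteq> 0" "integrable lebesgue (?j s)" by blast
    define X where "X n = s * inverse (real (Suc n))" for n
    have X: "X \<longlonglongrightarrow> 0" "\<And>n. X n \<noteq> 0"
      using tendsto_mult[OF tendsto_const[of s] LIMSEQ_inverse_real_of_nat] s(1) by (auto simp: X_def[abs_def])
    have "(\<lambda>n. ?J (X n)) \<longlonglongrightarrow> ?J 0"
    proof (rule integral_dominated_convergence)
      show "integrable lebesgue (\<lambda>x. ?j 0 x + ?j s x)"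
        using s(2) integrable_nonlinear(1)[OF \<phi>(1)] by simp
      show "AE x in lebesgue. (\<lambda>n. ?j (X n) x) \<longlonglongrightarrow> ?j 0 x"
      proof (rule AE_I2)
        fix x
        have w: "(\<lambda>n. \<bar>\<phi> x + X n * u x\<bar>) \<longlonglongrightarrow> \<bar>\<phi> x + 0 * u x\<bar>"
          by (intro tendsto_intros X)
        show "(\<lambda>n. ?j (X n) x) \<longlonglongrightarrow> ?j 0 x"
          by (intro tendsto_mult w continuous_on_tendsto_compose[OF r_cont w]) auto
      qed
      show "AE x in lebesgue. norm (?j (X n) x) \<le> ?j 0 x + ?j s x" for n
      proof (rule AE_I2)
        fix x
        define t where "t = inverse (real (Suc n))"
        have t: "0 \<le> t" "t \<le> 1" by (auto simp: t_def field_simps)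
        have "\<phi> x + X n * u x = (1 - t) * \<phi> x + t * (\<phi> x + s * u x)"
          by (simp add: X_def t_def algebra_simps)
        then have "\<bar>\<phi> x + X n * u x\<bar> \<le> (1 - t) * \<bar>\<phi> x\<bar> + t * \<bar>\<phi> x + s * u x\<bar>"
          using t abs_triangle_ineq[of "(1 - t) * \<phi> x" "t * (\<phi> x + s * u x)"] by (simp add: abs_mult)
        also have "\<dots> \<le> max \<bar>\<phi> x\<bar> \<bar>\<phi> x + s * u x\<bar>"
          using t by (intro convex_bound_le) auto
        finally have "?j (X n) x \<le> r (max \<bar>\<phi> x\<bar> \<bar>\<phi> x + s * u x\<bar>) * max \<bar>\<phi> x\<bar> \<bar>\<phi> x + s * u x\<bar>"
          using r_mono[of 0] by (intro mult_mono r_mono) auto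
        also have "\<dots> \<le> ?j 0 x + ?j s x" using j0[of x 0] j0[of x s] by (simp add: max_def)
        finally show "norm (?j (X n) x) \<le> ?j 0 x + ?j s x" using j0[of x "X n"] by simp
      qed
    qed measurable
    with lim[OF X] have "?I 0 + ?J 0 = ?J 0" by (rule LIMSEQ_unique)
    then show False using \<open>?I 0 > 0\<close> by simp
  next
    case False
    then have "?J s = 0" if "s \<noteq> 0" for s using that by (intro not_integrable_integral_eq) auto
    with lim[OF LIMSEQ_inverse_real_of_nat] have "(\<lambda>n::nat. 0::real) \<longlonglongrightarrow> ?I 0 + ?J 0" by simp
    then have "?I 0 + ?J 0 = 0" by (simp add: LIMSEQ_const_iff)
    moreover have "?J 0 \<ge> 0" by (intro integral_nonneg_AE AE_I2 j0)
    ultimately show False using \<open>?I 0 > 0\<close> by linarith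
  qed
qed

end

text \<open>The bound \<open>b\<close> makes multiplication by the potential a bounded operator. The
  equation enters in weak form, tested against the whole energy space.\<close>

locale ground = nonlinearity q K r r' R
  for q K :: real and r r' R :: "real \<Rightarrow> real" +
  fixes \<phi> :: "real^'n::finite \<Rightarrow> real" and \<omega> b :: real
  assumes \<phi>_pos: "\<And>x. \<phi> x > 0" and \<phi>_le: "\<And>x. \<phi> x \<le> b"
    and \<phi>_L2: "L2 \<phi>" and \<phi>_h1: "h1 (abs_lsq \<phi>)"
    and weak_eq: "\<And>v. L2 v \<Longrightarrow> h1 (abs_lsq v) \<Longrightarrow>
      dirichlet (abs_lsq \<phi>) (abs_lsq v) + \<omega> * inner (abs_lsq \<phi>) (abs_lsq v) = (\<integral>x. f (\<phi> x) * v x \<partial>lebesgue)"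
begin

definition N :: "(real^'n \<Rightarrow> real) \<Rightarrow> real" where
  "N w = dirichlet (abs_lsq w) (abs_lsq w) + \<omega> * inner (abs_lsq w) (abs_lsq w) - (\<integral>x. f (w x) * w x \<partial>lebesgue)"

definition S :: "(real^'n \<Rightarrow> real) \<Rightarrow> real" where
  "S w = 1/2 * dirichlet (abs_lsq w) (abs_lsq w) + \<omega>/2 * inner (abs_lsq w) (abs_lsq w) - (\<integral>x. F (w x) \<partial>lebesgue)"

definition vp :: "real^'n \<Rightarrow> real" where "vp x = \<omega> - f' (\<phi> x)"

lemma \<phi>_measurable: "\<phi> \<in> borel_measurable lebesgue"
  using \<phi>_L2 by (simp add: L2_real)

lemma adm_\<phi>: "adm \<phi>"
  unfolding adm_def
proof
  show "integrable lebesgue (\<lambda>x. \<bar>\<phi> x\<bar> powr q)"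
  proof (rule Bochner_Integration.integrable_bound)
    show "integrable lebesgue (\<lambda>x. b powr (q - 2) * (\<phi> x)\<^sup>2)" using \<phi>_L2 by (simp add: L2_real)
    show "AE x in lebesgue. norm (\<bar>\<phi> x\<bar> powr q) \<le> norm (b powr (q - 2) * (\<phi> x)\<^sup>2)"
    proof (rule AE_I2)
      fix x
      have "\<phi> x powr q = \<phi> x powr (q - 2) * (\<phi> x)\<^sup>2" using powr_q_split(3)[of "\<phi> x"] \<phi>_pos[of x] by simp
      also have "\<dots> \<le> b powr (q - 2) * (\<phi> x)\<^sup>2"
        using \<phi>_pos[of x] \<phi>_le[of x] q by (intro mult_right_mono powr_mono2) auto
      finally show "norm (\<bar>\<phi> x\<bar> powr q) \<le> norm (b powr (q - 2) * (\<phi> x)\<^sup>2)" using \<phi>_pos[of x] by simp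
    qed
  qed (use \<phi>_measurable in measurable)
qed (rule \<phi>_L2)

lemma \<phi>_abs: "\<bar>\<phi> x\<bar> \<le> b" using \<phi>_pos[of x] \<phi>_le[of x] by simp

lemma vp_measurable: "vp \<in> borel_measurable lebesgue"
  unfolding vp_def[abs_def]
  using measurable_comp_continuous[OF f'_cont \<phi>_measurable] by measurable

lemma vp_bounded: "\<bar>vp x\<bar> \<le> \<bar>\<omega>\<bar> + c * (1 + b powr (q - 2))"
  unfolding vp_def using f'_le[OF \<phi>_abs, of x] by linarith

sublocale schroedinger_form "mulop vp" "abs_lsq \<phi>"
  by (rule schroedinger_form.intro)
     (rule mulop_props[OF vp_measurable vp_bounded] \<phi>_h1)+

lemma inner_mulop_vp:
  assumes "L2 u" "L2 v"
  shows "inner (mulop vp (abs_lsq u)) (abs_lsq v) = (\<integral>x. vp x * u x * v x \<partial>lebesgue)"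
  unfolding mulop_abs[OF vp_measurable vp_bounded assms(1)]
  by (rule inner_abs_lsq[OF L2_mult_bounded[OF vp_measurable vp_bounded assms(1)] assms(2)])

lemma f\<phi>_L2: "L2 (\<lambda>x. f (\<phi> x))"
proof (rule L2_bound[OF L2_scale[OF \<phi>_L2, of "c * (1 + b powr (q - 2))"]])
  show "(\<lambda>x. f (\<phi> x)) \<in> borel_measurable lebesgue" by (rule measurable_comp_continuous[OF f_cont \<phi>_measurable])
  show "AE x in lebesgue. \<bar>f (\<phi> x)\<bar> \<le> \<bar>c * (1 + b powr (q - 2)) * \<phi> x\<bar>"
  proof (rule AE_I2)
    fix x
    have p: "\<phi> x > 0" by (rule \<phi>_pos)
    have "\<bar>f (\<phi> x)\<bar> \<le> c * (\<phi> x + \<phi> x powr (q - 1))" using p by (intro f_le) auto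
    also have "\<phi> x powr (q - 1) = \<phi> x powr (q - 2) * \<phi> x" using powr_q_split(2)[of "\<phi> x"] p by simp
    also have "c * (\<phi> x + \<phi> x powr (q - 2) * \<phi> x) \<le> c * (\<phi> x + b powr (q - 2) * \<phi> x)"
      using p \<phi>_le[of x] q c_pos by (intro mult_left_mono add_left_mono mult_right_mono powr_mono2) auto
    also have "\<dots> = c * (1 + b powr (q - 2)) * \<phi> x" by (simp add: algebra_simps)
    finally show "\<bar>f (\<phi> x)\<bar> \<le> \<bar>c * (1 + b powr (q - 2)) * \<phi> x\<bar>" by linarith
  qed
qed

text \<open>The weak equation eliminates the gradients and leaves an integral whose sign at
  \<open>v = \<phi>\<close> is decided by \<open>f_super\<close>.\<close>

lemma B_\<phi>:
  assumes "L2 v" "h1 (abs_lsq v)"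
  shows "B (abs_lsq \<phi>) (abs_lsq v) = (\<integral>x. (f (\<phi> x) - f' (\<phi> x) * \<phi> x) * v x \<partial>lebesgue)"
proof -
  have i: "integrable lebesgue (\<lambda>x. \<phi> x * v x)" "integrable lebesgue (\<lambda>x. f (\<phi> x) * v x)"
    "integrable lebesgue (\<lambda>x. vp x * \<phi> x * v x)"
    by (intro L2_mult_integrable \<phi>_L2 f\<phi>_L2 L2_mult_bounded[OF vp_measurable vp_bounded] assms)+
  have "B (abs_lsq \<phi>) (abs_lsq v) = (\<integral>x. f (\<phi> x) * v x \<partial>lebesgue) - \<omega> * (\<integral>x. \<phi> x * v x \<partial>lebesgue)
     + (\<integral>x. vp x * \<phi> x * v x \<partial>lebesgue)"
    using weak_eq[OF assms] by (simp add: B_def inner_mulop_vp[OF \<phi>_L2 assms(1)] inner_abs_lsq[OF \<phi>_L2 assms(1)])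
  also have "\<dots> = (\<integral>x. f (\<phi> x) * v x - \<omega> * (\<phi> x * v x) + vp x * \<phi> x * v x \<partial>lebesgue)"
    using i by simp
  also have "\<dots> = (\<integral>x. (f (\<phi> x) - f' (\<phi> x) * \<phi> x) * v x \<partial>lebesgue)"
    by (rule Bochner_Integration.integral_cong) (auto simp: vp_def algebra_simps)
  finally show ?thesis .
qed

lemma B_\<phi>_neg: "B (abs_lsq \<phi>) (abs_lsq \<phi>) < 0"
proof -
  let ?h = "\<lambda>x. (f' (\<phi> x) * \<phi> x - f (\<phi> x)) * \<phi> x"
  have pos: "?h x > 0" for x using f_super[OF \<phi>_pos[of x]] \<phi>_pos[of x] by simp
  have int: "integrable lebesgue ?h"
  proof -
    have "integrable lebesgue (\<lambda>x. \<omega> * (\<phi> x * \<phi> x) - vp x * \<phi> x * \<phi> x - f (\<phi> x) * \<phi> x)"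
      by (intro Bochner_Integration.integrable_diff integrable_mult_right L2_mult_integrable \<phi>_L2 f\<phi>_L2
          L2_mult_bounded[OF vp_measurable vp_bounded])
    then show ?thesis by (simp add: vp_def algebra_simps)
  qed
  have nn: "0 \<le> (\<integral>x. ?h x \<partial>lebesgue)"
    by (intro integral_nonneg_AE AE_I2 less_imp_le pos)
  have "(\<integral>x. ?h x \<partial>lebesgue) \<noteq> 0"
  proof
    assume "(\<integral>x. ?h x \<partial>lebesgue) = 0"
    then have "AE x in lebesgue. ?h x = 0"
      using int pos by (subst (asm) integral_nonneg_eq_0_iff_AE) (auto intro: less_imp_le)
    then have "AE x in (lebesgue :: (real^'n) measure). False"
    proof eventually_elim
      case (elim x) then show ?case using pos[of x] by linarith
    qed
    then show False
      using ae_filter_eq_bot_iff[of "lebesgue :: (real^'n) measure"]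
      by (simp add: trivial_limit_def emeasure_lborel_UNIV)
  qed
  then have "(\<integral>x. ?h x \<partial>lebesgue) > 0" using nn by (metis order.not_eq_order_implies_strict)
  moreover have "B (abs_lsq \<phi>) (abs_lsq \<phi>) = - (\<integral>x. ?h x \<partial>lebesgue)"
  proof -
    have "(\<integral>x. (f (\<phi> x) - f' (\<phi> x) * \<phi> x) * \<phi> x \<partial>lebesgue) = (\<integral>x. - ?h x \<partial>lebesgue)"
      by (rule Bochner_Integration.integral_cong) (auto simp: algebra_simps)
    then show ?thesis unfolding B_\<phi>[OF \<phi>_L2 \<phi>_h1] by simp
  qed
  ultimately show ?thesis by simp
qed

definition E :: "(real^'n \<Rightarrow> real) \<Rightarrow> real" where
  "E w = dirichlet (abs_lsq w) (abs_lsq w) + \<omega> * inner (abs_lsq w) (abs_lsq w)"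

definition E2 :: "(real^'n \<Rightarrow> real) \<Rightarrow> (real^'n \<Rightarrow> real) \<Rightarrow> real" where
  "E2 v w = dirichlet (abs_lsq v) (abs_lsq w) + \<omega> * inner (abs_lsq v) (abs_lsq w)"

lemma E_line:
  assumes "L2 v" "h1 (abs_lsq v)" "L2 w" "h1 (abs_lsq w)"
  shows "E (\<lambda>x. v x + s * w x) = E v + 2 * s * E2 v w + s\<^sup>2 * E w"
proof -
  have "abs_lsq (\<lambda>x. v x + s * w x) = abs_lsq v + s *\<^sub>R abs_lsq w"
    using assms by (simp add: abs_lsq_add abs_lsq_scale L2_scale)
  then show ?thesis
    using assms by (simp add: E_def E2_def dirichlet_add_left dirichlet_add_right dirichlet_scaleR_left
        dirichlet_scaleR_right h1_scaleR h1_add dirichlet_commute[of "abs_lsq w" "abs_lsq v"]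
        inner_add_left inner_add_right inner_commute[of "abs_lsq w" "abs_lsq v"] power2_eq_square algebra_simps)
qed

lemma E_line_deriv:
  assumes "L2 v" "h1 (abs_lsq v)" "L2 w" "h1 (abs_lsq w)"
  shows "((\<lambda>s. E (\<lambda>x. v x + s * w x)) has_real_derivative 2 * E2 v w) (at 0)"
  unfolding E_line[OF assms] by (auto intro!: derivative_eq_intros)

lemma N_line_deriv:
  assumes "adm v" "h1 (abs_lsq v)" "adm w" "h1 (abs_lsq w)"
  shows "((\<lambda>s. N (\<lambda>x. v x + s * w x)) has_real_derivative
     2 * E2 v w - (\<integral>x. (f' (v x) * v x + f (v x)) * w x \<partial>lebesgue)) (at 0)"
proof -
  have "((\<lambda>s. E (\<lambda>x. v x + s * w x) - (\<integral>x. f (v x + s * w x) * (v x + s * w x) \<partial>lebesgue)) has_real_derivative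
     2 * E2 v w - (\<integral>x. (f' (v x) * v x + f (v x)) * w x \<partial>lebesgue)) (at 0)"
    using assms by (intro DERIV_diff E_line_deriv integral_f_deriv) (auto simp: adm_def)
  then show ?thesis by (simp add: N_def E_def)
qed

text \<open>The weak equation turns the derivative of the quadratic part into twice the integral of
  \<open>f (\<phi> x) * v x\<close>; subtracting the derivative of \<open>f t * t\<close> leaves the
  integrand of \<open>B_\<phi>\<close>. So the tangent space is a hyperplane defined by the
  form.\<close>

lemma N_\<phi>_deriv:
  assumes "adm v" "h1 (abs_lsq v)"
  shows "((\<lambda>s. N (\<lambda>x. \<phi> x + s * v x)) has_real_derivative B (abs_lsq \<phi>) (abs_lsq v)) (at 0)"
proof -
  have L: "L2 v" using assms by (simp add: adm_def)
  have i: "integrable lebesgue (\<lambda>x. f (\<phi> x) * v x)" "integrable lebesgue (\<lambda>x. \<phi> x * v x)"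
    "integrable lebesgue (\<lambda>x. vp x * \<phi> x * v x)"
    by (intro L2_mult_integrable \<phi>_L2 f\<phi>_L2 L2_mult_bounded[OF vp_measurable vp_bounded] L)+
  have i2: "integrable lebesgue (\<lambda>x. (f' (\<phi> x) * \<phi> x + f (\<phi> x)) * v x)"
  proof -
    have "integrable lebesgue (\<lambda>x. \<omega> * (\<phi> x * v x) - vp x * \<phi> x * v x + f (\<phi> x) * v x)" using i by simp
    then show ?thesis by (simp add: vp_def algebra_simps)
  qed
  have "2 * E2 \<phi> v - (\<integral>x. (f' (\<phi> x) * \<phi> x + f (\<phi> x)) * v x \<partial>lebesgue)
     = 2 * (\<integral>x. f (\<phi> x) * v x \<partial>lebesgue) - (\<integral>x. (f' (\<phi> x) * \<phi> x + f (\<phi> x)) * v x \<partial>lebesgue)"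
    using weak_eq[OF L assms(2)] by (simp add: E2_def)
  also have "\<dots> = (\<integral>x. 2 * (f (\<phi> x) * v x) - (f' (\<phi> x) * \<phi> x + f (\<phi> x)) * v x \<partial>lebesgue)"
    using i i2 by simp
  also have "\<dots> = B (abs_lsq \<phi>) (abs_lsq v)"
    unfolding B_\<phi>[OF L assms(2)] by (rule Bochner_Integration.integral_cong) (auto simp: algebra_simps)
  finally show ?thesis using N_line_deriv[OF adm_\<phi> \<phi>_h1 assms] by simp
qed

text \<open>Moving the base point along the line to parameter \<open>s\<close> reduces the claim to
  differentiability at 0.\<close>

lemma N_line_continuous:
  assumes "adm v" "h1 (abs_lsq v)" "adm w" "h1 (abs_lsq w)"
  shows "isCont (\<lambda>s. N (\<lambda>x. v x + s * w x)) s"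
proof -
  have "abs_lsq (\<lambda>x. v x + s * w x) = abs_lsq v + s *\<^sub>R abs_lsq w"
    using assms by (simp add: adm_def abs_lsq_add abs_lsq_scale L2_scale)
  then have h: "h1 (abs_lsq (\<lambda>x. v x + s * w x))" using assms by (simp add: h1_add h1_scaleR)
  have "isCont (\<lambda>t. N (\<lambda>x. (v x + s * w x) + t * w x)) 0"
    by (rule DERIV_isCont[OF N_line_deriv[OF adm_add[OF assms(1) adm_scale[OF assms(3)]] h assms(3,4)]])
  then have "isCont (\<lambda>t. N (\<lambda>x. v x + (s + t) * w x)) 0" by (simp add: algebra_simps)
  then show ?thesis by (simp add: isCont_iff)
qed

end

section \<open>Minimality on the Nehari constraint\<close>

locale ground_min = ground q K r r' R \<phi> \<omega> b
  for q K :: real and r r' R :: "real \<Rightarrow> real" and \<phi> :: "real^'n::finite \<Rightarrow> real" and \<omega> b :: real +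
  assumes N_\<phi>: "N \<phi> = 0"
    and minimal: "\<And>w. adm w \<Longrightarrow> h1 (abs_lsq w) \<Longrightarrow> abs_lsq w \<noteq> 0 \<Longrightarrow> N w = 0 \<Longrightarrow> S \<phi> \<le> S w"
begin

lemma constraint_curve:
  assumes u: "adm u" "h1 (abs_lsq u)" "B (abs_lsq \<phi>) (abs_lsq u) = 0" and e: "e > 0"
  shows "\<exists>s \<rho>. 0 < s \<and> s < e \<and> \<bar>\<rho>\<bar> \<le> e \<and> N (\<lambda>x. \<phi> x + s * (u x + \<rho> * \<phi> x)) = 0"
proof -
  let ?P = "abs_lsq \<phi>" and ?v = "\<lambda>\<rho> x. u x + \<rho> * \<phi> x"
  have L: "L2 u" using u by (simp add: adm_def)
  have absv: "abs_lsq (?v \<rho>) = abs_lsq u + \<rho> *\<^sub>R ?P" for \<rho>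
    by (simp add: abs_lsq_add abs_lsq_scale L2_scale L \<phi>_L2)
  have av: "adm (?v \<rho>)" for \<rho> by (intro adm_add adm_scale adm_\<phi> u)
  have hv: "h1 (abs_lsq (?v \<rho>))" for \<rho> unfolding absv by (intro h1_add h1_scaleR u \<phi>_h1)
  have Bv: "B ?P (abs_lsq (?v \<rho>)) = \<rho> * B ?P ?P" for \<rho>
    unfolding absv by (simp add: B_right u h1_scaleR \<phi>_h1)
  have "B ?P (abs_lsq (?v e)) < 0" unfolding Bv by (rule mult_pos_neg[OF e B_\<phi>_neg])
  from DERIV_neg_dec_right[OF N_\<phi>_deriv[OF av hv] this]
  obtain d1 where d1: "d1 > 0" "\<And>h. 0 < h \<Longrightarrow> h < d1 \<Longrightarrow> N (\<lambda>x. \<phi> x + h * ?v e x) < 0"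
    using N_\<phi> by auto
  have "B ?P (abs_lsq (?v (- e))) > 0" 
    unfolding Bv by (rule mult_neg_neg[OF _ B_\<phi>_neg]) (use e in simp)
  from DERIV_pos_inc_right[OF N_\<phi>_deriv[OF av hv] this]
  obtain d2 where d2: "d2 > 0" "\<And>h. 0 < h \<Longrightarrow> h < d2 \<Longrightarrow> 0 < N (\<lambda>x. \<phi> x + h * ?v (- e) x)"
    using N_\<phi> by auto
  \<comment> \<open>Below \<open>d1\<close> and \<open>d2\<close>, the functional has opposite signs
    at \<open>\<rho> = e\<close> and \<open>\<rho> = - e\<close>; the bound by \<open>e\<close> lets
    the points approach \<phi>.\<close>
  define s where "s = min (min d1 d2) e / 2"
  have s: "0 < s" "s < d1" "s < d2" "s < e" using d1 d2 e by (auto simp: s_def)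
  \<comment> \<open>With \<open>s\<close> fixed the competitor is affine in \<open>\<rho>\<close>,
    so continuity along lines is what the intermediate value theorem requires.\<close>
  have eq: "(\<lambda>x. \<phi> x + s * ?v \<rho> x) = (\<lambda>x. (\<phi> x + s * u x) + \<rho> * (s * \<phi> x))" for \<rho>
    by (simp add: algebra_simps)
  have h0: "h1 (abs_lsq (\<lambda>x. \<phi> x + s * u x))" "h1 (abs_lsq (\<lambda>x. s * \<phi> x))"
    using u \<phi>_h1 by (simp_all add: abs_lsq_add abs_lsq_scale L2_scale L \<phi>_L2 h1_add h1_scaleR)
  have cont: "isCont (\<lambda>\<rho>. N (\<lambda>x. \<phi> x + s * ?v \<rho> x)) \<rho>" for \<rho>
    unfolding eq by (intro N_line_continuous adm_add adm_scale adm_\<phi> u h0)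
  have "\<exists>\<rho>. - e \<le> \<rho> \<and> \<rho> \<le> e \<and> N (\<lambda>x. \<phi> x + s * ?v \<rho> x) = 0"
    by (rule IVT2) (use d1(2)[OF s(1,2)] d2(2)[OF s(1,3)] e cont in auto)
  then obtain \<rho> where "- e \<le> \<rho>" "\<rho> \<le> e" "N (\<lambda>x. \<phi> x + s * ?v \<rho> x) = 0" by blast
  then show ?thesis using s by (intro exI[of _ s] exI[of _ \<rho>]) (auto simp: abs_le_iff)
qed

theorem B_nonneg_on_tangent:
  assumes u: "adm u" "h1 (abs_lsq u)" "B (abs_lsq \<phi>) (abs_lsq u) = 0"
  shows "B (abs_lsq u) (abs_lsq u) \<ge> 0"
proof -
  let ?P = "abs_lsq \<phi>" and ?U = "abs_lsq u"
  let ?v = "\<lambda>\<rho> x. u x + \<rho> * \<phi> x"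
  have L: "L2 u" using u by (simp add: adm_def)
  have absv: "abs_lsq (?v \<rho>) = ?U + \<rho> *\<^sub>R ?P" for \<rho>
    by (simp add: abs_lsq_add abs_lsq_scale L2_scale L \<phi>_L2)
  have av: "adm (?v \<rho>)" for \<rho> by (intro adm_add adm_scale adm_\<phi> u)
  have Lv: "L2 (?v \<rho>)" for \<rho> using av by (simp add: adm_def)
  have hv: "h1 (abs_lsq (?v \<rho>))" for \<rho> unfolding absv by (intro h1_add h1_scaleR u \<phi>_h1)
  have P0: "norm ?P > 0" using B_\<phi>_neg by (auto simp: B_def dirichlet_def wpd_eq[OF wd_zero])
  \<comment> \<open>The first factor keeps the perturbation shorter than \<phi>, so that the
    competitor is nonzero; the second sends both parameters to 0.\<close>
  define e where "e n = min 1 (norm ?P / (norm ?U + norm ?P + 1)) * inverse (real (Suc n))" for n :: nat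
  have e1: "min 1 (norm ?P / (norm ?U + norm ?P + 1)) > 0" using P0 by (simp add: add_nonneg_pos)
  have e_pos: "e n > 0" for n using e1 by (simp add: e_def)
  have e_le: "e n \<le> 1" "e n \<le> norm ?P / (norm ?U + norm ?P + 1)" for n
  proof -
    have "e n \<le> min 1 (norm ?P / (norm ?U + norm ?P + 1)) * 1"
      unfolding e_def using e1 by (intro mult_left_mono) (auto simp: field_simps)
    then show "e n \<le> 1" "e n \<le> norm ?P / (norm ?U + norm ?P + 1)" by auto
  qed
  have e_lim: "e \<longlonglongrightarrow> 0"
    using tendsto_mult[OF tendsto_const LIMSEQ_inverse_real_of_nat] by (simp add: e_def[abs_def])
  obtain s \<rho> where s: "\<And>n. 0 < s n" "\<And>n. s n < e n" and \<rho>: "\<And>n. \<bar>\<rho> n\<bar> \<le> e n"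
    and N0: "\<And>n. N (\<lambda>x. \<phi> x + s n * ?v (\<rho> n) x) = 0"
    using constraint_curve[OF u e_pos] by metis
  have s_lim: "s \<longlonglongrightarrow> 0"
    by (rule tendsto_sandwich[OF _ _ tendsto_const e_lim]) (intro always_eventually allI less_imp_le s)+
  have \<rho>_lim: "\<rho> \<longlonglongrightarrow> 0"
    by (rule Lim_null_comparison[OF _ e_lim]) (use \<rho> in auto)
  let ?D = "\<lambda>n. \<integral>x. (F (\<phi> x + s n * ?v (\<rho> n) x) - F (\<phi> x) - s n * ?v (\<rho> n) x * f (\<phi> x)) / (s n)\<^sup>2 \<partial>lebesgue"
  \<comment> \<open>The weak equation cancels the terms of order \<open>s n\<close>, and
    \<open>S ?w - S \<phi>\<close> becomes \<open>(s n)\<^sup>2\<close> times the displayed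
    expression.\<close>
  have nonneg: "0 \<le> 1/2 * E (?v (\<rho> n)) - ?D n" for n
  proof -
    let ?w = "\<lambda>x. \<phi> x + s n * ?v (\<rho> n) x"
    have aw: "adm ?w" by (intro adm_add[OF adm_\<phi>] adm_scale[OF av])
    have absw: "abs_lsq ?w = ?P + s n *\<^sub>R abs_lsq (?v (\<rho> n))"
      by (simp add: abs_lsq_add abs_lsq_scale L2_scale Lv \<phi>_L2)
    have hw: "h1 (abs_lsq ?w)" unfolding absw by (intro h1_add h1_scaleR hv \<phi>_h1)
    have "abs_lsq ?w \<noteq> 0"
    proof
      assume "abs_lsq ?w = 0"
      then have "norm ?P = norm (s n *\<^sub>R abs_lsq (?v (\<rho> n)))"
        unfolding absw by (metis add_eq_0_iff norm_minus_cancel)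
      also have "\<dots> \<le> s n * (norm ?U + norm ?P)"
      proof -
        have "norm (abs_lsq (?v (\<rho> n))) \<le> norm ?U + norm (\<rho> n *\<^sub>R ?P)" unfolding absv by (rule norm_triangle_ineq)
        also have "norm (\<rho> n *\<^sub>R ?P) \<le> 1 * norm ?P"
          unfolding norm_scaleR using \<rho>[of n] e_le(1)[of n] by (intro mult_right_mono) auto
        finally show ?thesis using s(1)[of n] by simp
      qed
      also have "\<dots> < s n * (norm ?U + norm ?P + 1)" using s(1)[of n] by simp
      also have "\<dots> \<le> norm ?P / (norm ?U + norm ?P + 1) * (norm ?U + norm ?P + 1)"
        using s(2)[of n] e_le(2)[of n] by (intro mult_right_mono) auto
      also have "\<dots> = norm ?P"
      proof -
        have "norm ?U + norm ?P + 1 \<noteq> 0" using norm_ge_zero[of ?U] norm_ge_zero[of ?P] by linarith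
        then show ?thesis by simp
      qed
      finally show False by simp
    qed
    from minimal[OF aw hw this N0] have le: "S \<phi> \<le> S ?w" .
    have SE: "S w = 1/2 * E w - (\<integral>x. F (w x) \<partial>lebesgue)" for w by (simp add: S_def E_def algebra_simps)
    have i: "integrable lebesgue (\<lambda>x. F (?w x))" "integrable lebesgue (\<lambda>x. F (\<phi> x))"
      by (intro integrable_nonlinear(5) aw adm_\<phi>)+
    have i2: "integrable lebesgue (\<lambda>x. s n * ?v (\<rho> n) x * f (\<phi> x))"
      using L2_mult_integrable[OF L2_scale[OF Lv, of "s n" "\<rho> n"] f\<phi>_L2] by simp
    have "E2 \<phi> (?v (\<rho> n)) = (\<integral>x. f (\<phi> x) * ?v (\<rho> n) x \<partial>lebesgue)"
      using weak_eq[OF Lv hv] by (simp add: E2_def)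
    then have w: "s n * E2 \<phi> (?v (\<rho> n)) = (\<integral>x. s n * ?v (\<rho> n) x * f (\<phi> x) \<partial>lebesgue)"
      by (simp add: mult.assoc mult.commute[of "f _"] flip: integral_mult_right_zero)
    have "(s n)\<^sup>2 * ?D n = (\<integral>x. F (?w x) - F (\<phi> x) - s n * ?v (\<rho> n) x * f (\<phi> x) \<partial>lebesgue)"
      using s(1)[of n] by simp
    also have "\<dots> = (\<integral>x. F (?w x) \<partial>lebesgue) - (\<integral>x. F (\<phi> x) \<partial>lebesgue) - s n * E2 \<phi> (?v (\<rho> n))"
      unfolding w using i i2 by simp
    finally have "(s n)\<^sup>2 * (1/2 * E (?v (\<rho> n)) - ?D n) = S ?w - S \<phi>"
      unfolding SE E_line[OF \<phi>_L2 \<phi>_h1 Lv hv] by (simp add: algebra_simps)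
    then have "0 \<le> (s n)\<^sup>2 * (1/2 * E (?v (\<rho> n)) - ?D n)" using le by simp
    then show ?thesis using s(1)[of n] by (simp add: zero_le_mult_iff)
  qed
  have "?D \<longlonglongrightarrow> (\<integral>x. 1/2 * f' (\<phi> x) * (u x)\<^sup>2 \<partial>lebesgue)"
    by (rule integral_F_second_order[OF adm_\<phi> u(1) s_lim _ \<rho>_lim]) (use s(1) in \<open>simp add: less_imp_neq[symmetric]\<close>)
  moreover have "(\<lambda>n. E (?v (\<rho> n))) \<longlonglongrightarrow> E u + 2 * 0 * E2 u \<phi> + 0\<^sup>2 * E \<phi>"
    unfolding E_line[OF L u(2) \<phi>_L2 \<phi>_h1] by (intro tendsto_intros \<rho>_lim)
  ultimately have "(\<lambda>n. 1/2 * E (?v (\<rho> n)) - ?D n) \<longlonglongrightarrow>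
     1/2 * (E u + 2 * 0 * E2 u \<phi> + 0\<^sup>2 * E \<phi>) - (\<integral>x. 1/2 * f' (\<phi> x) * (u x)\<^sup>2 \<partial>lebesgue)"
    by (intro tendsto_intros)
  then have "0 \<le> 1/2 * (E u + 2 * 0 * E2 u \<phi> + 0\<^sup>2 * E \<phi>) - (\<integral>x. 1/2 * f' (\<phi> x) * (u x)\<^sup>2 \<partial>lebesgue)"
    by (rule LIMSEQ_le_const) (use nonneg in blast)
  then have "0 \<le> 1/2 * (E u - (\<integral>x. f' (\<phi> x) * (u x)\<^sup>2 \<partial>lebesgue))"
    by (simp add: mult.assoc)
  moreover have "E u - (\<integral>x. f' (\<phi> x) * (u x)\<^sup>2 \<partial>lebesgue) = B ?U ?U"
  proof -
    have i: "integrable lebesgue (\<lambda>x. \<omega> * (u x * u x))" "integrable lebesgue (\<lambda>x. vp x * u x * u x)"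
      by (intro integrable_mult_right L2_mult_integrable L L2_mult_bounded[OF vp_measurable vp_bounded])+
    have "(\<integral>x. f' (\<phi> x) * (u x)\<^sup>2 \<partial>lebesgue) = (\<integral>x. \<omega> * (u x * u x) - vp x * u x * u x \<partial>lebesgue)"
      by (rule Bochner_Integration.integral_cong) (auto simp: vp_def power2_eq_square algebra_simps)
    also have "\<dots> = \<omega> * inner ?U ?U - inner (mulop vp ?U) ?U"
      using i by (simp add: inner_abs_lsq[OF L L] inner_mulop_vp[OF L L])
    finally show ?thesis by (simp add: E_def B_def)
  qed
  ultimately show ?thesis by simp
qed

text \<open>Ball averages are bounded, hence admissible, and subtracting multiples of \<phi>
  preserves admissibility; so \<open>B_nonneg_extend\<close> applies with admissibility as its
  predicate.\<close>

theorem B_nonneg: "h1 u \<Longrightarrow> B (abs_lsq \<phi>) u = 0 \<Longrightarrow> B u u \<ge> 0"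
proof -
  obtain T :: "nat \<Rightarrow> 'n lsq \<Rightarrow> 'n lsq" where
    T: "\<And>n u. \<exists>k. AE x in lebesgue. \<bar>rep_lsq (T n u) x\<bar> \<le> k" "\<And>u. (\<lambda>n. T n u) \<longlonglongrightarrow> u"
    "\<And>n i u w. wd i u w \<Longrightarrow> wd i (T n u) (T n w)"
    by (rule bounded_approximation, rule that, assumption+)
  have adm_bdd: "adm (rep_lsq z)" if k: "AE x in lebesgue. \<bar>rep_lsq z x\<bar> \<le> k" for z :: "'n lsq" and k
    unfolding adm_def
  proof
    show "integrable lebesgue (\<lambda>x. \<bar>rep_lsq z x\<bar> powr q)"
    proof (rule Bochner_Integration.integrable_bound)
      show "integrable lebesgue (\<lambda>x. k powr (q - 2) * (rep_lsq z x)\<^sup>2)"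
        using L2_rep[of z] by (simp add: L2_real)
      show "AE x in lebesgue. norm (\<bar>rep_lsq z x\<bar> powr q) \<le> norm (k powr (q - 2) * (rep_lsq z x)\<^sup>2)"
        using k
      proof eventually_elim
        case (elim x)
        have "\<bar>rep_lsq z x\<bar> powr q = \<bar>rep_lsq z x\<bar> powr (q - 2) * (rep_lsq z x)\<^sup>2"
          using powr_q_split(3)[of "\<bar>rep_lsq z x\<bar>"] by simp
        also have "\<dots> \<le> k powr (q - 2) * (rep_lsq z x)\<^sup>2"
          using elim q by (intro mult_right_mono powr_mono2) auto
        finally show ?case by simp
      qed
      show "(\<lambda>x. \<bar>rep_lsq z x\<bar> powr q) \<in> borel_measurable lebesgue"
        using L2D(1)[OF L2_rep[of z]] by measurable
    qed
  qed (rule L2_rep)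
  let ?P = "\<lambda>z. adm (rep_lsq z)"
  assume "h1 u" "B (abs_lsq \<phi>) u = 0"
  show ?thesis
  proof (rule B_nonneg_extend[where P = ?P and T = T, OF B_\<phi>_neg _ _ _ T(2,3)])
    show "B u u \<ge> 0" if "?P u" "h1 u" "B (abs_lsq \<phi>) u = 0" for u
      using B_nonneg_on_tangent[of "rep_lsq u"] that by simp
    show "?P (T n u)" for n using T(1) adm_bdd by blast
    show "?P (u - c *\<^sub>R abs_lsq \<phi>)" if "?P u" for u c
    proof -
      let ?w = "\<lambda>x. rep_lsq u x + (- c) * \<phi> x"
      have aw: "adm ?w" by (intro adm_add that adm_scale adm_\<phi>)
      have Lw: "L2 ?w" using aw by (simp add: adm_def)
      have "u - c *\<^sub>R abs_lsq \<phi> = abs_lsq ?w"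
        using abs_lsq_add[OF L2_rep L2_scale[OF \<phi>_L2], of u "- c"] abs_lsq_scale[OF \<phi>_L2, of "- c"] by simp
      then have ae: "AE x in lebesgue. rep_lsq (u - c *\<^sub>R abs_lsq \<phi>) x = ?w x"
        using rep_abs_AE[OF Lw] by simp
      have "integrable lebesgue (\<lambda>x. \<bar>rep_lsq (u - c *\<^sub>R abs_lsq \<phi>) x\<bar> powr q)"
      proof (rule integrable_cong_AE_imp)
        show "integrable lebesgue (\<lambda>x. \<bar>?w x\<bar> powr q)" using aw unfolding adm_def by blast
        show "AE x in lebesgue. \<bar>?w x\<bar> powr q = \<bar>rep_lsq (u - c *\<^sub>R abs_lsq \<phi>) x\<bar> powr q"
          using ae by eventually_elim simp
      qed (use L2D(1)[OF L2_rep] in measurable)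
      then show ?thesis by (simp add: adm_def L2_rep)
    qed
  qed (assumption | fact)+
qed

end

subsection \<open>Weak derivatives of functions and of classes\<close>

text \<open>The two candidates need not be square integrable, so uniqueness rests on the fundamental
  lemma and not on \<open>wd_unique\<close>.\<close>

lemma is_weak_deriv_unique:
  fixes u w1 w2 :: "real^'n \<Rightarrow> real"
  assumes "is_weak_deriv i u w1" "is_weak_deriv i u w2"
  shows "AE x in lebesgue. w1 x = w2 x"
proof -
  have "AE x in lebesgue. w1 x - w2 x = 0"
  proof (rule fundamental_lemma)
    show "(\<lambda>x. w1 x - w2 x) \<in> borel_measurable lebesgue"
      using assms by (auto simp: is_weak_deriv_def)
    fix \<phi> :: "real^'n \<Rightarrow> real" assume t: "test_fun \<phi>"
    then have i: "integrable lebesgue (\<lambda>x. \<phi> x * w1 x)" "integrable lebesgue (\<lambda>x. \<phi> x * w2 x)"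
      and e: "(\<integral>x. \<phi> x * w1 x \<partial>lebesgue) = (\<integral>x. \<phi> x * w2 x \<partial>lebesgue)"
      using assms by (auto simp: is_weak_deriv_def)
    show "integrable lebesgue (\<lambda>x. \<phi> x * (w1 x - w2 x))" "(\<integral>x. \<phi> x * (w1 x - w2 x) \<partial>lebesgue) = 0"
      using i e by (simp_all add: right_diff_distrib)
  qed
  then show ?thesis by simp
qed

lemma is_weak_deriv_wderiv: "is_weak_deriv i u w \<Longrightarrow> is_weak_deriv i u (wderiv i u)"
  unfolding wderiv_def by (rule someI[of "is_weak_deriv i u"])

text \<open>The chosen \<open>wderiv\<close> agrees almost everywhere with the square-integrable
  derivative provided by \<open>H1\<close>, and thereby inherits its integrability and its
  class.\<close>

lemma H1_imp:
  fixes u :: "real^'n::finite \<Rightarrow> real"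
  assumes "H1 u"
  shows "L2 u" "h1 (abs_lsq u)" "L2 (wderiv i u)" "abs_lsq (wderiv i u) = wpd i (abs_lsq u)"
    "is_weak_deriv i u (wderiv i u)"
proof -
  show L: "L2 u" using assms by (simp add: H1_def)
  have ex: "\<exists>w. is_weak_deriv i u w \<and> L2 w" for i using assms by (simp add: H1_def)
  then show "h1 (abs_lsq u)" unfolding h1_def using wd_abs_iff[OF L] by blast
  obtain w where w: "is_weak_deriv i u w" "L2 w" using ex by blast
  show wd: "is_weak_deriv i u (wderiv i u)" using w(1) by (rule is_weak_deriv_wderiv)
  show L': "L2 (wderiv i u)"
    by (rule L2_cong_AE[OF w(2) _ is_weak_deriv_unique[OF w(1) wd]]) (use wd in \<open>simp add: is_weak_deriv_def\<close>)
  show "abs_lsq (wderiv i u) = wpd i (abs_lsq u)"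
    using wd wd_abs_iff[OF L L'] wpd_eq by metis
qed

lemma H1_iff: "H1 u \<longleftrightarrow> L2 u \<and> h1 (abs_lsq u)" for u :: "real^'n::finite \<Rightarrow> real"
proof
  assume "L2 u \<and> h1 (abs_lsq u)"
  then have L: "L2 u" and h: "h1 (abs_lsq u)" by auto
  have "is_weak_deriv i u (rep_lsq (wpd i (abs_lsq u)))" for i
    using wd_wpd[OF h, of i] wd_abs_iff[OF L L2_rep, of i "wpd i (abs_lsq u)"] by simp
  then show "H1 u" using L L2_rep unfolding H1_def by blast
qed (use H1_imp in blast)

lemma H2_iff: "H2 u \<longleftrightarrow> L2 u \<and> h1 (abs_lsq u) \<and> (\<forall>i. h1 (wpd i (abs_lsq u)))"
  for u :: "real^'n::finite \<Rightarrow> real"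
proof (cases "H1 u")
  case True
  then have "H1 (wderiv i u) \<longleftrightarrow> h1 (wpd i (abs_lsq u))" for i
    using H1_iff[of "wderiv i u"] H1_imp(3,4)[OF True, of i] by simp
  then show ?thesis using True H1_iff[of u] by (simp add: H2_def)
next
  case False
  then show ?thesis using H1_iff[of u] unfolding H2_def by blast
qed

lemma L2_sum:
  fixes u :: "'i \<Rightarrow> real^'n::finite \<Rightarrow> real"
  assumes "finite I" "\<And>i. i \<in> I \<Longrightarrow> L2 (u i)"
  shows "L2 (\<lambda>x. \<Sum>i\<in>I. u i x) \<and> abs_lsq (\<lambda>x. \<Sum>i\<in>I. u i x) = (\<Sum>i\<in>I. abs_lsq (u i))"
  using assms
proof (induction I)
  case empty
  then show ?case by (simp flip: zero_lsq.abs_eq)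
next
  case (insert i I)
  then show ?case by (auto simp: L2_add abs_lsq_add)
qed

lemma wlap_abs:
  fixes u :: "real^'n::finite \<Rightarrow> real"
  assumes "H2 u"
  shows "L2 (wlap u)" "abs_lsq (wlap u) = (\<Sum>i\<in>UNIV. wpd i (wpd i (abs_lsq u)))"
proof -
  have h: "H1 u" "H1 (wderiv i u)" for i using assms by (simp_all add: H2_def)
  have "L2 (wderiv i (wderiv i u))" "abs_lsq (wderiv i (wderiv i u)) = wpd i (wpd i (abs_lsq u))" for i
    using H1_imp[OF h(2)] H1_imp[OF h(1)] by simp_all
  then show "L2 (wlap u)" "abs_lsq (wlap u) = (\<Sum>i\<in>UNIV. wpd i (wpd i (abs_lsq u)))"
    using L2_sum[of UNIV "\<lambda>i. wderiv i (wderiv i u)"] by (simp_all add: wlap_def[abs_def])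
qed

lemma integral_wderiv_mult:
  fixes u v :: "real^'n::finite \<Rightarrow> real"
  assumes "H1 u" "H1 v"
  shows "(\<integral>x. (\<Sum>i\<in>UNIV. wderiv i u x * wderiv i v x) \<partial>lebesgue) = dirichlet (abs_lsq u) (abs_lsq v)"
proof -
  have "integrable lebesgue (\<lambda>x. wderiv i u x * wderiv i v x)" for i
    by (intro L2_mult_integrable H1_imp assms)
  then show ?thesis
    by (simp add: dirichlet_def inner_abs_lsq H1_imp(3) assms flip: H1_imp(4)[OF assms(1)] H1_imp(4)[OF assms(2)])
qed

section \<open>Real functions viewed as complex ones\<close>

lemma is_weak_deriv_complex:
  fixes u w :: "real^'n::finite \<Rightarrow> real"
  assumes "is_weak_deriv i u w"
  shows "is_weak_deriv i (\<lambda>x. complex_of_real (u x)) (\<lambda>x. complex_of_real (w x))"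
proof -
  have s: "a *\<^sub>R complex_of_real b = complex_of_real (a * b)" for a b by (simp add: scaleR_conv_of_real)
  show ?thesis using assms
    unfolding is_weak_deriv_def s integral_complex_of_real
    by (auto simp del: of_real_mult simp flip: of_real_minus)
qed

text \<open>A chosen weak derivative of a real function viewed as complex might have an imaginary
  part; being a weak derivative of 0, that part vanishes almost everywhere by uniqueness.\<close>

lemma is_weak_deriv_Re_Im:
  fixes u :: "real^'n::finite \<Rightarrow> real" and w :: "real^'n \<Rightarrow> complex"
  assumes "is_weak_deriv i (\<lambda>x. complex_of_real (u x)) w"
  shows "is_weak_deriv i u (\<lambda>x. Re (w x))" "is_weak_deriv i (\<lambda>x. 0 :: real) (\<lambda>x. Im (w x))"
proof -
  have m [measurable]: "w \<in> borel_measurable lebesgue" using assms by (simp add: is_weak_deriv_def)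
  have "integrable lebesgue (\<lambda>x. frechet_derivative \<phi> (at x) (axis i 1) * u x) \<and>
     integrable lebesgue (\<lambda>x. \<phi> x * Re (w x)) \<and> integrable lebesgue (\<lambda>x. \<phi> x * Im (w x)) \<and>
     (\<integral>x. frechet_derivative \<phi> (at x) (axis i 1) * u x \<partial>lebesgue) = - (\<integral>x. \<phi> x * Re (w x) \<partial>lebesgue) \<and>
     0 = - (\<integral>x. \<phi> x * Im (w x) \<partial>lebesgue)" if "test_fun \<phi>" for \<phi>
  proof -
    let ?d = "\<lambda>x. frechet_derivative \<phi> (at x) (axis i 1)"
    have i: "integrable lebesgue (\<lambda>x. ?d x *\<^sub>R complex_of_real (u x))" "integrable lebesgue (\<lambda>x. \<phi> x *\<^sub>R w x)"
      and e: "(\<integral>x. ?d x *\<^sub>R complex_of_real (u x) \<partial>lebesgue) = - (\<integral>x. \<phi> x *\<^sub>R w x \<partial>lebesgue)"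
      using assms that by (auto simp: is_weak_deriv_def)
    note R = integrable_Re[OF i(1)] integrable_Re[OF i(2)] integrable_Im[OF i(2)] 
      integral_Re[OF i(1)] integral_Re[OF i(2)] integral_Im[OF i(1)] integral_Im[OF i(2)]
    show ?thesis using R e by (auto simp: complex_eq_iff)
  qed
  then show "is_weak_deriv i u (\<lambda>x. Re (w x))" "is_weak_deriv i (\<lambda>x. 0 :: real) (\<lambda>x. Im (w x))"
    by (auto simp: is_weak_deriv_def)
qed

lemma H1_complex:
  fixes u :: "real^'n::finite \<Rightarrow> real"
  assumes u: "H1 u"
  shows "H1 (\<lambda>x. complex_of_real (u x))"
    "AE x in lebesgue. wderiv i (\<lambda>x. complex_of_real (u x)) x = complex_of_real (wderiv i u x)"
proof -
  have L: "L2 (\<lambda>x. complex_of_real (v x))" if "L2 v" for v :: "real^'n \<Rightarrow> real"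
    using that by (auto simp: L2_def)
  show "H1 (\<lambda>x. complex_of_real (u x))"
    unfolding H1_def using H1_imp[OF u] is_weak_deriv_complex L by blast
  have "is_weak_deriv i (\<lambda>x. complex_of_real (u x)) (wderiv i (\<lambda>x. complex_of_real (u x)))"
    by (rule is_weak_deriv_wderiv[OF is_weak_deriv_complex[OF H1_imp(5)[OF u]]])
  note ri = is_weak_deriv_Re_Im[OF this]
  have z: "is_weak_deriv i (\<lambda>x::real^'n. 0 :: real) (\<lambda>x. 0 :: real)" by (simp add: is_weak_deriv_def)
  show "AE x in lebesgue. wderiv i (\<lambda>x. complex_of_real (u x)) x = complex_of_real (wderiv i u x)"
    using is_weak_deriv_unique[OF ri(1) H1_imp(5)[OF u]] is_weak_deriv_unique[OF ri(2) z]
    by eventually_elim (simp add: complex_eq_iff)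
qed

lemma integral_grad_sq_complex:
  fixes u :: "real^'n::finite \<Rightarrow> real"
  assumes u: "H1 u"
  shows "(\<integral>x. grad_sq (\<lambda>x. complex_of_real (u x)) x \<partial>lebesgue) = dirichlet (abs_lsq u) (abs_lsq u)"
proof -
  have "AE x in lebesgue. \<forall>i. wderiv i (\<lambda>x. complex_of_real (u x)) x = complex_of_real (wderiv i u x)"
    unfolding AE_all_countable by (intro allI H1_complex(2)[OF u])
  then have ae: "AE x in lebesgue. grad_sq (\<lambda>x. complex_of_real (u x)) x = (\<Sum>i\<in>UNIV. wderiv i u x * wderiv i u x)"
    by eventually_elim (simp add: grad_sq_def power2_eq_square flip: abs_mult)
  have m: "(\<lambda>x. \<Sum>i\<in>UNIV. wderiv i u x * wderiv i u x) \<in> borel_measurable lebesgue"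
    using H1_imp(3)[OF u] by (intro borel_measurable_sum borel_measurable_times L2D(1))
  have "wderiv i (\<lambda>x. complex_of_real (u x)) \<in> borel_measurable lebesgue" for i
    using is_weak_deriv_wderiv[OF is_weak_deriv_complex[OF H1_imp(5)[OF u]]]
    by (simp add: is_weak_deriv_def)
  note [measurable] = this
  have m': "grad_sq (\<lambda>x. complex_of_real (u x)) \<in> borel_measurable lebesgue"
    unfolding grad_sq_def[abs_def]
    by measurable
  show ?thesis unfolding integral_wderiv_mult[OF u u, symmetric] by (rule integral_cong_AE[OF m' m ae])
qed

lemma nehari_real:
  fixes u :: "real^'n::finite \<Rightarrow> real"
  assumes u: "H1 u"
  shows "nehari g \<omega> (\<lambda>x. complex_of_real (u x)) = dirichlet (abs_lsq u) (abs_lsq u)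
     + \<omega> * inner (abs_lsq u) (abs_lsq u) - (\<integral>x. \<bar>u x\<bar> powr crit TYPE('n) \<partial>lebesgue)
     - (\<integral>x. gr g \<bar>u x\<bar> * \<bar>u x\<bar> \<partial>lebesgue)"
  unfolding nehari_def integral_grad_sq_complex[OF u]
  by (simp add: inner_abs_lsq H1_imp(1)[OF u] power2_eq_square)

lemma action_real:
  fixes u :: "real^'n::finite \<Rightarrow> real"
  assumes u: "H1 u"
  shows "action g \<omega> (\<lambda>x. complex_of_real (u x)) = 1/2 * dirichlet (abs_lsq u) (abs_lsq u)
     + \<omega>/2 * inner (abs_lsq u) (abs_lsq u) - 1 / crit TYPE('n) * (\<integral>x. \<bar>u x\<bar> powr crit TYPE('n) \<partial>lebesgue)
     - (\<integral>x. Gp g \<bar>u x\<bar> \<partial>lebesgue)"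
  unfolding action_def integral_grad_sq_complex[OF u]
  by (simp add: inner_abs_lsq H1_imp(1)[OF u] power2_eq_square)

lemma is_zero_complex: "is_zero (\<lambda>x. complex_of_real (u x)) \<longleftrightarrow> is_zero u"
  by (simp add: is_zero_def)

lemma is_zero_abs: "L2 u \<Longrightarrow> is_zero u \<longleftrightarrow> abs_lsq u = 0"
  for u :: "real^'n::finite \<Rightarrow> real"
  by (simp add: is_zero_def abs_lsq_eq_0_iff)

theorem theorem1p9:
  fixes g :: "complex \<Rightarrow> complex" and \<omega> :: real and \<Phi> :: "real^'n \<Rightarrow> real"
  assumes d3: "CARD('n) \<ge> 3"
    and g: "g_assms TYPE('n) g"
    and \<omega>: "\<omega> > 0"
    and gs: "ground_state g \<omega> (\<lambda>x. complex_of_real (\<Phi> x))"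
    and eq: "AE x in lebesgue. - wlap \<Phi> x + \<omega> * \<Phi> x
                 - \<bar>\<Phi> x\<bar> powr (4 / (real CARD('n) - 2)) * \<Phi> x - gr g (\<Phi> x) = 0"
    and H2: "H2 \<Phi>" and C2: "C2_fun \<Phi>"
    and pos: "\<forall>x. \<Phi> x > 0"
    and radial: "\<forall>x y. norm x = norm y \<longrightarrow> \<Phi> x = \<Phi> y"
    and decr: "\<forall>x y. norm x < norm y \<longrightarrow> \<Phi> y < \<Phi> x"
  shows "(\<forall>u :: real^'n \<Rightarrow> real. H1 u \<and>
            ((\<lambda>s. nehari g \<omega> (\<lambda>x. complex_of_real (\<Phi> x + s * u x))) has_real_derivative 0) (at 0)
            \<longrightarrow> Bform g \<omega> \<Phi> u u \<ge> 0)
       \<and> (\<exists>lam0<0. (\<forall>lam<0. (\<exists>u. Lp_eigen g \<omega> \<Phi> lam u \<and> \<not> is_zero u) \<longrightarrow> lam = lam0) \<and>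
             (\<exists>e. Lp_eigen g \<omega> \<Phi> lam0 e \<and> \<not> is_zero e \<and>
                  (\<forall>u. Lp_eigen g \<omega> \<Phi> lam0 u \<longrightarrow> (\<exists>c. AE x in lebesgue. u x = c * e x))))"
proof -
  let ?q = "crit TYPE('n)" and ?d = "real CARD('n)"
  have d: "?d - 2 > 0" using d3 by linarith
  have q1: "(?d + 2) / (?d - 2) = ?q - 1" and q2: "4 / (?d - 2) = ?q - 2"
    using d by (simp_all add: crit_def dimR_def field_simps)
  obtain K where nl: "nonlinearity ?q K (gr g) (deriv (gr g)) (\<lambda>t. Gp g \<bar>t\<bar>)"
    by (rule g_assms_nonlinearity[OF d3 g])
  interpret NL: nonlinearity ?q K "gr g" "deriv (gr g)" "\<lambda>t. Gp g \<bar>t\<bar>" by (rule nl)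
  have \<Phi>1: "H1 \<Phi>" using H2 by (simp add: H2_def)
  have L\<Phi>: "L2 \<Phi>" and h\<Phi>: "h1 (abs_lsq \<Phi>)" using H1_imp[OF \<Phi>1] by auto
  have h2\<Phi>: "h1 (wpd i (abs_lsq \<Phi>))" for i using H2 H2_iff by blast
  \<comment> \<open>Strict decrease makes \<open>\<Phi> 0\<close> the upper bound. Integrating the
    Laplacian by parts against a general \<open>v\<close> turns the almost everywhere equation into
    the weak one.\<close>
  interpret G: ground ?q K "gr g" "deriv (gr g)" "\<lambda>t. Gp g \<bar>t\<bar>" \<Phi> \<omega> "\<Phi> 0"
  proof unfold_locales
    show "\<Phi> x > 0" for x using pos by blast
    show "\<Phi> x \<le> \<Phi> 0" for x using decr by (cases "x = 0") (auto intro: less_imp_le)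
    show "L2 \<Phi>" by (rule L\<Phi>)
    show "h1 (abs_lsq \<Phi>)" by (rule h\<Phi>)
    fix v :: "real^'n \<Rightarrow> real" assume v: "L2 v" "h1 (abs_lsq v)"
    have "dirichlet (abs_lsq \<Phi>) (abs_lsq v) = - inner (abs_lsq (wlap \<Phi>)) (abs_lsq v)"
      unfolding dirichlet_by_parts[OF h2\<Phi> h\<Phi> v(2)] wlap_abs(2)[OF H2] by simp
    also have "\<dots> = - (\<integral>x. wlap \<Phi> x * v x \<partial>lebesgue)"
      by (simp add: inner_abs_lsq wlap_abs(1)[OF H2] v)
    finally have "dirichlet (abs_lsq \<Phi>) (abs_lsq v) + \<omega> * inner (abs_lsq \<Phi>) (abs_lsq v)
      = (\<integral>x. \<omega> * (\<Phi> x * v x) - wlap \<Phi> x * v x \<partial>lebesgue)"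
      using L2_mult_integrable[OF L\<Phi> v(1)] L2_mult_integrable[OF wlap_abs(1)[OF H2] v(1)]
      by (simp add: inner_abs_lsq L\<Phi> v)
    also have "\<dots> = (\<integral>x. NL.f (\<Phi> x) * v x \<partial>lebesgue)"
    proof (rule integral_cong_AE)
      show "AE x in lebesgue. \<omega> * (\<Phi> x * v x) - wlap \<Phi> x * v x = NL.f (\<Phi> x) * v x"
        using eq
      proof eventually_elim
        case (elim x)
        then have f: "NL.f (\<Phi> x) = \<omega> * \<Phi> x - wlap \<Phi> x" by (simp add: NL.f_def q2)
        show ?case unfolding f by (simp add: algebra_simps)
      qed
    qed (use L2D(1)[OF L\<Phi>] L2D(1)[OF v(1)] L2D(1)[OF wlap_abs(1)[OF H2]]
        NL.measurable_comp_continuous[OF NL.f_cont] in measurable)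
    finally show "dirichlet (abs_lsq \<Phi>) (abs_lsq v) + \<omega> * inner (abs_lsq \<Phi>) (abs_lsq v) = (\<integral>x. NL.f (\<Phi> x) * v x \<partial>lebesgue)" .
  qed
  have N: "nehari g \<omega> (\<lambda>x. complex_of_real (w x)) = G.N w" if "NL.adm w" "H1 w" for w
    unfolding nehari_real[OF that(2)] G.N_def NL.f_mult
    using NL.integrable_nonlinear[OF that(1)] by simp
  have S: "action g \<omega> (\<lambda>x. complex_of_real (w x)) = G.S w" if "NL.adm w" "H1 w" for w
    unfolding action_real[OF that(2)] G.S_def NL.F_abs
    using NL.integrable_nonlinear[OF that(1)] by simp
  \<comment> \<open>A real competitor is embedded as a complex function with the same values of both
    functionals, and minimality of the ground state applies to it.\<close>
  interpret M: ground_min ?q K "gr g" "deriv (gr g)" "\<lambda>t. Gp g \<bar>t\<bar>" \<Phi> \<omega> "\<Phi> 0"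
  proof unfold_locales
    show "G.N \<Phi> = 0" using gs N[OF G.adm_\<phi> \<Phi>1] by (simp add: ground_state_def)
    fix w :: "real^'n \<Rightarrow> real"
    assume w: "NL.adm w" "h1 (abs_lsq w)" "abs_lsq w \<noteq> 0" "G.N w = 0"
    have Lw: "L2 w" using w(1) by (simp add: NL.adm_def)
    then have H1w: "H1 w" using w(2) H1_iff by blast
    show "G.S \<Phi> \<le> G.S w"
      using gs H1_complex(1)[OF H1w] N[OF w(1) H1w] S[OF w(1) H1w] S[OF G.adm_\<phi> \<Phi>1] w(3,4) Lw
      by (auto simp: ground_state_def is_zero_complex is_zero_abs)
  qed
  have Vp: "Vp g \<omega> \<Phi> x = G.vp x" for x
    using pos by (simp add: Vp_def G.vp_def NL.f'_def dimR_def q1 q2 less_imp_le)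
  have B: "Bform g \<omega> \<Phi> u v = G.B (abs_lsq u) (abs_lsq v)" if "H1 u" "H1 v" for u v
    unfolding Bform_def G.B_def integral_wderiv_mult[OF that] Vp
    using H1_imp(1)[OF that(1)] H1_imp(1)[OF that(2)] by (simp add: G.inner_mulop_vp)
  have part1: "Bform g \<omega> \<Phi> u u \<ge> 0"
    if u: "H1 u" and der: "((\<lambda>s. nehari g \<omega> (\<lambda>x. complex_of_real (\<Phi> x + s * u x))) has_real_derivative 0) (at 0)"
    for u :: "real^'n \<Rightarrow> real"
  proof -
    note u' = H1_imp(1,2)[OF u]
    have hs: "H1 (\<lambda>x. \<Phi> x + s * u x)" for s
      using u' L\<Phi> h\<Phi> by (simp add: H1_iff L2_add L2_scale abs_lsq_add abs_lsq_scale h1_add h1_scaleR)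
    \<comment> \<open>Differentiability at 0 gives continuity there, and the quadratic part is a
      polynomial in \<open>s\<close>; together they force the critical power of \<open>u\<close> to
      be integrable.\<close>
    have c1: "isCont (\<lambda>s. G.E (\<lambda>x. \<Phi> x + s * u x) - (\<integral>x. \<bar>\<Phi> x + s * u x\<bar> powr ?q \<partial>lebesgue)
        - (\<integral>x. gr g \<bar>\<Phi> x + s * u x\<bar> * \<bar>\<Phi> x + s * u x\<bar> \<partial>lebesgue)) 0"
      using DERIV_isCont[OF der] unfolding nehari_real[OF hs] G.E_def by simp
    have c2: "isCont (\<lambda>s. G.E (\<lambda>x. \<Phi> x + s * u x)) 0"
      by (rule DERIV_isCont[OF G.E_line_deriv[OF L\<Phi> h\<Phi> u']])
    have "integrable lebesgue (\<lambda>x. \<bar>u x\<bar> powr ?q)"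
      by (rule NL.integrable_powr_q_if_continuous[OF G.adm_\<phi> G.\<phi>_pos u'(1) c1 c2])
    then have adm: "NL.adm u" using u' by (simp add: NL.adm_def)
    have NN: "nehari g \<omega> (\<lambda>x. complex_of_real (\<Phi> x + s * u x)) = G.N (\<lambda>x. \<Phi> x + s * u x)" for s
      by (rule N[OF _ hs]) (intro NL.adm_add NL.adm_scale G.adm_\<phi> adm)
    have "((\<lambda>s. nehari g \<omega> (\<lambda>x. complex_of_real (\<Phi> x + s * u x))) has_real_derivative
        G.B (abs_lsq \<Phi>) (abs_lsq u)) (at 0)"
      unfolding NN by (rule G.N_\<phi>_deriv[OF adm u'(2)])
    \<comment> \<open>The derivative computed for admissible directions must equal the derivative 0
      of the hypothesis.\<close>
    then have "G.B (abs_lsq \<Phi>) (abs_lsq u) = 0" using der by (rule DERIV_unique)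
    then show ?thesis unfolding B[OF u u] by (intro M.B_nonneg u')
  qed
  have eigen: "Lp_eigen g \<omega> \<Phi> lam u \<longleftrightarrow> L2 u \<and> h1 (abs_lsq u) \<and> (\<forall>i. h1 (wpd i (abs_lsq u))) \<and>
      - (\<Sum>i\<in>UNIV. wpd i (wpd i (abs_lsq u))) + mulop G.vp (abs_lsq u) = lam *\<^sub>R abs_lsq u"
    for lam and u :: "real^'n \<Rightarrow> real"
  proof -
    have "(AE x in lebesgue. Lp g \<omega> \<Phi> u x = lam * u x) \<longleftrightarrow>
      - (\<Sum>i\<in>UNIV. wpd i (wpd i (abs_lsq u))) + mulop G.vp (abs_lsq u) = lam *\<^sub>R abs_lsq u" if "H2 u"
    proof -
      have L: "L2 u" using that H2_iff by blast
      note m = mulop_abs[OF G.vp_measurable G.vp_bounded L] L2_mult_bounded[OF G.vp_measurable G.vp_bounded L]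
      have "L2 (\<lambda>x. - 1 * wlap u x + G.vp x * u x)"
        by (intro L2_add L2_scale wlap_abs(1)[OF that] m(2))
      moreover have "abs_lsq (\<lambda>x. - 1 * wlap u x + G.vp x * u x)
        = - (\<Sum>i\<in>UNIV. wpd i (wpd i (abs_lsq u))) + mulop G.vp (abs_lsq u)"
        unfolding abs_lsq_add[OF L2_scale[OF wlap_abs(1)[OF that]] m(2)] abs_lsq_scale[OF wlap_abs(1)[OF that]]
          wlap_abs(2)[OF that] m(1) by simp
      ultimately show ?thesis
        using abs_lsq_eq_iff[of "\<lambda>x. - 1 * wlap u x + G.vp x * u x" "\<lambda>x. lam * u x"] L
        by (simp add: Lp_def Vp abs_lsq_scale L2_scale)
    qed
    then show ?thesis unfolding Lp_eigen_def H2_iff by blast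
  qed
  have eigen_weak: "G.B (abs_lsq u) v = lam * inner (abs_lsq u) v"
    if "Lp_eigen g \<omega> \<Phi> lam u" "h1 v" for lam u v
  proof -
    have "inner (- (\<Sum>i\<in>UNIV. wpd i (wpd i (abs_lsq u))) + mulop G.vp (abs_lsq u)) v = inner (lam *\<^sub>R abs_lsq u) v"
      using that eigen by metis
    moreover have "dirichlet (abs_lsq u) v = - inner (\<Sum>i\<in>UNIV. wpd i (wpd i (abs_lsq u))) v"
      using that eigen by (intro dirichlet_by_parts) auto
    ultimately show ?thesis by (simp add: G.B_def inner_diff_left)
  qed
  obtain lam0 e where e: "lam0 < 0" "e \<noteq> 0" "h1 e" "\<And>v. h1 v \<Longrightarrow> G.B e v = lam0 * inner e v"
    using G.negative_eigenvalue_exists[OF M.B_nonneg G.B_\<phi>_neg] by metis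
  \<comment> \<open>The eigenvalue relation read as a Poisson equation whose right side is square
    integrable because the potential is bounded; regularity then puts \<open>e\<close> into the
    domain of the operator.\<close>
  have weak: "dirichlet e v = inner (lam0 *\<^sub>R e - mulop G.vp e) v" if "h1 v" for v
    using e(4)[OF that] by (simp add: G.B_def inner_diff_left)
  note reg = weak_solution_regular[OF e(3) weak]
  have ee: "Lp_eigen g \<omega> \<Phi> lam0 (rep_lsq e)"
    unfolding eigen abs_rep_lsq using L2_rep e(3) reg by simp
  have e0: "\<not> is_zero (rep_lsq e)" using e(2) by (simp add: is_zero_abs L2_rep)
  have uniq: "lam = lam0 \<and> (\<exists>c. AE x in lebesgue. u x = c * rep_lsq e x)"
    if u: "Lp_eigen g \<omega> \<Phi> lam u" "lam < 0" "\<not> is_zero u" for lam u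
  proof -
    have L: "L2 u" and h: "h1 (abs_lsq u)" using u(1) eigen by blast+
    have n0: "abs_lsq u \<noteq> 0" using u(3) L by (simp add: is_zero_abs)
    note nu = G.negative_direction_unique[OF M.B_nonneg e(3,4,1,2) h eigen_weak[OF u(1)] u(2) n0]
    obtain c where "abs_lsq u = c *\<^sub>R e" using nu(2) by blast
    also have "\<dots> = abs_lsq (\<lambda>x. c * rep_lsq e x)" by (simp add: abs_lsq_scale L2_rep)
    finally have "AE x in lebesgue. u x = c * rep_lsq e x" by (simp add: abs_lsq_eq_iff L L2_scale L2_rep)
    then show ?thesis using nu(1) by blast
  qed
  have uniq0: "\<exists>c. AE x in lebesgue. u x = c * rep_lsq e x" if "Lp_eigen g \<omega> \<Phi> lam0 u" for u
  proof (cases "is_zero u")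
    case True
    then show ?thesis by (intro exI[of _ 0]) (simp add: is_zero_def)
  qed (use uniq[OF that e(1)] in blast)
  show ?thesis
  proof (rule conjI)
    show "\<forall>u :: real^'n \<Rightarrow> real. H1 u \<and>
        ((\<lambda>s. nehari g \<omega> (\<lambda>x. complex_of_real (\<Phi> x + s * u x))) has_real_derivative 0) (at 0)
        \<longrightarrow> Bform g \<omega> \<Phi> u u \<ge> 0"
      using part1 by blast
    have 1: "\<forall>lam<0. (\<exists>u. Lp_eigen g \<omega> \<Phi> lam u \<and> \<not> is_zero u) \<longrightarrow> lam = lam0"
      using uniq by blast
    have 2: "\<exists>e. Lp_eigen g \<omega> \<Phi> lam0 e \<and> \<not> is_zero e \<and>
        (\<forall>u. Lp_eigen g \<omega> \<Phi> lam0 u \<longrightarrow> (\<exists>c. AE x in lebesgue. u x = c * e x))"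
      using ee e0 uniq0 by blast
    show "\<exists>lam0<0. (\<forall>lam<0. (\<exists>u. Lp_eigen g \<omega> \<Phi> lam u \<and> \<not> is_zero u) \<longrightarrow> lam = lam0) \<and>
        (\<exists>e. Lp_eigen g \<omega> \<Phi> lam0 e \<and> \<not> is_zero e \<and>
          (\<forall>u. Lp_eigen g \<omega> \<Phi> lam0 u \<longrightarrow> (\<exists>c. AE x in lebesgue. u x = c * e x)))"
      using e(1) 1 2 by (intro exI[of _ lam0] conjI)
  qed
qed

end
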